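(* In the setting described in the context, for all $n\in\overline{\mathbb N}$ and all $a\in\mathrm{dom}(L_n)$, $$\forall z\in\mathbb U^d_{k_n}\qquad \|a-\alpha_n^z(a)\|_{\mathfrak A_n}\le 2\,\mathsf{slen}(z)\,L_n(a).$$
   Context: TORI. $\mathbb N_*=\mathbb N\setminus\{0,1\}$, $\overline{\mathbb N}=\mathbb N\cup\{\infty\}$, $\overline{\mathbb N}_*=\mathbb N_*\cup\{\infty\}$ (one-point compactification), $\mathbb T=\{z\in\mathbb C:|z|=1\}$. For $q\in\mathbb N_*$ and $k\in\overline{\mathbb N}_*^q$, $\mathbb Z^q_k=\prod_{j}\mathbb Z/k(j)\mathbb Z$ with $\infty\mathbb Z=\{0\}$; $\infty^q=(\infty,\dots,\infty)$; $e_j$ is the $j$-th canonical vector of $\mathbb Z^q$ or its class in $\mathbb Z^q_k$. A normalized 2-cocycle of an Abelian group $G$ is $\sigma:G\times G\to\mathbb T$ with $\sigma(x,y)\sigma(x+y,z)=\sigma(x,y+z)\sigma(y,z)$, $\sigma(0,x)=\sigma(x,0)=1$, $\sigma(x,-x)=1$. Cocycles of $\mathbb Z^q_k$ are viewed as cocycles of $\mathbb Z^q$ via the quotient map. $\Xi^q$ is the set of pairs $(k,\sigma)$ with $k\in\overline{\mathbb N}_*^q$ and $\sigma$ a normalized 2-cocycle of $\mathbb Z^q_k$, with the topology induced from the product of $\overline{\mathbb N}_*^q$ and the normalized 2-cocycles of $\mathbb Z^q$ with pointwise convergence. For $(k,\sigma)\in\Xi^q$, $m\in\mathbb Z^q_k$: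 $W^m_{k,\sigma}$ is the unitary on $\ell^2(\mathbb Z^q_k)$ with $(W^m_{k,\sigma}\xi)(p)=\sigma(m,p-m)\xi(p-m)$; $C^*(\mathbb Z^q_k,\sigma)$ is the C*-algebra generated by all $W^m_{k,\sigma}$. $\mathbb U^q_k=\{z\in\mathbb T^q: z_j^{k(j)}=1\text{ whenever }k(j)<\infty\}$, and $z^m=\prod_j z_j^{m_j}$ for $m\in\mathbb Z^q_k$, $z\in\mathbb U^q_k$. For $z=(z_1,\dots,z_d)\in\mathbb T^d$, $\mathsf{slen}(z)=\sum_{j=1}^d\min\{|t|:t\in\mathbb R,\ e^{it}=z_j\}$. SETTING. Fix $d,d'\in\mathbb N_*$, $d\le d'$, and a fixed-point-free permutation $f$ of $\{1,\dots,d'\}$ of order $2$ with $\{d+1,\dots,d'\}\subseteq f(\{1,\dots,d\})$. For each $n\in\overline{\mathbb N}$ let $(k_n,\sigma_n)\in\Xi^d$, $(k_n',\sigma_n')\in\Xi^{d'}$ be such that: $(k_n,\sigma_n)\to(k_\infty,\sigma_\infty)$ with $k_\infty=\infty^d$; $(k'_n,\sigma'_n)\to(k'_\infty,\sigma'_\infty)$ with $k'_\infty=\infty^{d'}$; for each $j\le d$ either $k_n(j)<\infty$ for all $n\in\mathbb N$ or $k_n(j)=\infty$ for all $n\in\mathbb N$; $k'_n(f(j))=k'_n(j)=k_n(j)$ for $j\le d$; $\sigma_n$ is the restriction of $\sigma'_n$ to $\mathbb Z^d_{k_n}\times\{0\}$; and, with $U_{n,j}=W^{e_j}_{k'_n,\sigma'_n}$,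 for all $j\le d$, $s\le d'$: $U_{n,f(j)}U_{n,s}=\lambda\, U_{n,s}U_{n,f(j)}$, where $\lambda=\exp(2i\pi/k_n(j))$ if $s=j$, $k_n(j)<\infty$, $j<f(j)$; $\lambda=\exp(-2i\pi/k_n(j))$ if $s=j$, $k_n(j)<\infty$, $j>f(j)$; $\lambda=1$ otherwise. Put $\mathfrak B_n=C^*(\mathbb Z^{d'}_{k'_n},\sigma'_n)$, $\mathfrak A_n=C^*(U_{n,1},\dots,U_{n,d})\subseteq\mathfrak B_n$ (identified with $C^*(\mathbb Z^d_{k_n},\sigma_n)$), $\widehat{G_n}=\mathbb Z^{d'}_{k'_n}$, $G_n=\mathbb U^{d'}_{k'_n}$, $\mathcal H_n=\ell^2(\widehat{G_n})$, $(v_n^z\xi)(m)=z^m\xi(m)$ and $\alpha_n^z(a)=v_n^z\,a\,v_n^{\overline z}$ for $z\in G_n$, $a\in\mathfrak B_n$; $z\in\mathbb U^d_{k_n}$ is identified with $(z,1,\dots,1)\in G_n$. Let $z_{n,j}\in G_n$ have $j$-th entry $\exp(2i\pi/k'_n(j))$ (or $1$ if $k'_n(j)=\infty$) and other entries $1$. If $k_n'(j)=\infty$, $(\partial_{n,j}\xi)(m)=i m_j\xi(m)$. Let $(J_n\xi)(m)=\overline{\xi(-m)}$, $\xi\cdot a=J_na^*J_n\xi$, $[a,\xi]=a\xi-\xi\cdot a$ for $a\in\mathfrak B_n$, $\xi\in\mathcal H_n$. $\Re b=\frac{b+b^*}2$, $\Im b=\frac{b-b^*}{2i}$. DIRAC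 OPERATORS AND $L_n$. For $j\le d$: $X_{n,j}=\Re(U_{n,f(j)})$, $Y_{n,j}=\pm\Im(U_{n,f(j)})$ with sign $+$ if $f(j)>j$, $-$ if $f(j)<j$. For $j\le d$ with $k_n(j)=\infty$: $\Gamma_{n,j}=X_{n,j}\partial_{n,j}$, $\Gamma_{n,d+j}=Y_{n,j}\partial_{n,j}$. For $j\le d$ with $k_n(j)<\infty$: $\Gamma_{n,j}\xi=\frac{-k_n(j)}{2i\pi}[Y_{n,j},\xi]$, $\Gamma_{n,d+j}\xi=\frac{k_n(j)}{2i\pi}[X_{n,j},\xi]$. For $d<j\le d'$: $\Gamma_{n,d+j}=\partial_{n,j}$ if $k'_n(j)=\infty$, and $\Gamma_{n,d+j}=\frac{k'_n(j)}{2i\pi}\Im(1-v_n^{z_{n,j}})$ if $k_n'(j)<\infty$. Let $c$ be a fixed faithful *-representation on a finite dimensional Hilbert space $\mathcal S$ of the Clifford algebra generated by $\gamma_1,\dots,\gamma_{d+d'}$ with $\gamma_j^*=-\gamma_j$, $\gamma_j^2=-1$, $\gamma_j\gamma_s=-\gamma_s\gamma_j$ ($j\ne s$). Let $\mathcal J_n=\mathcal H_n\otimes\mathcal S=\ell^2(\widehat{G_n},\mathcal S)$, $a^\circ=a\otimes 1_{\mathcal S}$, $\langle m,m\rangle_n=\sum_{j:k'_n(j)=\infty}m_j^2$, $\mathrm{dom}(D_n)=\{\xi\in\mathcal J_n:\sum_m(1+\langle m,m\rangle_n)\|\xi(m)\|^2<\infty\}$ and $D_n=\sum_{j=1}^{d+d'}\Gamma_{n,j}\otimes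 c(\gamma_j)$ on $\mathrm{dom}(D_n)$. $L_n(a)=\|[D_n,a^\circ]\|$ on $\mathrm{dom}(L_n)=\{a\in\mathfrak A_n:a=a^*,\ a^\circ\mathrm{dom}(D_n)\subseteq\mathrm{dom}(D_n),\ [D_n,a^\circ]\text{ bounded}\}$. *)

theory Defs
  imports "HOL-Analysis.Analysis" "HOL-Algebra.Product_Groups"
begin

section \<open>Finite products of cyclic groups and their normalized 2-cocycles\<close>

text \<open>The group is additive in the mathematics and multiplicative in HOL-Algebra notation.
  Its elements are extensional functions on \<open>{1..q}\<close>; a class in \<open>\<int>/k(j)\<int>\<close> is
  represented in \<open>{0..<k(j)}\<close>. Since \<open>integer_mod_group 0\<close> is \<open>\<int>\<close>, the value
  \<open>\<infinity>\<close> is sent to the modulus \<open>0\<close>, in accordance with \<open>\<infinity>\<int> = {0}\<close>.\<close>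

definition modulus :: "enat \<Rightarrow> nat" where
  "modulus e = (case e of enat r \<Rightarrow> r | \<infinity> \<Rightarrow> 0)"

definition Zgrp :: "nat \<Rightarrow> (nat \<Rightarrow> enat) \<Rightarrow> (nat \<Rightarrow> int) monoid" where
  "Zgrp q k = product_group {1..q} (\<lambda>j. integer_mod_group (modulus (k j)))"

definition infty_vec :: "nat \<Rightarrow> nat \<Rightarrow> enat" where
  "infty_vec q = (\<lambda>j\<in>{1..q}. \<infinity>)"

text \<open>The quotient map from \<open>\<int>\<^sup>q\<close>; note \<open>x mod 0 = x\<close>.\<close>

definition Zproj :: "nat \<Rightarrow> (nat \<Rightarrow> enat) \<Rightarrow> (nat \<Rightarrow> int) \<Rightarrow> (nat \<Rightarrow> int)" where
  "Zproj q k x = (\<lambda>j\<in>{1..q}. x j mod int (modulus (k j)))"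

definition unit_vec :: "nat \<Rightarrow> nat \<Rightarrow> (nat \<Rightarrow> int)" where
  "unit_vec q j = (\<lambda>i\<in>{1..q}. if i = j then 1 else 0)"

text \<open>Extends a tuple indexed by \<open>{1..d}\<close> to one indexed by \<open>{1..d'}\<close> with constant value \<open>e\<close>.\<close>

definition pad :: "'a \<Rightarrow> nat \<Rightarrow> nat \<Rightarrow> (nat \<Rightarrow> 'a) \<Rightarrow> (nat \<Rightarrow> 'a)" where
  "pad e d d' x = (\<lambda>j\<in>{1..d'}. if j \<le> d then x j else e)"

definition normalized_2cocycles :: "('g, 'm) monoid_scheme \<Rightarrow> ('g \<times> 'g \<Rightarrow> complex) set" where
  "normalized_2cocycles G =
    {\<sigma> \<in> carrier G \<times> carrier G \<rightarrow>\<^sub>E sphere 0 1.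
       (\<forall>x\<in>carrier G. \<forall>y\<in>carrier G. \<forall>z\<in>carrier G.
          \<sigma> (x, y) * \<sigma> (x \<otimes>\<^bsub>G\<^esub> y, z) = \<sigma> (x, y \<otimes>\<^bsub>G\<^esub> z) * \<sigma> (y, z)) \<and>
       (\<forall>x\<in>carrier G. \<sigma> (\<one>\<^bsub>G\<^esub>, x) = 1 \<and> \<sigma> (x, \<one>\<^bsub>G\<^esub>) = 1 \<and> \<sigma> (x, inv\<^bsub>G\<^esub> x) = 1)}"

definition Xi :: "nat \<Rightarrow> ((nat \<Rightarrow> enat) \<times> ((nat \<Rightarrow> int) \<times> (nat \<Rightarrow> int) \<Rightarrow> complex)) set" where
  "Xi q = {(k, \<sigma>). k \<in> {1..q} \<rightarrow>\<^sub>E {2..} \<and> \<sigma> \<in> normalized_2cocycles (Zgrp q k)}"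

text \<open>The order topology of \<^typ>\<open>enat\<close> is the one-point compactification of \<open>\<nat>\<close>.\<close>

definition Xi_topology ::
  "nat \<Rightarrow> ((nat \<Rightarrow> enat) \<times> ((nat \<Rightarrow> int) \<times> (nat \<Rightarrow> int) \<Rightarrow> complex)) topology" where
  "Xi_topology q =
    (let Z = carrier (Zgrp q (infty_vec q)) in
     pullback_topology (Xi q)
       (\<lambda>(k, \<sigma>). (k, \<lambda>(x, y)\<in>Z \<times> Z. \<sigma> (Zproj q k x, Zproj q k y)))
       (prod_topology (product_topology (\<lambda>_. euclidean) {1..q})
                      (product_topology (\<lambda>_. euclidean) (Z \<times> Z))))"

definition Ugrp :: "nat \<Rightarrow> (nat \<Rightarrow> enat) \<Rightarrow> (nat \<Rightarrow> complex) set" where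
  "Ugrp q k = {z \<in> {1..q} \<rightarrow>\<^sub>E sphere 0 1. \<forall>j\<in>{1..q}. \<forall>r. k j = enat r \<longrightarrow> z j ^ r = 1}"

definition monomial :: "nat \<Rightarrow> (nat \<Rightarrow> complex) \<Rightarrow> (nat \<Rightarrow> int) \<Rightarrow> complex" where
  "monomial q z m = (\<Prod>j\<in>{1..q}. z j powi m j)"

definition slen :: "nat \<Rightarrow> (nat \<Rightarrow> complex) \<Rightarrow> real" where
  "slen d z = (\<Sum>j\<in>{1..d}. LEAST s. \<exists>t::real. exp (\<i> * of_real t) = z j \<and> s = \<bar>t\<bar>)"


section \<open>Operators on square summable functions\<close>

text \<open>Vectors of \<open>\<ell>\<^sup>2(X, V)\<close> are functions vanishing outside \<open>X\<close>.\<close>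

definition ell2 :: "'g set \<Rightarrow> ('g \<Rightarrow> 'v::real_normed_vector) set" where
  "ell2 X = {\<xi>. (\<forall>p. p \<notin> X \<longrightarrow> \<xi> p = 0) \<and> (\<lambda>p. (norm (\<xi> p))\<^sup>2) summable_on X}"

definition ell2_norm :: "'g set \<Rightarrow> ('g \<Rightarrow> 'v::real_normed_vector) \<Rightarrow> real" where
  "ell2_norm X \<xi> = sqrt (\<Sum>\<^sub>\<infinity>p\<in>X. (norm (\<xi> p))\<^sup>2)"

definition ell2_inner :: "'g set \<Rightarrow> ('g \<Rightarrow> complex) \<Rightarrow> ('g \<Rightarrow> complex) \<Rightarrow> complex" where
  "ell2_inner X \<xi> \<eta> = (\<Sum>\<^sub>\<infinity>p\<in>X. \<xi> p * cnj (\<eta> p))"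

definition bounded_on ::
  "'g set \<Rightarrow> ('g \<Rightarrow> 'v::real_normed_vector) set \<Rightarrow> (('g \<Rightarrow> 'v) \<Rightarrow> ('g \<Rightarrow> 'v)) \<Rightarrow> bool" where
  "bounded_on X V T \<longleftrightarrow> (\<exists>C. \<forall>\<xi>\<in>V. ell2_norm X (T \<xi>) \<le> C * ell2_norm X \<xi>)"

text \<open>The operator norm of an operator with domain \<open>V\<close>, a subspace of \<open>\<ell>\<^sup>2(X, _)\<close>;
  only used when \<open>bounded_on X V T\<close> holds.\<close>

definition opnorm ::
  "'g set \<Rightarrow> ('g \<Rightarrow> 'v::real_normed_vector) set \<Rightarrow> (('g \<Rightarrow> 'v) \<Rightarrow> ('g \<Rightarrow> 'v)) \<Rightarrow> real" where
  "opnorm X V T = Sup {ell2_norm X (T \<xi>) | \<xi>. \<xi> \<in> V \<and> ell2_norm X \<xi> \<le> 1}"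

type_synonym 'g oper = "('g \<Rightarrow> complex) \<Rightarrow> ('g \<Rightarrow> complex)"

definition on_ell2 :: "'g set \<Rightarrow> 'g oper \<Rightarrow> 'g oper" where
  "on_ell2 X F = (\<lambda>\<xi>. if \<xi> \<in> ell2 X then F \<xi> else (\<lambda>_. 0))"

text \<open>Bounded operators on \<open>\<ell>\<^sup>2(X)\<close>. They are set to zero off \<open>\<ell>\<^sup>2(X)\<close>, so that equality of
  HOL functions is equality of operators and the algebraic operations are the pointwise ones and
  composition.\<close>

definition bop :: "'g set \<Rightarrow> 'g oper set" where
  "bop X = {T. (\<forall>\<xi>\<in>ell2 X. T \<xi> \<in> ell2 X) \<and> (\<forall>\<xi>. \<xi> \<notin> ell2 X \<longrightarrow> T \<xi> = (\<lambda>_. 0)) \<and>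
     (\<forall>\<xi>\<in>ell2 X. \<forall>\<eta>\<in>ell2 X. T (\<lambda>p. \<xi> p + \<eta> p) = (\<lambda>p. T \<xi> p + T \<eta> p)) \<and>
     (\<forall>w. \<forall>\<xi>\<in>ell2 X. T (\<lambda>p. w * \<xi> p) = (\<lambda>p. w * T \<xi> p)) \<and>
     bounded_on X (ell2 X) T}"

definition adj :: "'g set \<Rightarrow> 'g oper \<Rightarrow> 'g oper" where
  "adj X a = (SOME b. b \<in> bop X \<and>
     (\<forall>\<xi>\<in>ell2 X. \<forall>\<eta>\<in>ell2 X. ell2_inner X (a \<xi>) \<eta> = ell2_inner X \<xi> (b \<eta>)))"

definition Re_op :: "'g set \<Rightarrow> 'g oper \<Rightarrow> 'g oper" where
  "Re_op X b = (\<lambda>\<xi> p. (b \<xi> p + adj X b \<xi> p) / 2)"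

definition Im_op :: "'g set \<Rightarrow> 'g oper \<Rightarrow> 'g oper" where
  "Im_op X b = (\<lambda>\<xi> p. (b \<xi> p - adj X b \<xi> p) / (2 * \<i>))"

definition cstar_subalgebra :: "'g set \<Rightarrow> 'g oper set \<Rightarrow> bool" where
  "cstar_subalgebra X A \<longleftrightarrow>
     A \<subseteq> bop X \<and> (\<lambda>\<xi> p. 0) \<in> A \<and>
     (\<forall>a\<in>A. \<forall>b\<in>A. (\<lambda>\<xi> p. a \<xi> p + b \<xi> p) \<in> A \<and> a \<circ> b \<in> A) \<and>
     (\<forall>w. \<forall>a\<in>A. (\<lambda>\<xi> p. w * a \<xi> p) \<in> A) \<and>
     (\<forall>a\<in>A. adj X a \<in> A) \<and>
     (\<forall>s a. (\<forall>i::nat. s i \<in> A) \<and> a \<in> bop X \<and>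
        (\<lambda>i. opnorm X (ell2 X) (\<lambda>\<xi> p. s i \<xi> p - a \<xi> p)) \<longlonglongrightarrow> 0 \<longrightarrow> a \<in> A)"

definition cstar_gen :: "'g set \<Rightarrow> 'g oper set \<Rightarrow> 'g oper set" where
  "cstar_gen X S = \<Inter>{A. cstar_subalgebra X A \<and> S \<subseteq> A}"


section \<open>Twisted group C*-algebras and the dual action\<close>

definition W ::
  "('g, 'm) monoid_scheme \<Rightarrow> ('g \<times> 'g \<Rightarrow> complex) \<Rightarrow> 'g \<Rightarrow> 'g oper" where
  "W G \<sigma> m = on_ell2 (carrier G)
     (\<lambda>\<xi> p. if p \<in> carrier G then \<sigma> (m, p \<otimes>\<^bsub>G\<^esub> inv\<^bsub>G\<^esub> m) * \<xi> (p \<otimes>\<^bsub>G\<^esub> inv\<^bsub>G\<^esub> m) else 0)"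

definition Jop :: "('g, 'm) monoid_scheme \<Rightarrow> 'g oper" where
  "Jop G \<xi> = (\<lambda>m. if m \<in> carrier G then cnj (\<xi> (inv\<^bsub>G\<^esub> m)) else 0)"

definition right_act :: "('g, 'm) monoid_scheme \<Rightarrow> ('g \<Rightarrow> complex) \<Rightarrow> 'g oper \<Rightarrow> ('g \<Rightarrow> complex)" where
  "right_act G \<xi> a = Jop G (adj (carrier G) a (Jop G \<xi>))"

definition vec_comm :: "('g, 'm) monoid_scheme \<Rightarrow> 'g oper \<Rightarrow> ('g \<Rightarrow> complex) \<Rightarrow> ('g \<Rightarrow> complex)" where
  "vec_comm G a \<xi> = (\<lambda>p. a \<xi> p - right_act G \<xi> a p)"

text \<open>From here on \<open>k\<close> and \<open>\<sigma>\<close> are the parameters of the large torus (\<open>k'\<^sub>n\<close>, \<open>\<sigma>'\<^sub>n\<close>); those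
  of the small one are determined by them.\<close>

definition U ::
  "nat \<Rightarrow> (nat \<Rightarrow> enat) \<Rightarrow> ((nat \<Rightarrow> int) \<times> (nat \<Rightarrow> int) \<Rightarrow> complex) \<Rightarrow> nat \<Rightarrow> (nat \<Rightarrow> int) oper" where
  "U d' k \<sigma> j = W (Zgrp d' k) \<sigma> (unit_vec d' j)"

text \<open>The algebra \<open>\<AA>\<^sub>n\<close>, realized on \<open>\<ell>\<^sup>2\<close> of the large group.\<close>

definition frakA ::
  "nat \<Rightarrow> nat \<Rightarrow> (nat \<Rightarrow> enat) \<Rightarrow> ((nat \<Rightarrow> int) \<times> (nat \<Rightarrow> int) \<Rightarrow> complex) \<Rightarrow>
     (nat \<Rightarrow> int) oper set" where
  "frakA d d' k \<sigma> = cstar_gen (carrier (Zgrp d' k)) (U d' k \<sigma> ` {1..d})"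

definition vop :: "nat \<Rightarrow> (nat \<Rightarrow> enat) \<Rightarrow> (nat \<Rightarrow> complex) \<Rightarrow> (nat \<Rightarrow> int) oper" where
  "vop d' k z = on_ell2 (carrier (Zgrp d' k)) (\<lambda>\<xi> m. monomial d' z m * \<xi> m)"

definition dual_action ::
  "nat \<Rightarrow> (nat \<Rightarrow> enat) \<Rightarrow> (nat \<Rightarrow> complex) \<Rightarrow> (nat \<Rightarrow> int) oper \<Rightarrow> (nat \<Rightarrow> int) oper" where
  "dual_action d' k z a = vop d' k z \<circ> a \<circ> vop d' k (\<lambda>j. cnj (z j))"

definition zgen :: "nat \<Rightarrow> (nat \<Rightarrow> enat) \<Rightarrow> nat \<Rightarrow> (nat \<Rightarrow> complex)" where
  "zgen d' k j = (\<lambda>i\<in>{1..d'}. if i = j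
     then (case k j of enat r \<Rightarrow> exp (2 * \<i> * of_real pi / of_nat r) | \<infinity> \<Rightarrow> 1) else 1)"


section \<open>The Clifford algebra\<close>

text \<open>The complex Clifford algebra on \<open>\<gamma>\<^sub>1, \<dots>, \<gamma>\<^sub>N\<close> in its standard basis: the subset
  \<open>A = {a\<^sub>1 < \<dots> < a\<^sub>r}\<close> of \<open>{1..N}\<close> stands for \<open>\<gamma>\<^sub>A = \<gamma>\<^bsub>a\<^sub>1\<^esub> \<dots> \<gamma>\<^bsub>a\<^sub>r\<^esub>\<close>, and an element is its
  coefficient function. The relations give \<open>\<gamma>\<^sub>A \<gamma>\<^sub>B = \<plusminus>\<gamma>\<^sub>C\<close> with \<open>C\<close> the symmetric
  difference, with one sign change for each pair \<open>b < a\<close> to be transposed and one for each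
  \<open>b = a\<close>, as \<open>\<gamma>\<^sub>a\<^sup>2 = -1\<close>. Reversing a product of \<open>r\<close> distinct generators and replacing
  each by its opposite gives \<open>\<gamma>\<^sub>A\<^sup>* = (-1)\<^bsup>r(r+1)/2\<^esup> \<gamma>\<^sub>A\<close>.\<close>

definition cliff :: "nat \<Rightarrow> (nat set \<Rightarrow> complex) set" where
  "cliff N = {x. \<forall>A. \<not> A \<subseteq> {1..N} \<longrightarrow> x A = 0}"

definition cliff_basis :: "nat set \<Rightarrow> (nat set \<Rightarrow> complex)" where
  "cliff_basis A = (\<lambda>B. if B = A then 1 else 0)"

definition cliff_gen :: "nat \<Rightarrow> (nat set \<Rightarrow> complex)" where
  "cliff_gen j = cliff_basis {j}"

definition cliff_mult ::
  "nat \<Rightarrow> (nat set \<Rightarrow> complex) \<Rightarrow> (nat set \<Rightarrow> complex) \<Rightarrow> (nat set \<Rightarrow> complex)" where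
  "cliff_mult N x y = (\<lambda>C. \<Sum>A\<in>Pow {1..N}.
     (- 1) ^ card {(a, b) \<in> A \<times> sym_diff A C. b \<le> a} * x A * y (sym_diff A C))"

definition cliff_star :: "(nat set \<Rightarrow> complex) \<Rightarrow> (nat set \<Rightarrow> complex)" where
  "cliff_star x = (\<lambda>A. (- 1) ^ (card A * (card A + 1) div 2) * cnj (x A))"

text \<open>Faithful (unital) *-representations on the Hilbert space \<open>\<complex>\<^sup>s\<close>, by matrices.\<close>

definition faithful_cliff_rep ::
  "nat \<Rightarrow> ((nat set \<Rightarrow> complex) \<Rightarrow> complex^'s^'s) \<Rightarrow> bool" where
  "faithful_cliff_rep N c \<longleftrightarrow>
     (\<forall>x\<in>cliff N. \<forall>y\<in>cliff N. c (\<lambda>A. x A + y A) = c x + c y \<and>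
        c (cliff_mult N x y) = c x ** c y) \<and>
     (\<forall>w. \<forall>x\<in>cliff N. c (\<lambda>A. w * x A) = map_matrix (\<lambda>u. w * u) (c x)) \<and>
     (\<forall>x\<in>cliff N. c (cliff_star x) = map_matrix cnj (transpose (c x))) \<and>
     c (cliff_basis {}) = mat 1 \<and>
     inj_on c (cliff N)"


section \<open>The Dirac operators and the seminorms\<close>

text \<open>\<open>T \<otimes> C\<close> on \<open>\<ell>\<^sup>2(X) \<otimes> \<complex>\<^sup>s = \<ell>\<^sup>2(X, \<complex>\<^sup>s)\<close>: apply the matrix \<open>C\<close> pointwise, then \<open>T\<close> to each
  component.\<close>

definition tens ::
  "'g oper \<Rightarrow> complex^'s^'s \<Rightarrow> ('g \<Rightarrow> complex^'s) \<Rightarrow> ('g \<Rightarrow> complex^'s)" where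
  "tens T C \<xi> = (\<lambda>m. \<chi> s. T (\<lambda>p. (C *v \<xi> p) $ s) m)"

definition ampl :: "'g oper \<Rightarrow> ('g \<Rightarrow> complex^'s) \<Rightarrow> ('g \<Rightarrow> complex^'s)" where
  "ampl a = tens a (mat 1)"

definition partial :: "nat \<Rightarrow> (nat \<Rightarrow> int) oper" where
  "partial j \<xi> = (\<lambda>m. \<i> * of_int (m j) * \<xi> m)"

definition Xop ::
  "nat \<Rightarrow> (nat \<Rightarrow> nat) \<Rightarrow> (nat \<Rightarrow> enat) \<Rightarrow> ((nat \<Rightarrow> int) \<times> (nat \<Rightarrow> int) \<Rightarrow> complex) \<Rightarrow>
     nat \<Rightarrow> (nat \<Rightarrow> int) oper" where
  "Xop d' f k \<sigma> j = Re_op (carrier (Zgrp d' k)) (U d' k \<sigma> (f j))"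

definition Yop ::
  "nat \<Rightarrow> (nat \<Rightarrow> nat) \<Rightarrow> (nat \<Rightarrow> enat) \<Rightarrow> ((nat \<Rightarrow> int) \<times> (nat \<Rightarrow> int) \<Rightarrow> complex) \<Rightarrow>
     nat \<Rightarrow> (nat \<Rightarrow> int) oper" where
  "Yop d' f k \<sigma> j = (\<lambda>\<xi> m. (if j < f j then 1 else - 1) *
     Im_op (carrier (Zgrp d' k)) (U d' k \<sigma> (f j)) \<xi> m)"

text \<open>The three branches define \<open>\<Gamma>\<^sub>j\<close> and \<open>\<Gamma>\<^bsub>d+j\<^esub>\<close> for \<open>1 \<le> j \<le> d\<close>, and \<open>\<Gamma>\<^bsub>d+j\<^esub>\<close> for
  \<open>d < j \<le> d'\<close>.\<close>

definition Gam ::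
  "nat \<Rightarrow> nat \<Rightarrow> (nat \<Rightarrow> nat) \<Rightarrow> (nat \<Rightarrow> enat) \<Rightarrow> ((nat \<Rightarrow> int) \<times> (nat \<Rightarrow> int) \<Rightarrow> complex) \<Rightarrow>
     nat \<Rightarrow> (nat \<Rightarrow> int) oper" where
  "Gam d d' f k \<sigma> i \<xi> =
    (if i \<le> d then
       (case k i of
          \<infinity> \<Rightarrow> Xop d' f k \<sigma> i (partial i \<xi>)
        | enat r \<Rightarrow> (\<lambda>m. - of_nat r / (2 * \<i> * of_real pi) *
                      vec_comm (Zgrp d' k) (Yop d' f k \<sigma> i) \<xi> m))
     else if i \<le> 2 * d then
       (let j = i - d in case k j of
          \<infinity> \<Rightarrow> Yop d' f k \<sigma> j (partial j \<xi>)
        | enat r \<Rightarrow> (\<lambda>m. of_nat r / (2 * \<i> * of_real pi) *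
                      vec_comm (Zgrp d' k) (Xop d' f k \<sigma> j) \<xi> m))
     else
       (let j = i - d in case k j of
          \<infinity> \<Rightarrow> partial j \<xi>
        | enat r \<Rightarrow> (\<lambda>m. of_nat r / (2 * \<i> * of_real pi) *
                      Im_op (carrier (Zgrp d' k))
                        (on_ell2 (carrier (Zgrp d' k))
                           (\<lambda>\<eta> p. \<eta> p - vop d' k (zgen d' k j) \<eta> p)) \<xi> m)))"

definition dom_D :: "nat \<Rightarrow> (nat \<Rightarrow> enat) \<Rightarrow> ((nat \<Rightarrow> int) \<Rightarrow> complex^'s) set" where
  "dom_D d' k = {\<xi> \<in> ell2 (carrier (Zgrp d' k)).
     (\<lambda>m. (1 + (\<Sum>j | j \<in> {1..d'} \<and> k j = \<infinity>. (real_of_int (m j))\<^sup>2)) * (norm (\<xi> m))\<^sup>2)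
       summable_on carrier (Zgrp d' k)}"

definition dirac ::
  "nat \<Rightarrow> nat \<Rightarrow> (nat \<Rightarrow> nat) \<Rightarrow> ((nat set \<Rightarrow> complex) \<Rightarrow> complex^'s^'s) \<Rightarrow>
     (nat \<Rightarrow> enat) \<Rightarrow> ((nat \<Rightarrow> int) \<times> (nat \<Rightarrow> int) \<Rightarrow> complex) \<Rightarrow>
     ((nat \<Rightarrow> int) \<Rightarrow> complex^'s) \<Rightarrow> ((nat \<Rightarrow> int) \<Rightarrow> complex^'s)" where
  "dirac d d' f c k \<sigma> \<xi> =
     (\<lambda>m. \<Sum>j\<in>{1..d + d'}. tens (Gam d d' f k \<sigma> j) (c (cliff_gen j)) \<xi> m)"

definition dirac_comm ::
  "nat \<Rightarrow> nat \<Rightarrow> (nat \<Rightarrow> nat) \<Rightarrow> ((nat set \<Rightarrow> complex) \<Rightarrow> complex^'s^'s) \<Rightarrow>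
     (nat \<Rightarrow> enat) \<Rightarrow> ((nat \<Rightarrow> int) \<times> (nat \<Rightarrow> int) \<Rightarrow> complex) \<Rightarrow> (nat \<Rightarrow> int) oper \<Rightarrow>
     ((nat \<Rightarrow> int) \<Rightarrow> complex^'s) \<Rightarrow> ((nat \<Rightarrow> int) \<Rightarrow> complex^'s)" where
  "dirac_comm d d' f c k \<sigma> a \<xi> =
     (\<lambda>m. dirac d d' f c k \<sigma> (ampl a \<xi>) m - ampl a (dirac d d' f c k \<sigma> \<xi>) m)"

definition dom_L ::
  "nat \<Rightarrow> nat \<Rightarrow> (nat \<Rightarrow> nat) \<Rightarrow> ((nat set \<Rightarrow> complex) \<Rightarrow> complex^'s^'s) \<Rightarrow>
     (nat \<Rightarrow> enat) \<Rightarrow> ((nat \<Rightarrow> int) \<times> (nat \<Rightarrow> int) \<Rightarrow> complex) \<Rightarrow> (nat \<Rightarrow> int) oper set" where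
  "dom_L d d' f c k \<sigma> =
     {a \<in> frakA d d' k \<sigma>. a = adj (carrier (Zgrp d' k)) a \<and>
        ampl a ` (dom_D d' k :: ((nat \<Rightarrow> int) \<Rightarrow> complex^'s) set) \<subseteq> dom_D d' k \<and>
        bounded_on (carrier (Zgrp d' k)) (dom_D d' k) (dirac_comm d d' f c k \<sigma> a)}"

definition L ::
  "nat \<Rightarrow> nat \<Rightarrow> (nat \<Rightarrow> nat) \<Rightarrow> ((nat set \<Rightarrow> complex) \<Rightarrow> complex^'s^'s) \<Rightarrow>
     (nat \<Rightarrow> enat) \<Rightarrow> ((nat \<Rightarrow> int) \<times> (nat \<Rightarrow> int) \<Rightarrow> complex) \<Rightarrow> (nat \<Rightarrow> int) oper \<Rightarrow> real" where
  "L d d' f c k \<sigma> a =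
     opnorm (carrier (Zgrp d' k)) (dom_D d' k) (dirac_comm d d' f c k \<sigma> a)"

end

theory Submission
  imports Defs
begin

text \<open>The dual action splits into one-parameter pieces, and along the \<open>j\<close>-th coordinate \<open>[D, a]\<close>
  controls how far it moves \<open>a\<close>. Anticommuting \<open>[D, a]\<close> with \<open>1 \<otimes> c(\<gamma>\<^sub>i)\<close> gives
  \<open>\<parallel>[\<Gamma>\<^sub>i, a]\<parallel> \<le> L(a)\<close> for every \<open>i\<close>. The two operators \<open>\<Gamma>\<^sub>j\<close> and \<open>\<Gamma>\<^bsub>d+j\<^esub>\<close> carry the real and
  imaginary parts of \<open>U\<^bsub>f(j)\<^esub>\<close>, which is where the factor 2 comes from. If \<open>k(j)\<close> is infinite,
  \<open>U\<^bsub>f(j)\<^esub>\<close> commutes with \<open>a\<close>, so \<open>\<parallel>[\<partial>\<^sub>j, a]\<parallel> \<le> 2 L(a)\<close>, and one concludes by the mean value theorem.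
  If \<open>k(j) = r\<close> is finite, the right actions drop out of the commutators, so
  \<open>r/2\<pi> \<parallel>[U\<^bsub>f(j)\<^esub>, a]\<parallel> \<le> 2 L(a)\<close>; since conjugation by \<open>U\<^bsub>f(j)\<^esub>\<close> is the dual action of
  \<open>exp(\<plusminus>2i\<pi>/r)\<close>, telescoping over powers of this root of unity concludes.\<close>

section \<open>Square summable functions\<close>

text \<open>Two obstacles shape the proof: \<open>[D, a]\<close> is only meaningful on the domain of
  \<open>D\<close>, and \<open>a\<close> is an arbitrary element of a generated C*-algebra, so there
  is no formula for it. The first is met by computing on finitely supported vectors: they lie in the
  domain, \<open>dom_L\<close> ensures that \<open>a\<close> maps them into it, and the matrix
  coefficients there are finite sums, which can be differentiated term by term. Density is then used
  only for operators already known to be bounded. The second is met by commutants: each algebraic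
  fact about \<open>a\<close> is phrased as commutation with one unitary, checked on the generators,
  and carried over to the generated algebra. The finite case loses nothing against the infinite one,
  because a root of unity with principal argument 2 pi l / r is reached in |l| steps of cost 2 pi /
  r each, which add up to exactly |Arg z|.\<close>

lemma ell2_norm_nonneg [simp]: "0 \<le> ell2_norm X \<xi>"
  unfolding ell2_norm_def by (intro real_sqrt_ge_zero infsum_nonneg) auto

lemma ell2_outside: "\<xi> \<in> ell2 X \<Longrightarrow> p \<notin> X \<Longrightarrow> \<xi> p = 0"
  unfolding ell2_def by auto

lemma L2_set_le_ell2_norm:
  assumes "\<xi> \<in> ell2 X" "finite F" "F \<subseteq> X"
  shows "L2_set (\<lambda>p. norm (\<xi> p)) F \<le> ell2_norm X \<xi>"
  using assms unfolding L2_set_def ell2_norm_def ell2_def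
  by (auto intro!: finite_sum_le_infsum)

text \<open>Nonnegative series are controlled by their finite partial sums, so membership and norm
  bound both follow from finite \<open>L2_set\<close> inequalities.\<close>

lemma ell2_boundI:
  assumes "\<And>p. p \<notin> X \<Longrightarrow> \<xi> p = 0"
    and "\<And>F. finite F \<Longrightarrow> F \<subseteq> X \<Longrightarrow> L2_set (\<lambda>p. norm (\<xi> p)) F \<le> C"
  shows "\<xi> \<in> ell2 X" "ell2_norm X \<xi> \<le> C"
proof -
  have "0 \<le> C" using assms(2)[of "{}"] by simp
  have le: "(\<Sum>p\<in>F. (norm (\<xi> p))\<^sup>2) \<le> C\<^sup>2" if "finite F" "F \<subseteq> X" for F
    using assms(2)[OF that] unfolding L2_set_def by (rule sqrt_le_D)
  have s: "(\<lambda>p. (norm (\<xi> p))\<^sup>2) summable_on X"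
    by (rule nonneg_bdd_above_summable_on) (auto intro!: bdd_aboveI2[where M = "C\<^sup>2"] le)
  then show "\<xi> \<in> ell2 X" using assms(1) unfolding ell2_def by auto
  have "(\<Sum>\<^sub>\<infinity>p\<in>X. (norm (\<xi> p))\<^sup>2) \<le> C\<^sup>2"
    using s le by (intro infsum_le_finite_sums) auto
  then show "ell2_norm X \<xi> \<le> C"
    unfolding ell2_norm_def using \<open>0 \<le> C\<close> by (rule real_le_lsqrt[rotated])
qed

text \<open>The two functions may take values in different spaces; this covers the passage from a
  scalar function to its product with a fixed vector.\<close>

lemma ell2_scaled:
  assumes "\<And>p. norm (\<eta> p) = K * norm (\<xi> p)" "0 \<le> K" "\<xi> \<in> ell2 X"
  shows "\<eta> \<in> ell2 X" "ell2_norm X \<eta> = K * ell2_norm X \<xi>"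
proof -
  have eq: "(\<lambda>p. (norm (\<eta> p))\<^sup>2) = (\<lambda>p. K\<^sup>2 * (norm (\<xi> p))\<^sup>2)"
    by (simp add: assms(1) power_mult_distrib)
  show "\<eta> \<in> ell2 X"
    using assms(3) assms(1) unfolding ell2_def
    by (auto simp: power_mult_distrib intro!: summable_on_cmult_right) (metis norm_eq_zero mult_zero_right)
  show "ell2_norm X \<eta> = K * ell2_norm X \<xi>"
    unfolding ell2_norm_def eq using assms(2) by (simp add: infsum_cmult_right' real_sqrt_mult)
qed

lemma ell2_dominated:
  assumes "\<And>p. norm (\<eta> p) \<le> norm (\<xi> p)" "\<xi> \<in> ell2 X"
  shows "\<eta> \<in> ell2 X" "ell2_norm X \<eta> \<le> ell2_norm X \<xi>"
proof -
  have 1: "\<eta> p = 0" if "p \<notin> X" for p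
    using assms(1)[of p] ell2_outside[OF assms(2) that] by simp
  have 2: "L2_set (\<lambda>p. norm (\<eta> p)) F \<le> ell2_norm X \<xi>" if "finite F" "F \<subseteq> X" for F
    using L2_set_mono[of F "\<lambda>p. norm (\<eta> p)" "\<lambda>p. norm (\<xi> p)"] L2_set_le_ell2_norm[OF assms(2) that]
      assms(1) by fastforce
  show "\<eta> \<in> ell2 X" "ell2_norm X \<eta> \<le> ell2_norm X \<xi>"
    using ell2_boundI[OF 1 2] by blast+
qed

lemma ell2_zero [simp]: "(\<lambda>_. 0) \<in> ell2 X" "ell2_norm X (\<lambda>_. 0) = 0"
  by (auto simp: ell2_def ell2_norm_def)

lemma ell2_smult:
  fixes \<xi> :: "'g \<Rightarrow> complex"
  assumes "\<xi> \<in> ell2 X"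
  shows "(\<lambda>p. w * \<xi> p) \<in> ell2 X" "ell2_norm X (\<lambda>p. w * \<xi> p) = norm w * ell2_norm X \<xi>"
  using ell2_scaled[of "\<lambda>p. w * \<xi> p" "norm w" \<xi>] assms by (auto simp: norm_mult)

lemma ell2_add:
  assumes "\<xi> \<in> ell2 X" "\<eta> \<in> ell2 X"
  shows "(\<lambda>p. \<xi> p + \<eta> p) \<in> ell2 X" "ell2_norm X (\<lambda>p. \<xi> p + \<eta> p) \<le> ell2_norm X \<xi> + ell2_norm X \<eta>"
proof -
  have 1: "\<xi> p + \<eta> p = 0" if "p \<notin> X" for p
    using assms that by (simp add: ell2_outside)
  have 2: "L2_set (\<lambda>p. norm (\<xi> p + \<eta> p)) F \<le> ell2_norm X \<xi> + ell2_norm X \<eta>"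
    if "finite F" "F \<subseteq> X" for F
  proof -
    have "L2_set (\<lambda>p. norm (\<xi> p + \<eta> p)) F \<le> L2_set (\<lambda>p. norm (\<xi> p) + norm (\<eta> p)) F"
      by (intro L2_set_mono norm_triangle_ineq) auto
    also have "\<dots> \<le> L2_set (\<lambda>p. norm (\<xi> p)) F + L2_set (\<lambda>p. norm (\<eta> p)) F"
      by (rule L2_set_triangle_ineq)
    also have "\<dots> \<le> ell2_norm X \<xi> + ell2_norm X \<eta>"
      using L2_set_le_ell2_norm[OF _ that] assms by (intro add_mono) auto
    finally show ?thesis .
  qed
  show "(\<lambda>p. \<xi> p + \<eta> p) \<in> ell2 X" "ell2_norm X (\<lambda>p. \<xi> p + \<eta> p) \<le> ell2_norm X \<xi> + ell2_norm X \<eta>"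
    using ell2_boundI[of X "\<lambda>p. \<xi> p + \<eta> p", OF 1 2] by blast+
qed

lemma ell2_uminus:
  assumes "\<xi> \<in> ell2 X"
  shows "(\<lambda>p. - \<xi> p) \<in> ell2 X" "ell2_norm X (\<lambda>p. - \<xi> p) = ell2_norm X \<xi>"
  using ell2_scaled[of "\<lambda>p. - \<xi> p" 1 \<xi>] assms by auto

lemma ell2_diff:
  assumes "\<xi> \<in> ell2 X" "\<eta> \<in> ell2 X"
  shows "(\<lambda>p. \<xi> p - \<eta> p) \<in> ell2 X" "ell2_norm X (\<lambda>p. \<xi> p - \<eta> p) \<le> ell2_norm X \<xi> + ell2_norm X \<eta>"
  using ell2_add[OF assms(1) ell2_uminus(1)[OF assms(2)]] ell2_uminus(2)[OF assms(2)] by auto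

lemma ell2_norm_minus_commute:
  "ell2_norm X (\<lambda>p. \<xi> p - \<eta> p) = ell2_norm X (\<lambda>p. \<eta> p - \<xi> p)"
  by (simp add: ell2_norm_def norm_minus_commute)

lemma ell2_sum:
  assumes "finite I" "\<And>i. i \<in> I \<Longrightarrow> \<xi> i \<in> ell2 X"
  shows "(\<lambda>p. \<Sum>i\<in>I. \<xi> i p) \<in> ell2 X"
  using assms by (induction I rule: finite_induct) (auto intro!: ell2_add)

lemma ell2_norm_eq_0:
  assumes "\<xi> \<in> ell2 X" "ell2_norm X \<xi> \<le> 0"
  shows "\<xi> = (\<lambda>_. 0)"
proof
  fix p
  show "\<xi> p = 0"
  proof (cases "p \<in> X")
    case True
    then show ?thesis using L2_set_le_ell2_norm[OF assms(1), of "{p}"] assms(2)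
      by simp (metis norm_le_zero_iff order_trans)
  qed (simp add: ell2_outside[OF assms(1)])
qed

section \<open>Finitely supported vectors, inner product and density\<close>

definition fin_supp :: "'g set \<Rightarrow> ('g \<Rightarrow> 'v::real_normed_vector) set" where
  "fin_supp X = {\<xi>. finite {p. \<xi> p \<noteq> 0} \<and> {p. \<xi> p \<noteq> 0} \<subseteq> X}"

lemma fin_supp_ell2: "\<xi> \<in> fin_supp X \<Longrightarrow> \<xi> \<in> ell2 X"
  unfolding fin_supp_def ell2_def
  by (auto intro: finite_nonzero_values_imp_summable_on finite_subset[rotated])

lemma fin_supp_subset: "\<xi> \<in> fin_supp X \<Longrightarrow> (\<And>p. \<xi> p = 0 \<Longrightarrow> \<eta> p = 0) \<Longrightarrow> \<eta> \<in> fin_supp X"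
  unfolding fin_supp_def by (auto intro: finite_subset[of "{p. \<eta> p \<noteq> 0}" "{p. \<xi> p \<noteq> 0}"])

lemma fin_supp_restrict: "finite F \<Longrightarrow> F \<subseteq> X \<Longrightarrow> (\<lambda>p. if p \<in> F then \<xi> p else 0) \<in> fin_supp X"
  unfolding fin_supp_def by (auto intro: finite_subset)

lemma ell2_norm_restrict:
  assumes "finite F" "F \<subseteq> X"
  shows "ell2_norm X (\<lambda>p. if p \<in> F then \<xi> p else 0) = L2_set (\<lambda>p. norm (\<xi> p)) F"
proof -
  have "(\<Sum>\<^sub>\<infinity>p\<in>X. (norm (if p \<in> F then \<xi> p else 0))\<^sup>2) = (\<Sum>\<^sub>\<infinity>p\<in>F. (norm (\<xi> p))\<^sup>2)"
    using assms by (intro infsum_cong_neutral) auto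
  then show ?thesis using assms by (simp add: ell2_norm_def L2_set_def)
qed

lemma ell2_approx:
  assumes "\<xi> \<in> ell2 X" "0 < e"
  obtains F where "finite F" "F \<subseteq> X"
    "ell2_norm X (\<lambda>p. \<xi> p - (if p \<in> F then \<xi> p else 0)) \<le> e"
proof -
  let ?g = "\<lambda>p. (norm (\<xi> p))\<^sup>2"
  have s: "?g summable_on X" using assms unfolding ell2_def by auto
  then obtain F where F: "finite F" "F \<subseteq> X" "dist (sum ?g F) (infsum ?g X) \<le> e\<^sup>2"
    using infsum_finite_approximation[OF s, of "e\<^sup>2"] assms(2) by auto
  have "ell2_norm X (\<lambda>p. \<xi> p - (if p \<in> F then \<xi> p else 0)) \<le> e"
  proof (rule ell2_boundI)
    show "\<xi> p - (if p \<in> F then \<xi> p else 0) = 0" if "p \<notin> X" for p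
      using that assms(1) by (simp add: ell2_outside)
    fix G assume G: "finite G" "G \<subseteq> X"
    have "(\<Sum>p\<in>G. (norm (\<xi> p - (if p \<in> F then \<xi> p else 0)))\<^sup>2) = sum ?g (G - F)"
      using G by (intro sum.mono_neutral_cong_right) auto
    also have "\<dots> = sum ?g (G \<union> F) - sum ?g F"
      \<comment> \<open>Adding \<open>F\<close> to \<open>G\<close> does not change the difference
        set, and it makes the sum over \<open>F\<close> available for subtraction.\<close>
      using G F by (subst Un_Diff_cancel2[symmetric], subst sum.union_disjoint) auto
    also have "\<dots> \<le> infsum ?g X - sum ?g F"
      using G F s by (intro diff_right_mono finite_sum_le_infsum) auto
    also have "\<dots> \<le> e\<^sup>2" using F(3) by (simp add: dist_real_def)
    finally show "L2_set (\<lambda>p. norm (\<xi> p - (if p \<in> F then \<xi> p else 0))) G \<le> e"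
      unfolding L2_set_def using assms(2) by (intro real_le_lsqrt) auto
  qed
  with F show ?thesis using that by blast
qed

lemma ell2_inner_summable:
  assumes "\<xi> \<in> ell2 X" "\<eta> \<in> ell2 X"
  shows "(\<lambda>p. \<xi> p * cnj (\<eta> p)) summable_on X"
proof -
  have "(\<lambda>p. (norm (\<xi> p))\<^sup>2 + (norm (\<eta> p))\<^sup>2) summable_on X"
    using assms unfolding ell2_def by (auto intro!: summable_on_add)
  then have "(\<lambda>p. norm (\<xi> p * cnj (\<eta> p))) summable_on X"
  proof (rule Infinite_Sum.abs_summable_on_comparison_test')
    fix p
    have "0 \<le> (norm (\<xi> p) - norm (\<eta> p))\<^sup>2" by simp
    then have "2 * (norm (\<xi> p) * norm (\<eta> p)) \<le> (norm (\<xi> p))\<^sup>2 + (norm (\<eta> p))\<^sup>2"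
      by (simp add: power2_diff algebra_simps)
    moreover have "0 \<le> norm (\<xi> p) * norm (\<eta> p)" by simp
    ultimately show "norm (\<xi> p * cnj (\<eta> p)) \<le> (norm (\<xi> p))\<^sup>2 + (norm (\<eta> p))\<^sup>2"
      unfolding norm_mult complex_mod_cnj by linarith
  qed
  then show ?thesis by (rule abs_summable_summable)
qed

lemma ell2_Cauchy_Schwarz:
  assumes "\<xi> \<in> ell2 X" "\<eta> \<in> ell2 X"
  shows "norm (ell2_inner X \<xi> \<eta>) \<le> ell2_norm X \<xi> * ell2_norm X \<eta>"
proof -
  have abs: "(\<lambda>p. norm (\<xi> p * cnj (\<eta> p))) summable_on X"
    using ell2_inner_summable[OF assms] by (simp only: summable_on_iff_abs_summable_on_complex)
  have "norm (ell2_inner X \<xi> \<eta>) \<le> (\<Sum>\<^sub>\<infinity>p\<in>X. norm (\<xi> p * cnj (\<eta> p)))"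
    unfolding ell2_inner_def using abs by (rule norm_infsum_bound)
  also have "\<dots> \<le> ell2_norm X \<xi> * ell2_norm X \<eta>"
  proof (rule infsum_le_finite_sums[OF abs])
    fix F assume F: "finite F" "F \<subseteq> X"
    have "(\<Sum>p\<in>F. norm (\<xi> p * cnj (\<eta> p))) \<le> L2_set (\<lambda>p. norm (\<xi> p)) F * L2_set (\<lambda>p. norm (\<eta> p)) F"
      using L2_set_mult_ineq[of "\<lambda>p. norm (\<xi> p)" "\<lambda>p. norm (\<eta> p)" F] by (simp add: norm_mult)
    also have "\<dots> \<le> ell2_norm X \<xi> * ell2_norm X \<eta>"
      using L2_set_le_ell2_norm[OF _ F] assms by (intro mult_mono) auto
    finally show "(\<Sum>p\<in>F. norm (\<xi> p * cnj (\<eta> p))) \<le> ell2_norm X \<xi> * ell2_norm X \<eta>" .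
  qed
  finally show ?thesis .
qed

lemma ell2_inner_add_left:
  assumes "\<xi> \<in> ell2 X" "\<xi>' \<in> ell2 X" "\<eta> \<in> ell2 X"
  shows "ell2_inner X (\<lambda>p. \<xi> p + \<xi>' p) \<eta> = ell2_inner X \<xi> \<eta> + ell2_inner X \<xi>' \<eta>"
  unfolding ell2_inner_def distrib_right
  using assms by (intro infsum_add ell2_inner_summable)

lemma ell2_inner_smult_left: "ell2_inner X (\<lambda>p. w * \<xi> p) \<eta> = w * ell2_inner X \<xi> \<eta>"
  unfolding ell2_inner_def mult.assoc by (rule infsum_cmult_right')

lemma ell2_inner_commute: "ell2_inner X \<eta> \<xi> = cnj (ell2_inner X \<xi> \<eta>)"
  unfolding ell2_inner_def infsum_cnj[symmetric] by (simp add: mult.commute)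

lemma ell2_inner_add_right:
  assumes "\<xi> \<in> ell2 X" "\<eta> \<in> ell2 X" "\<eta>' \<in> ell2 X"
  shows "ell2_inner X \<xi> (\<lambda>p. \<eta> p + \<eta>' p) = ell2_inner X \<xi> \<eta> + ell2_inner X \<xi> \<eta>'"
  using assms by (simp add: ell2_inner_commute[of X \<xi>] ell2_inner_add_left)

lemma ell2_inner_smult_right: "ell2_inner X \<xi> (\<lambda>p. w * \<eta> p) = cnj w * ell2_inner X \<xi> \<eta>"
  by (simp add: ell2_inner_commute[of X \<xi>] ell2_inner_smult_left)

lemma ell2_inner_restrict:
  assumes "finite F" "F \<subseteq> X"
  shows "ell2_inner X \<xi> (\<lambda>p. if p \<in> F then \<eta> p else 0) = (\<Sum>p\<in>F. \<xi> p * cnj (\<eta> p))"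
proof -
  have "ell2_inner X \<xi> (\<lambda>p. if p \<in> F then \<eta> p else 0) = (\<Sum>\<^sub>\<infinity>p\<in>F. \<xi> p * cnj (\<eta> p))"
    unfolding ell2_inner_def using assms by (intro infsum_cong_neutral) auto
  then show ?thesis using assms by simp
qed

lemma ell2_inner_ext:
  assumes "\<xi> \<in> ell2 X" "\<eta> \<in> ell2 X"
    and "\<And>\<zeta>. \<zeta> \<in> ell2 X \<Longrightarrow> ell2_inner X \<xi> \<zeta> = ell2_inner X \<eta> \<zeta>"
  shows "\<xi> = \<eta>"
proof
  fix p
  show "\<xi> p = \<eta> p"
  proof (cases "p \<in> X")
    case True
    let ?\<zeta> = "\<lambda>q. if q \<in> {p} then (\<lambda>_. 1 :: complex) q else 0"
    have "?\<zeta> \<in> ell2 X" using True by (intro fin_supp_ell2 fin_supp_restrict) auto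
    from assms(3)[OF this] show ?thesis
      using True by (subst (asm) (1 2) ell2_inner_restrict) auto
  qed (simp add: ell2_outside[OF assms(1)] ell2_outside[OF assms(2)])
qed

text \<open>Testing against truncations avoids any completeness argument.\<close>

lemma ell2_norm_le_dual:
  fixes \<xi> :: "'g \<Rightarrow> complex"
  assumes "\<And>p. p \<notin> X \<Longrightarrow> \<xi> p = 0" "0 \<le> C"
    and "\<And>\<eta>. \<eta> \<in> fin_supp X \<Longrightarrow> norm (ell2_inner X \<xi> \<eta>) \<le> C * ell2_norm X \<eta>"
  shows "\<xi> \<in> ell2 X" "ell2_norm X \<xi> \<le> C"
proof -
  have "L2_set (\<lambda>p. norm (\<xi> p)) F \<le> C" if F: "finite F" "F \<subseteq> X" for F
  proof -
    let ?N = "L2_set (\<lambda>p. norm (\<xi> p)) F"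
    have "ell2_inner X \<xi> (\<lambda>p. if p \<in> F then \<xi> p else 0) = of_real (\<Sum>p\<in>F. (norm (\<xi> p))\<^sup>2)"
      by (simp add: ell2_inner_restrict[OF F] complex_norm_square del: of_real_power)
    also have "(\<Sum>p\<in>F. (norm (\<xi> p))\<^sup>2) = ?N * ?N"
      by (simp add: L2_set_def sum_nonneg)
    finally have "norm (ell2_inner X \<xi> (\<lambda>p. if p \<in> F then \<xi> p else 0)) = ?N * ?N"
      by (simp add: norm_mult)
    with assms(3)[OF fin_supp_restrict[OF F, of \<xi>]] have "?N * ?N \<le> C * ?N"
      by (simp add: ell2_norm_restrict[OF F])
    then show ?thesis
      using assms(2) L2_set_nonneg[of "\<lambda>p. norm (\<xi> p)" F] by (metis less_eq_real_def mult_le_cancel_right not_less)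
  qed
  then show "\<xi> \<in> ell2 X" "ell2_norm X \<xi> \<le> C"
    using ell2_boundI[of X \<xi> C] assms(1) by blast+
qed

lemma ell2_inner_self: "\<xi> \<in> ell2 X \<Longrightarrow> ell2_inner X \<xi> \<xi> = of_real ((ell2_norm X \<xi>)\<^sup>2)"
proof -
  assume "\<xi> \<in> ell2 X"
  then have "((\<lambda>p. (norm (\<xi> p))\<^sup>2) has_sum (ell2_norm X \<xi>)\<^sup>2) X"
    unfolding ell2_def ell2_norm_def by (auto simp: infsum_nonneg)
  then have "((\<lambda>p. complex_of_real ((norm (\<xi> p))\<^sup>2)) has_sum of_real ((ell2_norm X \<xi>)\<^sup>2)) X"
    by (rule has_sum_of_real)
  then show ?thesis
    unfolding ell2_inner_def by (simp only: complex_norm_square) (rule infsumI)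
qed

lemma ell2_inner_sum_left:
  assumes "finite I" "\<And>i. i \<in> I \<Longrightarrow> \<xi> i \<in> ell2 X" "\<eta> \<in> ell2 X"
  shows "ell2_inner X (\<lambda>p. \<Sum>i\<in>I. \<xi> i p) \<eta> = (\<Sum>i\<in>I. ell2_inner X (\<xi> i) \<eta>)"
  using assms
proof (induction I rule: finite_induct)
  case (insert i I)
  then show ?case using ell2_inner_add_left[of "\<xi> i" X "\<lambda>p. \<Sum>i\<in>I. \<xi> i p" \<eta>] by (simp add: ell2_sum)
qed (simp add: ell2_inner_def)

lemma ell2_inner_fin_supp:
  assumes "\<zeta> \<in> fin_supp X"
  shows "ell2_inner X \<xi> \<zeta> = (\<Sum>p | \<zeta> p \<noteq> 0. \<xi> p * cnj (\<zeta> p))"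
proof -
  have "(\<lambda>p. if p \<in> {p. \<zeta> p \<noteq> 0} then \<zeta> p else 0) = \<zeta>" by auto
  then show ?thesis
    using ell2_inner_restrict[of "{p. \<zeta> p \<noteq> 0}" X \<xi> \<zeta>] assms by (simp add: fin_supp_def)
qed

text \<open>Density in the form of an inequality with an error term. Truncation does not increase
  the norm, so the premise may also assume that \<zeta> is no longer than \<xi>.\<close>

lemma le_by_ell2_approx:
  fixes x y M :: real
  assumes "\<xi> \<in> ell2 X"
    and "\<And>\<zeta>. \<zeta> \<in> fin_supp X \<Longrightarrow> ell2_norm X \<zeta> \<le> ell2_norm X \<xi> \<Longrightarrow>
           x \<le> y + M * ell2_norm X (\<lambda>p. \<xi> p - \<zeta> p)"
  shows "x \<le> y"
proof (rule field_le_epsilon)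
  fix e :: real assume "0 < e"
  \<comment> \<open>The added 1 keeps the denominator positive when \<open>M = 0\<close>.\<close>
  define e' where "e' = e / (\<bar>M\<bar> + 1)"
  have "0 < e'" unfolding e'_def using \<open>0 < e\<close> by (auto intro!: divide_pos_pos)
  obtain F where F: "finite F" "F \<subseteq> X" "ell2_norm X (\<lambda>p. \<xi> p - (if p \<in> F then \<xi> p else 0)) \<le> e'"
    using ell2_approx[OF assms(1) \<open>0 < e'\<close>] .
  let ?\<zeta> = "\<lambda>p. if p \<in> F then \<xi> p else 0"
  have "x \<le> y + M * ell2_norm X (\<lambda>p. \<xi> p - ?\<zeta> p)"
    using ell2_dominated(2)[of ?\<zeta> \<xi> X] assms(1) by (intro assms(2) fin_supp_restrict[OF F(1,2)]) auto
  also have "M * ell2_norm X (\<lambda>p. \<xi> p - ?\<zeta> p) \<le> \<bar>M\<bar> * e'"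
    using F(3) by (intro mult_mono) auto
  also have "\<bar>M\<bar> * e' \<le> (\<bar>M\<bar> + 1) * e'" using \<open>0 < e'\<close> by (intro mult_right_mono) auto
  also have "\<dots> = e" unfolding e'_def by (simp add: add_nonneg_eq_0_iff)
  finally show "x \<le> y + e" by simp
qed

text \<open>Homogeneity is asked for at the given vector only: for the commutator with the Dirac
  operator it is verified just on elementary tensors with finitely supported scalar part.\<close>

lemma le_opnorm:
  assumes "bounded_on X V T" "\<xi> \<in> V" "V \<subseteq> ell2 X"
    and "\<And>r. (\<lambda>p. r *\<^sub>R \<xi> p) \<in> V \<and> T (\<lambda>p. r *\<^sub>R \<xi> p) = (\<lambda>p. r *\<^sub>R T \<xi> p)"
    and "T \<xi> \<in> ell2 X"
  shows "ell2_norm X (T \<xi>) \<le> opnorm X V T * ell2_norm X \<xi>"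
proof -
  obtain C where C: "\<And>\<xi>. \<xi> \<in> V \<Longrightarrow> ell2_norm X (T \<xi>) \<le> C * ell2_norm X \<xi>"
    using assms(1) unfolding bounded_on_def by auto
  have bdd: "bdd_above {ell2_norm X (T \<xi>) | \<xi>. \<xi> \<in> V \<and> ell2_norm X \<xi> \<le> 1}"
  proof (rule bdd_aboveI, clarify)
    fix \<eta> assume \<eta>: "\<eta> \<in> V" "ell2_norm X \<eta> \<le> 1"
    have "ell2_norm X (T \<eta>) \<le> C * ell2_norm X \<eta>" by (rule C[OF \<eta>(1)])
    also have "\<dots> \<le> \<bar>C\<bar> * 1" using \<eta> by (intro mult_mono) auto
    finally show "ell2_norm X (T \<eta>) \<le> \<bar>C\<bar>" by simp
  qed
  show ?thesis
  proof (cases "ell2_norm X \<xi> = 0")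
    case True
    \<comment> \<open>A vector of norm 0 cannot be normalized; here any bounding constant already
      gives 0 on the left.\<close>
    then show ?thesis using C[OF assms(2)] by simp
  next
    case False
    define N where "N = ell2_norm X \<xi>"
    have N: "0 < N" unfolding N_def using False by (simp add: order_less_le)
    have sc: "ell2_norm X (\<lambda>p. inverse N *\<^sub>R \<zeta> p) = inverse N * ell2_norm X \<zeta>"
      if "\<zeta> \<in> ell2 X" for \<zeta> :: "'a \<Rightarrow> 'b"
      using N ell2_scaled(2)[of "\<lambda>p. inverse N *\<^sub>R \<zeta> p" "inverse N" \<zeta> X, OF _ _ that] by simp
    have "ell2_norm X (T (\<lambda>p. inverse N *\<^sub>R \<xi> p)) \<le> opnorm X V T"
      unfolding opnorm_def using assms(2,3) sc[of \<xi>] N N_def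
      by (intro cSup_upper[OF _ bdd]) (auto intro!: exI[of _ "\<lambda>p. inverse N *\<^sub>R \<xi> p"] simp: assms(4))
    moreover have "ell2_norm X (T (\<lambda>p. inverse N *\<^sub>R \<xi> p)) = inverse N * ell2_norm X (T \<xi>)"
      using assms(4) sc[OF assms(5)] by simp
    ultimately show ?thesis using N unfolding N_def[symmetric]
      by (simp add: inverse_eq_divide pos_divide_le_eq)
  qed
qed

section \<open>Bounded operators and their adjoints\<close>

lemma bop_ell2: "T \<in> bop X \<Longrightarrow> \<xi> \<in> ell2 X \<Longrightarrow> T \<xi> \<in> ell2 X"
  unfolding bop_def by auto

lemma bop_off: "T \<in> bop X \<Longrightarrow> \<xi> \<notin> ell2 X \<Longrightarrow> T \<xi> = (\<lambda>_. 0)"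
  unfolding bop_def by auto

lemma bop_add:
  "T \<in> bop X \<Longrightarrow> \<xi> \<in> ell2 X \<Longrightarrow> \<eta> \<in> ell2 X \<Longrightarrow> T (\<lambda>p. \<xi> p + \<eta> p) = (\<lambda>p. T \<xi> p + T \<eta> p)"
  unfolding bop_def by blast

lemma bop_zero: "T \<in> bop X \<Longrightarrow> T (\<lambda>_. 0) = (\<lambda>_. 0)"
proof -
  assume "T \<in> bop X"
  then have "\<forall>w. \<forall>\<xi>\<in>ell2 X. T (\<lambda>p. w * \<xi> p) = (\<lambda>p. w * T \<xi> p)"
    unfolding bop_def by blast
  from this[rule_format, of "\<lambda>_. 0" 0] show ?thesis by simp
qed

text \<open>Off \<open>\<ell>\<^sup>2\<close> both sides vanish.\<close>

lemma bop_smult: "T \<in> bop X \<Longrightarrow> T (\<lambda>p. w * \<xi> p) = (\<lambda>p. w * T \<xi> p)"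
proof (cases "\<xi> \<in> ell2 X")
  case False
  assume T: "T \<in> bop X"
  show ?thesis
  proof (cases "w = 0")
    case False
    then have "(\<lambda>p. w * \<xi> p) \<notin> ell2 X"
      using \<open>\<xi> \<notin> ell2 X\<close> ell2_smult(1)[of "\<lambda>p. w * \<xi> p" X "inverse w"] by (auto simp: mult.assoc[symmetric])
    then show ?thesis using bop_off[OF T] \<open>\<xi> \<notin> ell2 X\<close> by simp
  qed (simp add: bop_zero[OF T])
qed (simp add: bop_def)

lemma bop_diff:
  assumes "T \<in> bop X" "\<xi> \<in> ell2 X" "\<eta> \<in> ell2 X"
  shows "T (\<lambda>p. \<xi> p - \<eta> p) = (\<lambda>p. T \<xi> p - T \<eta> p)"
  using bop_add[OF assms(1,2) ell2_smult(1)[OF assms(3), of "-1"]] bop_smult[OF assms(1), of "-1" \<eta>]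
  by simp

lemma bop_sum:
  assumes "T \<in> bop X" "finite I" "\<And>i. i \<in> I \<Longrightarrow> \<xi> i \<in> ell2 X"
  shows "T (\<lambda>p. \<Sum>i\<in>I. w i * \<xi> i p) = (\<lambda>p. \<Sum>i\<in>I. w i * T (\<xi> i) p)"
  using assms(2,3)
proof (induction I rule: finite_induct)
  case (insert i I)
  then show ?case
    using bop_add[OF assms(1), of "\<lambda>p. w i * \<xi> i p" "\<lambda>p. \<Sum>i\<in>I. w i * \<xi> i p"]
    by (simp add: ell2_sum ell2_smult bop_smult[OF assms(1)])
qed (simp add: bop_zero[OF assms(1)])

lemma bopI:
  assumes "\<And>\<xi>. \<xi> \<in> ell2 X \<Longrightarrow> T \<xi> \<in> ell2 X \<and> ell2_norm X (T \<xi>) \<le> C * ell2_norm X \<xi>"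
    and "\<And>\<xi>. \<xi> \<notin> ell2 X \<Longrightarrow> T \<xi> = (\<lambda>_. 0)"
    and "\<And>\<xi> \<eta>. \<xi> \<in> ell2 X \<Longrightarrow> \<eta> \<in> ell2 X \<Longrightarrow> T (\<lambda>p. \<xi> p + \<eta> p) = (\<lambda>p. T \<xi> p + T \<eta> p)"
    and "\<And>w \<xi>. \<xi> \<in> ell2 X \<Longrightarrow> T (\<lambda>p. w * \<xi> p) = (\<lambda>p. w * T \<xi> p)"
  shows "T \<in> bop X"
  using assms unfolding bop_def bounded_on_def by auto

lemma bop_bounded:
  assumes "T \<in> bop X"
  shows "\<exists>C\<ge>0. \<forall>\<xi>\<in>ell2 X. ell2_norm X (T \<xi>) \<le> C * ell2_norm X \<xi>"
proof -
  obtain C where C: "\<And>\<xi>. \<xi> \<in> ell2 X \<Longrightarrow> ell2_norm X (T \<xi>) \<le> C * ell2_norm X \<xi>"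
    using assms unfolding bop_def bounded_on_def by blast
  have "ell2_norm X (T \<xi>) \<le> max C 0 * ell2_norm X \<xi>" if "\<xi> \<in> ell2 X" for \<xi>
    using C[OF that] mult_right_mono[of C "max C 0" "ell2_norm X \<xi>"] by simp
  then show ?thesis by (intro exI[of _ "max C 0"]) simp
qed

lemma bop_opnorm:
  assumes "T \<in> bop X" "\<xi> \<in> ell2 X"
  shows "ell2_norm X (T \<xi>) \<le> opnorm X (ell2 X) T * ell2_norm X \<xi>"
proof (rule le_opnorm)
  show "bounded_on X (ell2 X) T" using assms(1) unfolding bop_def by simp
  fix r :: real
  show "(\<lambda>p. r *\<^sub>R \<xi> p) \<in> ell2 X \<and> T (\<lambda>p. r *\<^sub>R \<xi> p) = (\<lambda>p. r *\<^sub>R T \<xi> p)"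
    using ell2_smult(1)[OF assms(2), of "of_real r"] bop_smult[OF assms(1), of "of_real r" \<xi>]
    by (simp add: scaleR_conv_of_real)
qed (use assms in \<open>auto simp: bop_ell2\<close>)

text \<open>Bounds obtained from \<open>[D, a]\<close> hold only on finitely supported vectors. The
  a priori boundedness of \<open>T\<close>, with whatever constant, lets the sharper constant
  \<open>C\<close> pass to all vectors.\<close>

lemma bop_le_by_fin_supp:
  assumes "T \<in> bop X" "0 \<le> C"
    and "\<And>\<zeta>. \<zeta> \<in> fin_supp X \<Longrightarrow> ell2_norm X (T \<zeta>) \<le> C * ell2_norm X \<zeta>" and \<xi>: "\<xi> \<in> ell2 X"
  shows "ell2_norm X (T \<xi>) \<le> C * ell2_norm X \<xi>"
proof -
  obtain K where K: "0 \<le> K" "\<And>\<xi>. \<xi> \<in> ell2 X \<Longrightarrow> ell2_norm X (T \<xi>) \<le> K * ell2_norm X \<xi>"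
    using bop_bounded[OF assms(1)] by blast
  show ?thesis
  proof (rule le_by_ell2_approx[OF \<xi>, where M = K])
    fix \<zeta> :: "'a \<Rightarrow> complex" assume \<zeta>: "\<zeta> \<in> fin_supp X" "ell2_norm X \<zeta> \<le> ell2_norm X \<xi>"
    have z: "\<zeta> \<in> ell2 X" "(\<lambda>p. \<xi> p - \<zeta> p) \<in> ell2 X" using \<zeta>(1) \<xi> by (auto simp: fin_supp_ell2 ell2_diff)
    have "T \<xi> = (\<lambda>p. T \<zeta> p + T (\<lambda>p. \<xi> p - \<zeta> p) p)"
      using bop_add[OF assms(1) z] by simp
    then have "ell2_norm X (T \<xi>) \<le> ell2_norm X (T \<zeta>) + ell2_norm X (T (\<lambda>p. \<xi> p - \<zeta> p))"
      using ell2_add(2)[OF bop_ell2[OF assms(1) z(1)] bop_ell2[OF assms(1) z(2)]] by simp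
    also have "\<dots> \<le> C * ell2_norm X \<zeta> + K * ell2_norm X (\<lambda>p. \<xi> p - \<zeta> p)"
      by (intro add_mono assms(3) K \<zeta> z)
    also have "C * ell2_norm X \<zeta> \<le> C * ell2_norm X \<xi>"
      using \<zeta>(2) assms(2) by (rule mult_left_mono)
    finally show "ell2_norm X (T \<xi>) \<le> C * ell2_norm X \<xi> + K * ell2_norm X (\<lambda>p. \<xi> p - \<zeta> p)"
      by simp
  qed
qed

section \<open>Matrix columns and existence of adjoints\<close>

definition delta :: "'g \<Rightarrow> 'g \<Rightarrow> complex" where
  "delta p = (\<lambda>q. if q = p then 1 else 0)"

lemma delta_ell2: "p \<in> X \<Longrightarrow> delta p \<in> ell2 X"
  by (rule fin_supp_ell2) (auto simp: fin_supp_def delta_def)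

lemma bop_fin_supp:
  assumes "T \<in> bop X" "\<zeta> \<in> fin_supp X"
  shows "T \<zeta> = (\<lambda>m. \<Sum>p | \<zeta> p \<noteq> 0. \<zeta> p * T (delta p) m)"
proof -
  have fin: "finite {p. \<zeta> p \<noteq> 0}" "\<And>p. p \<in> {p. \<zeta> p \<noteq> 0} \<Longrightarrow> delta p \<in> ell2 X"
    using assms(2) by (auto simp: fin_supp_def intro: delta_ell2)
  have "\<zeta> = (\<lambda>m. \<Sum>p | \<zeta> p \<noteq> 0. \<zeta> p * delta p m)"
  proof
    fix m
    have "(\<Sum>p | \<zeta> p \<noteq> 0. \<zeta> p * delta p m) = (\<Sum>p | \<zeta> p \<noteq> 0. if p = m then \<zeta> m else 0)"
      by (intro sum.cong) (auto simp: delta_def)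
    then show "\<zeta> m = (\<Sum>p | \<zeta> p \<noteq> 0. \<zeta> p * delta p m)" using fin(1) by (simp add: sum.delta)
  qed
  then have "T \<zeta> = T (\<lambda>m. \<Sum>p | \<zeta> p \<noteq> 0. \<zeta> p * delta p m)" by simp
  also have "\<dots> = (\<lambda>m. \<Sum>p | \<zeta> p \<noteq> 0. \<zeta> p * T (delta p) m)"
    by (rule bop_sum[OF assms(1) fin])
  finally show ?thesis .
qed

text \<open>\<open>adj\<close> is a choice term. With this relation an adjoint can be exhibited
  concretely and identified with \<open>adj\<close> afterwards.\<close>

definition adj_pair :: "'g set \<Rightarrow> 'g oper \<Rightarrow> 'g oper \<Rightarrow> bool" where
  "adj_pair X a b \<longleftrightarrow> a \<in> bop X \<and> b \<in> bop X \<and>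
     (\<forall>\<xi>\<in>ell2 X. \<forall>\<eta>\<in>ell2 X. ell2_inner X (a \<xi>) \<eta> = ell2_inner X \<xi> (b \<eta>))"

lemma adj_pairD:
  assumes "adj_pair X a b"
  shows "a \<in> bop X" "b \<in> bop X"
    "\<xi> \<in> ell2 X \<Longrightarrow> \<eta> \<in> ell2 X \<Longrightarrow> ell2_inner X (a \<xi>) \<eta> = ell2_inner X \<xi> (b \<eta>)"
  using assms unfolding adj_pair_def by auto

lemma adj_pair_sym: "adj_pair X a b \<Longrightarrow> adj_pair X b a"
  unfolding adj_pair_def using ell2_inner_commute by metis

lemma adj_pair_unique:
  assumes "adj_pair X a b" "adj_pair X a b'"
  shows "b = b'"
proof
  fix \<eta>
  show "b \<eta> = b' \<eta>"
  proof (cases "\<eta> \<in> ell2 X")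
    case True
    show ?thesis
    proof (rule ell2_inner_ext)
      fix \<zeta> :: "'a \<Rightarrow> complex" assume "\<zeta> \<in> ell2 X"
      then show "ell2_inner X (b \<eta>) \<zeta> = ell2_inner X (b' \<eta>) \<zeta>"
        using adj_pairD(3)[OF adj_pair_sym[OF assms(1)] True] adj_pairD(3)[OF adj_pair_sym[OF assms(2)] True]
        by simp
    qed (use assms True in \<open>auto simp: adj_pair_def bop_ell2\<close>)
  next
    case False
    then show ?thesis using bop_off[OF adj_pairD(2)[OF assms(1)]] bop_off[OF adj_pairD(2)[OF assms(2)]] by simp
  qed
qed

text \<open>In place of Riesz representation, the adjoint is written down from the columns of
  \<open>a\<close>. The adjoint identity is a finite computation against finitely supported vectors;
  that gives the bound on \<open>b\<close> by duality, and the bound then extends the identity to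
  all vectors.\<close>

lemma adj_pair_exists:
  assumes a: "a \<in> bop X"
  shows "\<exists>b. adj_pair X a b"
proof -
  obtain K where K: "0 \<le> K" "\<And>\<xi>. \<xi> \<in> ell2 X \<Longrightarrow> ell2_norm X (a \<xi>) \<le> K * ell2_norm X \<xi>"
    using bop_bounded[OF a] by blast
  define b where "b = on_ell2 X (\<lambda>\<eta> p. if p \<in> X then ell2_inner X \<eta> (a (delta p)) else 0)"
  have fin: "ell2_inner X (b \<eta>) \<zeta> = ell2_inner X \<eta> (a \<zeta>)" if "\<eta> \<in> ell2 X" "\<zeta> \<in> fin_supp X" for \<eta> \<zeta>
  proof -
    have f: "finite {p. \<zeta> p \<noteq> 0}" "{p. \<zeta> p \<noteq> 0} \<subseteq> X" using that(2) by (auto simp: fin_supp_def)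
    have "ell2_inner X (a \<zeta>) \<eta> = (\<Sum>p | \<zeta> p \<noteq> 0. ell2_inner X (\<lambda>m. \<zeta> p * a (delta p) m) \<eta>)"
      unfolding bop_fin_supp[OF a that(2)] using f that
      by (intro ell2_inner_sum_left ell2_smult bop_ell2[OF a] delta_ell2) auto
    then have "ell2_inner X \<eta> (a \<zeta>) = (\<Sum>p | \<zeta> p \<noteq> 0. ell2_inner X \<eta> (a (delta p)) * cnj (\<zeta> p))"
      by (simp add: ell2_inner_smult_left ell2_inner_commute[of X \<eta>] mult.commute)
    also have "\<dots> = ell2_inner X (b \<eta>) \<zeta>"
      unfolding ell2_inner_fin_supp[OF that(2)]
      using f that(1) by (intro sum.cong) (auto simp: b_def on_ell2_def)
    finally show ?thesis by simp
  qed
  have bnd: "b \<eta> \<in> ell2 X \<and> ell2_norm X (b \<eta>) \<le> K * ell2_norm X \<eta>" if \<eta>: "\<eta> \<in> ell2 X" for \<eta>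
  proof -
    have 1: "b \<eta> p = 0" if "p \<notin> X" for p using that \<eta> by (simp add: b_def on_ell2_def)
    have 2: "norm (ell2_inner X (b \<eta>) \<zeta>) \<le> K * ell2_norm X \<eta> * ell2_norm X \<zeta>"
      if \<zeta>: "\<zeta> \<in> fin_supp X" for \<zeta>
    proof -
      have z: "\<zeta> \<in> ell2 X" using \<zeta> by (rule fin_supp_ell2)
      have "norm (ell2_inner X (b \<eta>) \<zeta>) \<le> ell2_norm X \<eta> * ell2_norm X (a \<zeta>)"
        unfolding fin[OF \<eta> \<zeta>] using \<eta> z by (intro ell2_Cauchy_Schwarz bop_ell2[OF a])
      also have "\<dots> \<le> ell2_norm X \<eta> * (K * ell2_norm X \<zeta>)"
        using K(2)[OF z] by (intro mult_left_mono) auto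
      finally show ?thesis by (simp add: mult_ac)
    qed
    show ?thesis
      using ell2_norm_le_dual[of X "b \<eta>" "K * ell2_norm X \<eta>", OF 1 _ 2] K(1) by auto
  qed
  have bb: "b \<in> bop X"
  proof (rule bopI[where C = K])
    show "b \<xi> \<in> ell2 X \<and> ell2_norm X (b \<xi>) \<le> K * ell2_norm X \<xi>" if "\<xi> \<in> ell2 X" for \<xi>
      by (rule bnd[OF that])
  qed (auto simp: b_def on_ell2_def ell2_add ell2_smult ell2_inner_smult_left
       intro!: ext ell2_inner_add_left bop_ell2[OF a] delta_ell2)
  have "ell2_inner X (a \<xi>) \<eta> = ell2_inner X \<xi> (b \<eta>)" if \<xi>: "\<xi> \<in> ell2 X" and \<eta>: "\<eta> \<in> ell2 X" for \<xi> \<eta>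
  proof -
    have "norm (ell2_inner X (a \<xi>) \<eta> - ell2_inner X \<xi> (b \<eta>)) \<le> 0"
    \<comment> \<open>The difference vanishes at \<zeta>, so only the remainder \<rho> contributes.
      Each of its two terms is at most K times the norms of \<rho> and \<eta>, whence the 2.\<close>
    proof (rule le_by_ell2_approx[OF \<xi>, where M = "2 * K * ell2_norm X \<eta>"])
      fix \<zeta> :: "'a \<Rightarrow> complex" assume \<zeta>: "\<zeta> \<in> fin_supp X" "ell2_norm X \<zeta> \<le> ell2_norm X \<xi>"
      define \<rho> where "\<rho> = (\<lambda>p. \<xi> p - \<zeta> p)"
      have z: "\<zeta> \<in> ell2 X" "\<rho> \<in> ell2 X" using \<zeta>(1) \<xi> by (auto simp: \<rho>_def fin_supp_ell2 ell2_diff)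
      have \<xi>': "\<xi> = (\<lambda>p. \<zeta> p + \<rho> p)" by (simp add: \<rho>_def)
      have "ell2_inner X (a \<xi>) \<eta> - ell2_inner X \<xi> (b \<eta>) = ell2_inner X (a \<rho>) \<eta> - ell2_inner X \<rho> (b \<eta>)"
        using fin[OF \<eta> \<zeta>(1)] unfolding \<xi>'
        by (simp add: bop_add[OF a] ell2_inner_add_left z \<eta> bop_ell2[OF a] bnd ell2_inner_commute[of X \<zeta>]
            ell2_inner_commute[of X "a \<zeta>"])
      also have "norm \<dots> \<le> norm (ell2_inner X (a \<rho>) \<eta>) + norm (ell2_inner X \<rho> (b \<eta>))"
        by (rule norm_triangle_ineq4)
      also have "\<dots> \<le> ell2_norm X (a \<rho>) * ell2_norm X \<eta> + ell2_norm X \<rho> * ell2_norm X (b \<eta>)"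
        using z \<eta> bnd[OF \<eta>] by (intro add_mono ell2_Cauchy_Schwarz) (auto simp: bop_ell2[OF a])
      also have "\<dots> \<le> (K * ell2_norm X \<rho>) * ell2_norm X \<eta> + ell2_norm X \<rho> * (K * ell2_norm X \<eta>)"
        using K(2)[OF z(2)] bnd[OF \<eta>] by (intro add_mono mult_right_mono mult_left_mono) auto
      finally show "norm (ell2_inner X (a \<xi>) \<eta> - ell2_inner X \<xi> (b \<eta>))
          \<le> 0 + 2 * K * ell2_norm X \<eta> * ell2_norm X (\<lambda>p. \<xi> p - \<zeta> p)"
        by (simp add: \<rho>_def[symmetric] algebra_simps)
    qed
    then show ?thesis by simp
  qed
  with a bb show ?thesis unfolding adj_pair_def by blast
qed

lemma adj_pair_adj:
  assumes "a \<in> bop X"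
  shows "adj_pair X a (adj X a)"
proof -
  have "adj X a = (SOME b. adj_pair X a b)"
    unfolding adj_def adj_pair_def using assms by simp
  then show ?thesis using someI_ex[OF adj_pair_exists[OF assms]] by simp
qed

lemma adj_eqI: "adj_pair X a b \<Longrightarrow> adj X a = b"
  using adj_pair_adj adj_pair_unique adj_pairD(1) by metis

text \<open>One form for sums, differences, real and imaginary parts and commutators, so that
  boundedness, adjoints and commutation are treated once.\<close>

definition lincomb :: "complex \<Rightarrow> 'g oper \<Rightarrow> complex \<Rightarrow> 'g oper \<Rightarrow> 'g oper" where
  "lincomb w a w' b = (\<lambda>\<xi> p. w * a \<xi> p + w' * b \<xi> p)"

lemma Re_op_eq: "Re_op X b = lincomb (1/2) b (1/2) (adj X b)"
  by (simp add: Re_op_def lincomb_def add_divide_distrib)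

lemma Im_op_eq: "Im_op X b = lincomb (1/(2*\<i>)) b (- 1/(2*\<i>)) (adj X b)"
  by (simp add: Im_op_def lincomb_def diff_divide_distrib algebra_simps)

lemma bop_lincomb:
  assumes "a \<in> bop X" "b \<in> bop X"
  shows "lincomb w a w' b \<in> bop X"
proof -
  obtain K where K: "0 \<le> K" "\<And>\<xi>. \<xi> \<in> ell2 X \<Longrightarrow> ell2_norm X (a \<xi>) \<le> K * ell2_norm X \<xi>"
    using bop_bounded[OF assms(1)] by blast
  obtain K' where K': "0 \<le> K'" "\<And>\<xi>. \<xi> \<in> ell2 X \<Longrightarrow> ell2_norm X (b \<xi>) \<le> K' * ell2_norm X \<xi>"
    using bop_bounded[OF assms(2)] by blast
  show ?thesis
  proof (rule bopI[where C = "norm w * K + norm w' * K'"])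
    fix \<xi> :: "'a \<Rightarrow> complex" assume \<xi>: "\<xi> \<in> ell2 X"
    note m = ell2_smult[OF bop_ell2[OF assms(1) \<xi>], of w] ell2_smult[OF bop_ell2[OF assms(2) \<xi>], of w']
    have "ell2_norm X (lincomb w a w' b \<xi>) \<le> norm w * ell2_norm X (a \<xi>) + norm w' * ell2_norm X (b \<xi>)"
      using ell2_add(2)[OF m(1,3)] by (simp add: lincomb_def m)
    also have "\<dots> \<le> norm w * (K * ell2_norm X \<xi>) + norm w' * (K' * ell2_norm X \<xi>)"
      using K(2)[OF \<xi>] K'(2)[OF \<xi>] by (intro add_mono mult_left_mono) auto
    finally show "lincomb w a w' b \<xi> \<in> ell2 X \<and>
        ell2_norm X (lincomb w a w' b \<xi>) \<le> (norm w * K + norm w' * K') * ell2_norm X \<xi>"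
      using ell2_add(1)[OF m(1,3)] by (simp add: lincomb_def algebra_simps)
  qed (auto simp: lincomb_def bop_off[OF assms(1)] bop_off[OF assms(2)] bop_add[OF assms(1)]
      bop_add[OF assms(2)] bop_smult[OF assms(1)] bop_smult[OF assms(2)] algebra_simps)
qed

lemma adj_pair_lincomb:
  assumes "adj_pair X a a'" "adj_pair X b b'"
  shows "adj_pair X (lincomb w a w' b) (lincomb (cnj w) a' (cnj w') b')"
  unfolding adj_pair_def
proof (intro conjI ballI bop_lincomb)
  fix \<xi> \<eta> :: "'a \<Rightarrow> complex" assume "\<xi> \<in> ell2 X" "\<eta> \<in> ell2 X"
  then show "ell2_inner X (lincomb w a w' b \<xi>) \<eta> = ell2_inner X \<xi> (lincomb (cnj w) a' (cnj w') b' \<eta>)"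
    using assms unfolding lincomb_def adj_pair_def
    by (simp add: ell2_inner_add_left ell2_inner_add_right ell2_smult bop_ell2 ell2_inner_smult_left
        ell2_inner_smult_right)
qed (use assms in \<open>auto simp: adj_pair_def\<close>)

lemma bop_Im_op: "b \<in> bop X \<Longrightarrow> Im_op X b \<in> bop X"
  unfolding Im_op_eq by (intro bop_lincomb adj_pairD(2)[OF adj_pair_adj])

lemma bop_comp:
  assumes "a \<in> bop X" "b \<in> bop X"
  shows "a \<circ> b \<in> bop X"
proof -
  obtain K where K: "0 \<le> K" "\<And>\<xi>. \<xi> \<in> ell2 X \<Longrightarrow> ell2_norm X (a \<xi>) \<le> K * ell2_norm X \<xi>"
    using bop_bounded[OF assms(1)] by blast
  obtain K' where K': "0 \<le> K'" "\<And>\<xi>. \<xi> \<in> ell2 X \<Longrightarrow> ell2_norm X (b \<xi>) \<le> K' * ell2_norm X \<xi>"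
    using bop_bounded[OF assms(2)] by blast
  show ?thesis
  proof (rule bopI[where C = "K * K'"])
    fix \<xi> :: "'a \<Rightarrow> complex" assume \<xi>: "\<xi> \<in> ell2 X"
    have "ell2_norm X (a (b \<xi>)) \<le> K * ell2_norm X (b \<xi>)" by (rule K(2)[OF bop_ell2[OF assms(2) \<xi>]])
    also have "\<dots> \<le> K * (K' * ell2_norm X \<xi>)" by (rule mult_left_mono[OF K'(2)[OF \<xi>] K(1)])
    finally show "(a \<circ> b) \<xi> \<in> ell2 X \<and> ell2_norm X ((a \<circ> b) \<xi>) \<le> K * K' * ell2_norm X \<xi>"
      using assms \<xi> by (simp add: bop_ell2 mult.assoc)
  qed (auto simp: bop_off[OF assms(2)] bop_add[OF assms(2)] bop_smult[OF assms(2)]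
      bop_ell2[OF assms(2)] bop_zero[OF assms(1)] bop_add[OF assms(1)] bop_smult[OF assms(1)])
qed

lemma adj_pair_comp:
  assumes "adj_pair X a a'" "adj_pair X b b'"
  shows "adj_pair X (a \<circ> b) (b' \<circ> a')"
  using assms unfolding adj_pair_def by (auto simp: bop_comp bop_ell2)

section \<open>Commutants of unitaries\<close>

definition unitary_pair :: "'g set \<Rightarrow> 'g oper \<Rightarrow> 'g oper \<Rightarrow> bool" where
  "unitary_pair X V V' \<longleftrightarrow> adj_pair X V V' \<and> (\<forall>\<xi>\<in>ell2 X. V (V' \<xi>) = \<xi> \<and> V' (V \<xi>) = \<xi>)"

text \<open>Tested on square summable vectors only, so that the second operator need not belong to
  \<open>bop X\<close>: the right action, as a map of its vector argument, is used in this
  position.\<close>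

definition commutes_on :: "'g set \<Rightarrow> 'g oper \<Rightarrow> 'g oper \<Rightarrow> bool" where
  "commutes_on X a V \<longleftrightarrow> (\<forall>\<xi>\<in>ell2 X. a (V \<xi>) = V (a \<xi>))"

lemma commutes_on_lincomb:
  assumes a: "a \<in> bop X" and "P \<in> bop X" "Q \<in> bop X" "commutes_on X a P" "commutes_on X a Q"
  shows "commutes_on X a (lincomb w P w' Q)"
  using assms(2-) by (auto simp: commutes_on_def lincomb_def bop_add[OF a] bop_smult[OF a] ell2_smult bop_ell2)

lemma commutes_on_inverse:
  assumes "unitary_pair X V V'" "a \<in> bop X" "commutes_on X a V"
  shows "commutes_on X a V'"
  unfolding commutes_on_def
proof
  fix \<xi> :: "'a \<Rightarrow> complex" assume \<xi>: "\<xi> \<in> ell2 X"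
  have V: "V \<in> bop X" "V' \<in> bop X" using assms(1) by (auto simp: unitary_pair_def adj_pair_def)
  have "a (V' \<xi>) = V' (V (a (V' \<xi>)))"
    using assms(1,2) \<xi> V by (simp add: unitary_pair_def bop_ell2)
  also have "V (a (V' \<xi>)) = a (V (V' \<xi>))"
    using assms(3) \<xi> V by (simp add: commutes_on_def bop_ell2)
  also have "\<dots> = a \<xi>" using assms(1) \<xi> by (simp add: unitary_pair_def)
  finally show "a (V' \<xi>) = V' (a \<xi>)" .
qed

text \<open>Taking adjoints of \<open>a V' = V' a\<close> exchanges \<open>V'\<close> for
  \<open>V\<close>; the two operators therefore have to be treated as a pair.\<close>

lemma commutes_on_adj:
  assumes "adj_pair X V V'" "adj_pair X a a'" "commutes_on X a V'"
  shows "commutes_on X a' V"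
  unfolding commutes_on_def
proof
  fix \<xi> :: "'a \<Rightarrow> complex" assume \<xi>: "\<xi> \<in> ell2 X"
  note b = adj_pairD(1,2)[OF assms(1)] adj_pairD(1,2)[OF assms(2)]
  show "a' (V \<xi>) = V (a' \<xi>)"
  proof (rule ell2_inner_ext)
    fix \<zeta> :: "'a \<Rightarrow> complex" assume \<zeta>: "\<zeta> \<in> ell2 X"
    have "ell2_inner X (a' (V \<xi>)) \<zeta> = ell2_inner X \<xi> (V' (a \<zeta>))"
      using \<xi> \<zeta> b by (simp add: adj_pairD(3)[OF adj_pair_sym[OF assms(2)]] adj_pairD(3)[OF assms(1)] bop_ell2)
    also have "\<dots> = ell2_inner X \<xi> (a (V' \<zeta>))"
      using assms(3) \<zeta> by (simp add: commutes_on_def)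
    also have "\<dots> = ell2_inner X (V (a' \<xi>)) \<zeta>"
      using \<xi> \<zeta> b by (simp add: adj_pairD(3)[OF adj_pair_sym[OF assms(2)]] adj_pairD(3)[OF assms(1)] bop_ell2)
    finally show "ell2_inner X (a' (V \<xi>)) \<zeta> = ell2_inner X (V (a' \<xi>)) \<zeta>" .
  qed (use b \<xi> in \<open>auto simp: bop_ell2\<close>)
qed

lemma commutes_on_limit:
  assumes V: "V \<in> bop X" and s: "\<And>i::nat. s i \<in> bop X \<and> commutes_on X (s i) V" and a: "a \<in> bop X"
    and lim: "(\<lambda>i. opnorm X (ell2 X) (\<lambda>\<xi> p. s i \<xi> p - a \<xi> p)) \<longlonglongrightarrow> 0"
  shows "commutes_on X a V"
  unfolding commutes_on_def
proof
  fix \<xi> :: "'a \<Rightarrow> complex" assume \<xi>: "\<xi> \<in> ell2 X"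
  obtain K where K: "0 \<le> K" "\<And>\<xi>. \<xi> \<in> ell2 X \<Longrightarrow> ell2_norm X (V \<xi>) \<le> K * ell2_norm X \<xi>"
    using bop_bounded[OF V] by blast
  define t where "t i = (\<lambda>\<xi> p. s i \<xi> p - a \<xi> p)" for i
  define o' where "o' i = opnorm X (ell2 X) (t i)" for i
  have t: "t i \<in> bop X" for i
    using bop_lincomb[of "s i" X a 1 "-1"] s a by (simp add: t_def lincomb_def)
  have \<rho>: "(\<lambda>p. a (V \<xi>) p - V (a \<xi>) p) \<in> ell2 X"
    using \<xi> a V by (simp add: ell2_diff bop_ell2)
  have le: "ell2_norm X (\<lambda>p. a (V \<xi>) p - V (a \<xi>) p) \<le> \<bar>o' i\<bar> * (2 * K * ell2_norm X \<xi>)" for i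
  proof -
    have "V (t i \<xi>) = (\<lambda>p. V (s i \<xi>) p - V (a \<xi>) p)"
      unfolding t_def by (rule bop_diff[OF V bop_ell2[OF _ \<xi>] bop_ell2[OF a \<xi>]]) (use s in blast)
    moreover have "V (s i \<xi>) = s i (V \<xi>)" using s \<xi> by (simp add: commutes_on_def)
    \<comment> \<open>As \<open>s i\<close> commutes with \<open>V\<close>, the commutator of
      \<open>a\<close> with \<open>V\<close> equals that of the error \<open>t i\<close> up to sign,
      and so tends to 0 with it.\<close>
    ultimately have "(\<lambda>p. a (V \<xi>) p - V (a \<xi>) p) = (\<lambda>p. V (t i \<xi>) p - t i (V \<xi>) p)"
      by (simp add: t_def)
    then have "ell2_norm X (\<lambda>p. a (V \<xi>) p - V (a \<xi>) p) \<le> ell2_norm X (V (t i \<xi>)) + ell2_norm X (t i (V \<xi>))"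
      using ell2_diff(2)[of "V (t i \<xi>)" X "t i (V \<xi>)"] V t \<xi> by (simp add: bop_ell2)
    also have "\<dots> \<le> K * (\<bar>o' i\<bar> * ell2_norm X \<xi>) + \<bar>o' i\<bar> * (K * ell2_norm X \<xi>)"
    proof (rule add_mono)
      have "ell2_norm X (t i \<xi>) \<le> \<bar>o' i\<bar> * ell2_norm X \<xi>"
        unfolding o'_def by (rule order_trans[OF bop_opnorm[OF t \<xi>] mult_right_mono]) auto
      then show "ell2_norm X (V (t i \<xi>)) \<le> K * (\<bar>o' i\<bar> * ell2_norm X \<xi>)"
        using K(1) by (rule order_trans[OF K(2)[OF bop_ell2[OF t \<xi>]] mult_left_mono])
      have "ell2_norm X (t i (V \<xi>)) \<le> o' i * ell2_norm X (V \<xi>)"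
        unfolding o'_def by (rule bop_opnorm[OF t bop_ell2[OF V \<xi>]])
      also have "\<dots> \<le> \<bar>o' i\<bar> * (K * ell2_norm X \<xi>)" using K(2)[OF \<xi>] by (intro mult_mono) auto
      finally show "ell2_norm X (t i (V \<xi>)) \<le> \<bar>o' i\<bar> * (K * ell2_norm X \<xi>)" .
    qed
    finally show ?thesis by (simp add: algebra_simps)
  qed
  have "(\<lambda>i. \<bar>o' i\<bar> * (2 * K * ell2_norm X \<xi>)) \<longlonglongrightarrow> 0 * (2 * K * ell2_norm X \<xi>)"
    using lim unfolding o'_def t_def by (intro tendsto_mult_right tendsto_rabs_zero)
  then have "ell2_norm X (\<lambda>p. a (V \<xi>) p - V (a \<xi>) p) \<le> 0"
    using le by (intro LIMSEQ_le_const[of _ 0]) auto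
  from ell2_norm_eq_0[OF \<rho> this] show "a (V \<xi>) = V (a \<xi>)"
    by (auto simp: fun_eq_iff)
qed

text \<open>The commutant of \<open>V\<close> alone need not be closed under adjoints; that of an
  operator together with its adjoint is.\<close>

lemma commutant_cstar:
  assumes "adj_pair X V V'"
  shows "cstar_subalgebra X {a \<in> bop X. commutes_on X a V \<and> commutes_on X a V'}"
  unfolding cstar_subalgebra_def
proof (intro conjI ballI allI impI)
  note b = adj_pairD(1,2)[OF assms]
  let ?A = "{a \<in> bop X. commutes_on X a V \<and> commutes_on X a V'}"
  show "?A \<subseteq> bop X" by auto
  show "(\<lambda>\<xi> p. 0) \<in> ?A"
    using b by (auto simp: commutes_on_def bop_zero[OF b(1)] bop_zero[OF b(2)] intro!: bopI[where C = 0])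
  fix a c assume ac: "a \<in> ?A" "c \<in> ?A"
  show "a \<circ> c \<in> ?A" using ac b by (auto simp: commutes_on_def bop_comp) (simp_all add: bop_ell2)
  show "(\<lambda>\<xi> p. a \<xi> p + c \<xi> p) \<in> ?A"
    using ac b bop_lincomb[of a X c 1 1] by (auto simp: commutes_on_def lincomb_def bop_add[OF b(1)] bop_add[OF b(2)] bop_ell2)
next
  note b = adj_pairD(1,2)[OF assms]
  let ?A = "{a \<in> bop X. commutes_on X a V \<and> commutes_on X a V'}"
  fix a w assume a: "a \<in> ?A"
  show "(\<lambda>\<xi> p. w * a \<xi> p) \<in> ?A"
    using a b bop_lincomb[of a X a w 0] by (auto simp: commutes_on_def lincomb_def bop_smult[OF b(1)] bop_smult[OF b(2)])
next
  let ?A = "{a \<in> bop X. commutes_on X a V \<and> commutes_on X a V'}"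
  fix a assume "a \<in> ?A"
  then show "adj X a \<in> ?A"
    using adj_pair_adj[of a X] commutes_on_adj[OF assms, of a] commutes_on_adj[OF adj_pair_sym[OF assms], of a]
    by (auto simp: adj_pair_def)
next
  note b = adj_pairD(1,2)[OF assms]
  let ?A = "{a \<in> bop X. commutes_on X a V \<and> commutes_on X a V'}"
  fix s a assume "(\<forall>i::nat. s i \<in> ?A) \<and> a \<in> bop X \<and>
    (\<lambda>i. opnorm X (ell2 X) (\<lambda>\<xi> p. s i \<xi> p - a \<xi> p)) \<longlonglongrightarrow> 0"
  then show "a \<in> ?A"
    using commutes_on_limit[OF b(1), of s a] commutes_on_limit[OF b(2), of s a] by auto
qed

text \<open>\<open>cstar_gen\<close> is an intersection, hence contained in the commutant as soon as
  the generators are. For a unitary, commuting with \<open>V\<close> already implies commuting with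
  its inverse, so the generators are tested against \<open>V\<close> only.\<close>

lemma cstar_gen_commutes:
  assumes "unitary_pair X V V'" "S \<subseteq> bop X" "\<And>s. s \<in> S \<Longrightarrow> commutes_on X s V" "a \<in> cstar_gen X S"
  shows "a \<in> bop X" "commutes_on X a V" "commutes_on X a V'"
proof -
  have "S \<subseteq> {a \<in> bop X. commutes_on X a V \<and> commutes_on X a V'}"
    using assms(1-3) commutes_on_inverse[OF assms(1)] by auto
  moreover have "adj_pair X V V'" using assms(1) by (simp add: unitary_pair_def)
  ultimately have "a \<in> {a \<in> bop X. commutes_on X a V \<and> commutes_on X a V'}"
    using assms(4) commutant_cstar unfolding cstar_gen_def by blast
  then show "a \<in> bop X" "commutes_on X a V" "commutes_on X a V'" by auto
qed

section \<open>Unitaries and multiplication operators\<close>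

lemma unitary_pairD:
  assumes "unitary_pair X V V'"
  shows "adj_pair X V V'" "V \<in> bop X" "V' \<in> bop X"
    "\<xi> \<in> ell2 X \<Longrightarrow> V (V' \<xi>) = \<xi>" "\<xi> \<in> ell2 X \<Longrightarrow> V' (V \<xi>) = \<xi>"
  using assms by (auto simp: unitary_pair_def adj_pair_def)

lemma unitary_pair_sym: "unitary_pair X V V' \<Longrightarrow> unitary_pair X V' V"
  by (auto simp: unitary_pair_def adj_pair_sym)

lemma unitary_pair_comp:
  "unitary_pair X V V' \<Longrightarrow> unitary_pair X T T' \<Longrightarrow> unitary_pair X (V \<circ> T) (T' \<circ> V')"
  by (auto simp: unitary_pair_def adj_pair_comp) (simp_all add: adj_pair_def bop_ell2)

lemma unitary_norm:
  assumes "unitary_pair X V V'" "\<xi> \<in> ell2 X"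
  shows "ell2_norm X (V \<xi>) = ell2_norm X \<xi>"
proof -
  note u = unitary_pairD[OF assms(1)]
  have "ell2_inner X (V \<xi>) (V \<xi>) = ell2_inner X \<xi> \<xi>"
    using u assms(2) by (simp add: adj_pairD(3)[OF u(1)] bop_ell2)
  then have "(ell2_norm X (V \<xi>))\<^sup>2 = (ell2_norm X \<xi>)\<^sup>2"
    using assms(2) u by (simp add: ell2_inner_self bop_ell2 flip: of_real_power)
  then show ?thesis by simp
qed

definition diag :: "'g set \<Rightarrow> ('g \<Rightarrow> complex) \<Rightarrow> 'g oper" where
  "diag X u = on_ell2 X (\<lambda>\<xi> m. u m * \<xi> m)"

lemma diag_unitary:
  assumes "\<And>m. m \<in> X \<Longrightarrow> norm (u m) = 1"
  shows "unitary_pair X (diag X u) (diag X (\<lambda>m. cnj (u m)))"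
proof -
  \<comment> \<open>Nothing is known about \<open>v\<close> off \<open>X\<close>, but \<xi> vanishes
    there.\<close>
  have dom: "(\<lambda>m. v m * \<xi> m) \<in> ell2 X \<and> ell2_norm X (\<lambda>m. v m * \<xi> m) \<le> 1 * ell2_norm X \<xi>"
    if \<xi>: "\<xi> \<in> ell2 X" and v: "\<And>m. m \<in> X \<Longrightarrow> norm (v m) = 1" for v \<xi> :: "'a \<Rightarrow> complex"
  proof -
    have "norm (v m * \<xi> m) \<le> norm (\<xi> m)" for m
      by (cases "m \<in> X") (use v ell2_outside[OF \<xi>] in \<open>auto simp: norm_mult\<close>)
    then show ?thesis using ell2_dominated[of "\<lambda>m. v m * \<xi> m" \<xi> X] \<xi> by auto
  qed
  have b: "diag X v \<in> bop X" if "\<And>m. m \<in> X \<Longrightarrow> norm (v m) = 1" for v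
    by (rule bopI[where C = 1]) (use dom that in \<open>auto simp: diag_def on_ell2_def ell2_add ell2_smult algebra_simps\<close>)
  have uu: "u m * cnj (u m) = 1" if "m \<in> X" for m
    using assms[OF that] complex_norm_square[of "u m"] by simp
  have "ell2_inner X (diag X u \<xi>) \<eta> = ell2_inner X \<xi> (diag X (\<lambda>m. cnj (u m)) \<eta>)"
    if "\<xi> \<in> ell2 X" "\<eta> \<in> ell2 X" for \<xi> \<eta>
    using that by (simp add: ell2_inner_def diag_def on_ell2_def mult_ac)
  moreover have "u m * (cnj (u m) * \<xi> m) = \<xi> m" "cnj (u m) * (u m * \<xi> m) = \<xi> m" if "\<xi> \<in> ell2 X" for \<xi> m
    using that uu[of m] ell2_outside[OF that, of m] by (cases "m \<in> X"; simp add: mult_ac; metis mult.assoc mult.commute mult_1)+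
  ultimately show ?thesis
    using b[of u] b[of "\<lambda>m. cnj (u m)"] assms dom[of _ u] dom[of _ "\<lambda>m. cnj (u m)"]
    by (auto simp: unitary_pair_def adj_pair_def diag_def on_ell2_def)
qed

section \<open>Twisted translations\<close>

text \<open>The operator \<open>J a J\<close>, linear because two antilinear maps are composed. On
  square summable vectors the right action of \<open>b\<close> is
  \<open>conjJ G (adj (carrier G) b)\<close>.\<close>

definition conjJ :: "('g, 'm) monoid_scheme \<Rightarrow> 'g oper \<Rightarrow> 'g oper" where
  "conjJ G a = on_ell2 (carrier G) (\<lambda>\<xi>. Jop G (a (Jop G \<xi>)))"

lemma Jop_smult: "Jop G (\<lambda>p. w * \<xi> p) = (\<lambda>p. cnj w * Jop G \<xi> p)"
  by (auto simp: Jop_def)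

lemma Jop_add: "Jop G (\<lambda>p. \<xi> p + \<eta> p) = (\<lambda>p. Jop G \<xi> p + Jop G \<eta> p)"
  by (auto simp: Jop_def)

lemma cnj_eq_if_mult_eq_1: "norm u = 1 \<Longrightarrow> u * v = 1 \<Longrightarrow> cnj u = (v :: complex)"
proof -
  assume u: "norm u = 1" and uv: "u * v = 1"
  have "cnj u * u = 1" using complex_norm_square[of u] u by (simp add: mult.commute)
  then have "cnj u * (u * v) = v" by (simp add: mult.assoc[symmetric])
  with uv show ?thesis by simp
qed

locale twisted_group = comm_group G for G :: "('g, 'm) monoid_scheme" (structure) +
  fixes \<sigma> :: "'g \<times> 'g \<Rightarrow> complex"
  assumes normalized: "\<sigma> \<in> normalized_2cocycles G"
begin

abbreviation X where "X \<equiv> carrier G"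

lemma cocycle_norm [simp]: "x \<in> X \<Longrightarrow> y \<in> X \<Longrightarrow> norm (\<sigma> (x, y)) = 1"
proof -
  assume "x \<in> X" "y \<in> X"
  then have xy: "(x, y) \<in> X \<times> X" by simp
  have "\<sigma> \<in> X \<times> X \<rightarrow>\<^sub>E sphere 0 1"
    using normalized unfolding normalized_2cocycles_def by blast
  from PiE_mem[OF this xy] have "\<sigma> (x, y) \<in> sphere 0 1" .
  then show ?thesis by simp
qed

lemma cocycle:
  "x \<in> X \<Longrightarrow> y \<in> X \<Longrightarrow> z \<in> X \<Longrightarrow> \<sigma> (x, y) * \<sigma> (x \<otimes> y, z) = \<sigma> (x, y \<otimes> z) * \<sigma> (y, z)"
  using normalized unfolding normalized_2cocycles_def by blast

lemma cocycle_one [simp]: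
  "x \<in> X \<Longrightarrow> \<sigma> (\<one>, x) = 1" "x \<in> X \<Longrightarrow> \<sigma> (x, \<one>) = 1" "x \<in> X \<Longrightarrow> \<sigma> (x, inv x) = 1"
  using normalized unfolding normalized_2cocycles_def by auto

text \<open>The cocycle identity for (-x, x, y), with the normalization at (-x, x). It is what makes
  the translation by -x the inverse of the translation by x.\<close>

lemma cocycle_inv_left:
  assumes "x \<in> X" "y \<in> X"
  shows "\<sigma> (x, y) * \<sigma> (inv x, x \<otimes> y) = 1"
proof -
  have "\<sigma> (inv x, x) = 1" using cocycle_one(3)[of "inv x"] assms by simp
  then show ?thesis using cocycle[of "inv x" x y] assms by (simp add: mult.commute)
qed

text \<open>The cocycle identities for (x, y, -y) and (x+y, -y, -x) both collapse by normalization
  and share the factor at (x+y, -y). This rewrites the conjugation coming from \<open>J\<close> as a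
  value of \<sigma>.\<close>

lemma cnj_cocycle:
  assumes "x \<in> X" "y \<in> X"
  shows "cnj (\<sigma> (x, y)) = \<sigma> (inv y, inv x)"
proof (rule cnj_eq_if_mult_eq_1)
  have 1: "\<sigma> (x, y) * \<sigma> (x \<otimes> y, inv y) = 1"
    using cocycle[of x y "inv y"] assms by simp
  have "x \<otimes> y \<otimes> inv y = x" using assms by (simp add: m_assoc)
  moreover have "inv y \<otimes> inv x = inv (x \<otimes> y)" using assms by (simp add: inv_mult m_comm)
  ultimately have "\<sigma> (x \<otimes> y, inv y) = \<sigma> (inv y, inv x)"
    using cocycle[of "x \<otimes> y" "inv y" "inv x"] assms by simp
  with 1 show "\<sigma> (x, y) * \<sigma> (inv y, inv x) = 1" by simp
qed (use assms in simp)

lemma W_apply: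
  "\<xi> \<in> ell2 X \<Longrightarrow> W G \<sigma> m \<xi> p = (if p \<in> X then \<sigma> (m, p \<otimes> inv m) * \<xi> (p \<otimes> inv m) else 0)"
  by (simp add: W_def on_ell2_def)

lemma bij_translate: "m \<in> X \<Longrightarrow> bij_betw (\<lambda>p. p \<otimes> m) X X"
  by (rule bij_betw_byWitness[where f' = "\<lambda>p. p \<otimes> inv m"]) (auto simp: m_assoc)

lemma W_ell2:
  assumes "m \<in> X" "\<xi> \<in> ell2 X"
  shows "W G \<sigma> m \<xi> \<in> ell2 X" "ell2_norm X (W G \<sigma> m \<xi>) = ell2_norm X \<xi>"
proof -
  have eq: "(norm (W G \<sigma> m \<xi> p))\<^sup>2 = (norm (\<xi> (p \<otimes> inv m)))\<^sup>2" if "p \<in> X" for p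
    using assms that by (simp add: W_apply norm_mult)
  note bij = bij_translate[of "inv m"]
  have "(\<lambda>p. (norm (\<xi> (p \<otimes> inv m)))\<^sup>2) summable_on X"
    using assms summable_on_reindex_bij_betw[OF bij, of "\<lambda>p. (norm (\<xi> p))\<^sup>2"] by (simp add: ell2_def)
  moreover have "(\<lambda>p. (norm (W G \<sigma> m \<xi> p))\<^sup>2) summable_on X \<longleftrightarrow> (\<lambda>p. (norm (\<xi> (p \<otimes> inv m)))\<^sup>2) summable_on X"
    by (rule summable_on_cong[OF eq])
  ultimately have "(\<lambda>p. (norm (W G \<sigma> m \<xi> p))\<^sup>2) summable_on X" by simp
  then show "W G \<sigma> m \<xi> \<in> ell2 X" using assms by (auto simp: ell2_def W_apply)
  have "(\<Sum>\<^sub>\<infinity>p\<in>X. (norm (W G \<sigma> m \<xi> p))\<^sup>2) = (\<Sum>\<^sub>\<infinity>p\<in>X. (norm (\<xi> (p \<otimes> inv m)))\<^sup>2)"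
    using eq by (rule infsum_cong)
  also have "\<dots> = (\<Sum>\<^sub>\<infinity>p\<in>X. (norm (\<xi> p))\<^sup>2)"
    using infsum_reindex_bij_betw[OF bij, of "\<lambda>p. (norm (\<xi> p))\<^sup>2"] assms by simp
  finally show "ell2_norm X (W G \<sigma> m \<xi>) = ell2_norm X \<xi>" by (simp add: ell2_norm_def)
qed

lemma W_bop: "m \<in> X \<Longrightarrow> W G \<sigma> m \<in> bop X"
proof (rule bopI[where C = 1])
  fix \<xi> :: "'g \<Rightarrow> complex"
  assume "m \<in> X" "\<xi> \<in> ell2 X"
  then show "W G \<sigma> m \<xi> \<in> ell2 X \<and> ell2_norm X (W G \<sigma> m \<xi>) \<le> 1 * ell2_norm X \<xi>"
    by (simp add: W_ell2)
qed (auto simp: W_def on_ell2_def ell2_add ell2_smult algebra_simps)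

lemma W_inverse:
  assumes "m \<in> X" "\<xi> \<in> ell2 X"
  shows "W G \<sigma> (inv m) (W G \<sigma> m \<xi>) = \<xi>"
proof
  fix p
  show "W G \<sigma> (inv m) (W G \<sigma> m \<xi>) p = \<xi> p"
  proof (cases "p \<in> X")
    case True
    then have "W G \<sigma> (inv m) (W G \<sigma> m \<xi>) p = \<sigma> (inv m, p \<otimes> m) * (\<sigma> (m, p) * \<xi> p)"
      using assms by (simp add: W_apply W_ell2 m_assoc)
    then show ?thesis
      using cocycle_inv_left[of m p] True assms by (simp add: mult.assoc[symmetric] mult.commute m_comm)
  qed (simp add: W_apply W_ell2 assms ell2_outside[OF assms(2)])
qed

lemma W_adjoint:
  assumes "m \<in> X" "\<xi> \<in> ell2 X" "\<eta> \<in> ell2 X"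
  shows "ell2_inner X (W G \<sigma> m \<xi>) \<eta> = ell2_inner X \<xi> (W G \<sigma> (inv m) \<eta>)"
proof -
  have "ell2_inner X (W G \<sigma> m \<xi>) \<eta> = (\<Sum>\<^sub>\<infinity>q\<in>X. W G \<sigma> m \<xi> (q \<otimes> m) * cnj (\<eta> (q \<otimes> m)))"
    unfolding ell2_inner_def
    by (rule infsum_reindex_bij_betw[OF bij_translate[OF assms(1)], symmetric])
  also have "\<dots> = ell2_inner X \<xi> (W G \<sigma> (inv m) \<eta>)"
    unfolding ell2_inner_def
  proof (rule infsum_cong)
    fix q assume q: "q \<in> X"
    have "cnj (\<sigma> (inv m, m \<otimes> q)) = \<sigma> (m, q)"
      using cocycle_inv_left[of m q] q assms(1) by (intro cnj_eq_if_mult_eq_1) (auto simp: mult.commute)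
    then show "W G \<sigma> m \<xi> (q \<otimes> m) * cnj (\<eta> (q \<otimes> m)) = \<xi> q * cnj (W G \<sigma> (inv m) \<eta> q)"
      using q assms by (simp add: W_apply m_assoc m_comm[of m q])
  qed
  finally show ?thesis .
qed

lemma W_unitary: "m \<in> X \<Longrightarrow> unitary_pair X (W G \<sigma> m) (W G \<sigma> (inv m))"
  using W_inverse[of m] W_inverse[of "inv m"]
  by (auto simp: unitary_pair_def adj_pair_def W_bop W_adjoint)

section \<open>The antiunitary J and right translations\<close>

lemma Jop_ell2:
  assumes "\<xi> \<in> ell2 X"
  shows "Jop G \<xi> \<in> ell2 X" "ell2_norm X (Jop G \<xi>) = ell2_norm X \<xi>"
proof -
  have bij: "bij_betw (\<lambda>p. inv p) X X"
    by (rule bij_betw_byWitness[where f' = "\<lambda>p. inv p"]) auto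
  have eq: "(norm (Jop G \<xi> p))\<^sup>2 = (norm (\<xi> (inv p)))\<^sup>2" if "p \<in> X" for p
    using that by (simp add: Jop_def)
  have "(\<lambda>p. (norm (\<xi> (inv p)))\<^sup>2) summable_on X"
    using assms summable_on_reindex_bij_betw[OF bij, of "\<lambda>p. (norm (\<xi> p))\<^sup>2"] by (simp add: ell2_def)
  moreover have "(\<lambda>p. (norm (Jop G \<xi> p))\<^sup>2) summable_on X \<longleftrightarrow> (\<lambda>p. (norm (\<xi> (inv p)))\<^sup>2) summable_on X"
    by (rule summable_on_cong[OF eq])
  ultimately have "(\<lambda>p. (norm (Jop G \<xi> p))\<^sup>2) summable_on X" by simp
  then show "Jop G \<xi> \<in> ell2 X" by (auto simp: ell2_def Jop_def)
  have "(\<Sum>\<^sub>\<infinity>p\<in>X. (norm (Jop G \<xi> p))\<^sup>2) = (\<Sum>\<^sub>\<infinity>p\<in>X. (norm (\<xi> (inv p)))\<^sup>2)"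
    using eq by (rule infsum_cong)
  also have "\<dots> = (\<Sum>\<^sub>\<infinity>p\<in>X. (norm (\<xi> p))\<^sup>2)"
    by (rule infsum_reindex_bij_betw[OF bij])
  finally show "ell2_norm X (Jop G \<xi>) = ell2_norm X \<xi>" by (simp add: ell2_norm_def)
qed

lemma Jop_Jop: "\<xi> \<in> ell2 X \<Longrightarrow> Jop G (Jop G \<xi>) = \<xi>"
  by (auto simp: Jop_def ell2_outside)

lemma ell2_inner_Jop: "ell2_inner X (Jop G \<xi>) \<eta> = ell2_inner X (Jop G \<eta>) \<xi>"
proof -
  have bij: "bij_betw (\<lambda>p. inv p) X X"
    by (rule bij_betw_byWitness[where f' = "\<lambda>p. inv p"]) auto
  have "ell2_inner X (Jop G \<xi>) \<eta> = (\<Sum>\<^sub>\<infinity>p\<in>X. Jop G \<xi> (inv p) * cnj (\<eta> (inv p)))"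
    unfolding ell2_inner_def by (rule infsum_reindex_bij_betw[OF bij, symmetric])
  also have "\<dots> = ell2_inner X (Jop G \<eta>) \<xi>"
    unfolding ell2_inner_def by (rule infsum_cong) (simp add: Jop_def mult.commute)
  finally show ?thesis .
qed

lemma conjJ_bop:
  assumes a: "a \<in> bop X"
  shows "conjJ G a \<in> bop X"
proof -
  obtain K where K: "0 \<le> K" "\<And>\<xi>. \<xi> \<in> ell2 X \<Longrightarrow> ell2_norm X (a \<xi>) \<le> K * ell2_norm X \<xi>"
    using bop_bounded[OF a] by blast
  show ?thesis
  proof (rule bopI[where C = K])
    fix \<xi> :: "'g \<Rightarrow> complex" assume \<xi>: "\<xi> \<in> ell2 X"
    show "conjJ G a \<xi> \<in> ell2 X \<and> ell2_norm X (conjJ G a \<xi>) \<le> K * ell2_norm X \<xi>"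
      using K(2)[OF Jop_ell2(1)[OF \<xi>]] Jop_ell2[OF \<xi>] Jop_ell2[OF bop_ell2[OF a Jop_ell2(1)[OF \<xi>]]] \<xi>
      by (simp add: conjJ_def on_ell2_def)
  qed (auto simp: conjJ_def on_ell2_def ell2_add ell2_smult Jop_add Jop_smult bop_smult[OF a]
      bop_add[OF a Jop_ell2(1) Jop_ell2(1)])
qed

lemma conjJ_adjoint:
  assumes "adj_pair X a b"
  shows "adj_pair X (conjJ G a) (conjJ G b)"
  unfolding adj_pair_def
proof (intro conjI ballI conjJ_bop adj_pairD[OF assms])
  fix \<xi> \<eta> :: "'g \<Rightarrow> complex" assume *: "\<xi> \<in> ell2 X" "\<eta> \<in> ell2 X"
  note J = Jop_ell2(1)[OF *(1)] Jop_ell2(1)[OF *(2)]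
  have "ell2_inner X (conjJ G a \<xi>) \<eta> = ell2_inner X (Jop G \<eta>) (a (Jop G \<xi>))"
    using * by (simp add: conjJ_def on_ell2_def ell2_inner_Jop)
  also have "\<dots> = ell2_inner X (b (Jop G \<eta>)) (Jop G \<xi>)"
    using adj_pairD(3)[OF adj_pair_sym[OF assms] J(2,1)] by simp
  also have "\<dots> = cnj (ell2_inner X (conjJ G b \<eta>) \<xi>)"
    using * ell2_inner_Jop[of "b (Jop G \<eta>)" \<xi>]
    by (simp add: conjJ_def on_ell2_def ell2_inner_commute[of X "b (Jop G \<eta>)"])
  finally show "ell2_inner X (conjJ G a \<xi>) \<eta> = ell2_inner X \<xi> (conjJ G b \<eta>)"
    by (simp add: ell2_inner_commute[of X \<xi>])
qed

lemma conjJ_unitary: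
  assumes "unitary_pair X V V'"
  shows "unitary_pair X (conjJ G V) (conjJ G V')"
  using unitary_pairD[OF assms] bop_ell2[of V X] bop_ell2[of V' X] conjJ_adjoint[of V V']
  by (auto simp: unitary_pair_def) (auto simp: conjJ_def on_ell2_def Jop_ell2 Jop_Jop)

text \<open>The cocycle identity is exactly what makes the
  twisting factors agree.\<close>

lemma W_commutes_conjJ:
  assumes s: "s \<in> X" and m: "m \<in> X"
  shows "commutes_on X (W G \<sigma> s) (conjJ G (W G \<sigma> m))"
  unfolding commutes_on_def
proof (intro ballI ext)
  fix \<xi> :: "'g \<Rightarrow> complex" and p assume \<xi>: "\<xi> \<in> ell2 X"
  \<comment> \<open>\<open>J W J\<close> is a twisted translation in the opposite direction, with
    the cocycle factor evaluated from the other side.\<close>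
  have conj_apply: "conjJ G (W G \<sigma> m) \<eta> p = (if p \<in> X then \<sigma> (p \<otimes> m, inv m) * \<eta> (p \<otimes> m) else 0)"
    if "\<eta> \<in> ell2 X" for \<eta> p
  proof (cases "p \<in> X")
    case p: True
    have "inv (inv p \<otimes> inv m) = p \<otimes> m" using m p by (simp add: inv_mult)
    moreover have "conjJ G (W G \<sigma> m) \<eta> p = cnj (W G \<sigma> m (Jop G \<eta>) (inv p))"
      using that p by (simp add: conjJ_def on_ell2_def Jop_def[of _ "W G \<sigma> m (Jop G \<eta>)"])
    moreover have "W G \<sigma> m (Jop G \<eta>) (inv p) = \<sigma> (m, inv p \<otimes> inv m) * Jop G \<eta> (inv p \<otimes> inv m)"
      using that p m by (simp add: W_apply Jop_ell2)
    ultimately show ?thesis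
      using p m cnj_cocycle[of m "inv p \<otimes> inv m"] by (simp add: Jop_def)
  qed (simp add: conjJ_def on_ell2_def Jop_def)
  show "W G \<sigma> s (conjJ G (W G \<sigma> m) \<xi>) p = conjJ G (W G \<sigma> m) (W G \<sigma> s \<xi>) p"
  proof (cases "p \<in> X")
    case p: True
    \<comment> \<open>Both orders of composition evaluate \<xi> at this point; their factors are the
      two sides of the cocycle identity for (s, t, -m).\<close>
    define t where "t = p \<otimes> m \<otimes> inv s"
    have t: "t \<in> X" "s \<otimes> t = p \<otimes> m" "t \<otimes> inv m = p \<otimes> inv s" "p \<otimes> inv s \<otimes> m = t"
    proof -
      have 1: "t = p \<otimes> inv s \<otimes> m" "t \<in> X" using s m p by (simp_all add: t_def m_ac)
      have "s \<otimes> t = (s \<otimes> inv s) \<otimes> (p \<otimes> m)" unfolding 1 using s m p inv_closed[OF s] by (simp only: m_ac m_closed)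
      then show "s \<otimes> t = p \<otimes> m" using s m p by simp
      show "t \<in> X" "t \<otimes> inv m = p \<otimes> inv s" "p \<otimes> inv s \<otimes> m = t"
        using 1 s m p by (simp_all add: m_assoc)
    qed
    have cb: "conjJ G (W G \<sigma> m) \<xi> \<in> ell2 X" using \<xi> m by (intro bop_ell2[OF conjJ_bop[OF W_bop]])
    have "W G \<sigma> s (conjJ G (W G \<sigma> m) \<xi>) p = \<sigma> (s, t \<otimes> inv m) * \<sigma> (t, inv m) * \<xi> t"
      using p s m t \<xi> cb by (simp add: W_apply conj_apply)
    also have "\<dots> = \<sigma> (s, t) * \<sigma> (p \<otimes> m, inv m) * \<xi> t"
      using cocycle[of s t "inv m"] s m t by simp
    also have "\<dots> = conjJ G (W G \<sigma> m) (W G \<sigma> s \<xi>) p"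
      using p s m t \<xi> by (simp add: W_apply conj_apply W_ell2 t_def[symmetric])
    finally show ?thesis .
  next
    case False
    have cb: "conjJ G (W G \<sigma> m) \<xi> \<in> ell2 X" using \<xi> m by (intro bop_ell2[OF conjJ_bop[OF W_bop]])
    with False s \<xi> show ?thesis by (simp add: W_apply conj_apply W_ell2)
  qed
qed

end

section \<open>Clifford generators\<close>

text \<open>Only the term \<open>A = {i}\<close> survives, and then the other factor forces the
  symmetric difference to be \<open>{j}\<close>. The sign is -1 for a transposition (j < i) as well
  as for a square (j = i).\<close>

lemma cliff_mult_gen:
  assumes "i \<in> {1..N}"
  shows "cliff_mult N (cliff_gen i) (cliff_gen j) =
    (\<lambda>C. if C = sym_diff {i} {j} then (if j \<le> i then - 1 else 1) else 0)"
proof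
  fix C
  let ?g = "\<lambda>A. (- 1) ^ card {(a, b) \<in> A \<times> sym_diff A C. b \<le> a} * cliff_gen j (sym_diff A C) :: complex"
  have "cliff_mult N (cliff_gen i) (cliff_gen j) C = (\<Sum>A\<in>Pow {1..N}. if A = {i} then ?g A else 0)"
    unfolding cliff_mult_def by (intro sum.cong) (auto simp: cliff_gen_def cliff_basis_def)
  also have "\<dots> = ?g {i}" using assms by (subst sum.delta) auto
  also have "\<dots> = (if C = sym_diff {i} {j} then (if j \<le> i then - 1 else 1) else 0)"
  proof (cases "C = sym_diff {i} {j}")
    case True
    then have sd: "sym_diff {i} C = {j}" by auto
    have "{(a, b) \<in> {i} \<times> {j}. b \<le> a} = (if j \<le> i then {(i, j)} else {})" by auto
    then show ?thesis unfolding sd using True by (auto simp: cliff_gen_def cliff_basis_def)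
  next
    case False
    then have "sym_diff {i} C \<noteq> {j}" by auto
    then show ?thesis using False by (simp add: cliff_gen_def cliff_basis_def)
  qed
  finally show "cliff_mult N (cliff_gen i) (cliff_gen j) C =
    (if C = sym_diff {i} {j} then (if j \<le> i then - 1 else 1) else 0)" .
qed

lemma uminus_matrix_vector_mult: "(- A :: 'a::ring_1 ^ 'n ^ 'm) *v v = - (A *v v)"
  by (simp add: matrix_vector_mult_def vec_eq_iff sum_negf)

lemma matrix_vector_mult_sum:
  "(A :: 'a::comm_ring_1 ^ 'n ^ 'm) *v (\<Sum>j\<in>I. g j) = (\<Sum>j\<in>I. A *v g j)"
  by (induction I rule: infinite_finite_induct) (simp_all add: matrix_vector_right_distrib)

lemma norm_vector_scalar_mult: "norm (w *s (v :: complex^'n)) = norm w * norm v"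
  by (simp add: norm_vec_def norm_mult L2_set_right_distrib)

locale clifford_rep =
  fixes N :: nat and c :: "(nat set \<Rightarrow> complex) \<Rightarrow> complex^'s^'s"
  assumes rep: "faithful_cliff_rep N c"
begin

lemma gen_cliff: "i \<in> {1..N} \<Longrightarrow> cliff_gen i \<in> cliff N"
  by (auto simp: cliff_def cliff_gen_def cliff_basis_def)

lemma mult_cliff: "cliff_mult N (cliff_gen i) (cliff_gen j) \<in> cliff N" if "i \<in> {1..N}" "j \<in> {1..N}"
  using that by (auto simp: cliff_def cliff_mult_gen)

lemma rep_mult: "x \<in> cliff N \<Longrightarrow> y \<in> cliff N \<Longrightarrow> c (cliff_mult N x y) = c x ** c y"
  using rep unfolding faithful_cliff_rep_def by blast

lemma rep_uminus:
  assumes "x \<in> cliff N"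
  shows "c (\<lambda>A. - x A) = - c x"
proof -
  have "\<forall>w. \<forall>x\<in>cliff N. c (\<lambda>A. w * x A) = map_matrix (\<lambda>u. w * u) (c x)"
    using rep unfolding faithful_cliff_rep_def by blast
  from this[rule_format, OF assms, of "-1"] show ?thesis
    by (simp add: map_matrix_def vec_eq_iff)
qed

lemma gen_square:
  assumes "i \<in> {1..N}"
  shows "c (cliff_gen i) *v (c (cliff_gen i) *v v) = - v"
proof -
  have "cliff_mult N (cliff_gen i) (cliff_gen i) = (\<lambda>A. - cliff_basis {} A)"
    using assms by (auto simp: cliff_mult_gen cliff_basis_def)
  moreover have "cliff_basis {} \<in> cliff N" by (auto simp: cliff_def cliff_basis_def)
  moreover have "c (cliff_basis {}) = mat 1" using rep unfolding faithful_cliff_rep_def by blast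
  ultimately have "c (cliff_gen i) ** c (cliff_gen i) = - mat 1"
    using rep_mult[OF gen_cliff[OF assms] gen_cliff[OF assms]] rep_uminus by simp
  then show ?thesis
    by (simp add: matrix_vector_mul_assoc uminus_matrix_vector_mult)
qed

lemma gen_anticommute:
  assumes "i \<in> {1..N}" "j \<in> {1..N}" "i \<noteq> j"
  shows "c (cliff_gen i) *v (c (cliff_gen j) *v v) = - (c (cliff_gen j) *v (c (cliff_gen i) *v v))"
proof -
  have "cliff_mult N (cliff_gen i) (cliff_gen j) = (\<lambda>A. - cliff_mult N (cliff_gen j) (cliff_gen i) A)"
    using assms by (auto simp: cliff_mult_gen fun_eq_iff)
  then have "c (cliff_gen i) ** c (cliff_gen j) = - (c (cliff_gen j) ** c (cliff_gen i))"
    using rep_mult[OF gen_cliff gen_cliff] rep_uminus[OF mult_cliff] assms by metis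
  then show ?thesis
    by (simp add: matrix_vector_mul_assoc uminus_matrix_vector_mult)
qed

text \<open>Generators are anti-self-adjoint with square -1, so the adjoint of the matrix times the
  matrix is the identity.\<close>

lemma gen_isometry:
  assumes "i \<in> {1..N}"
  shows "norm (c (cliff_gen i) *v v) = norm v"
proof -
  let ?C = "c (cliff_gen i)" and ?w = "c (cliff_gen i) *v v"
  have nrm: "of_real ((norm (u :: complex^'s))\<^sup>2) = (\<Sum>s\<in>UNIV. u $ s * cnj (u $ s))" for u
    by (simp add: norm_vec_def L2_set_def sum_nonneg complex_norm_square del: of_real_power)
  \<comment> \<open>For a singleton the exponent in \<open>cliff_star\<close> is 1 * 2 div 2 =
    1.\<close>
  have "cliff_star (cliff_gen i) = (\<lambda>A. - cliff_gen i A)"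
    by (auto simp: cliff_star_def cliff_gen_def cliff_basis_def)
  moreover have "c (cliff_star (cliff_gen i)) = map_matrix cnj (transpose ?C)"
    using rep gen_cliff[OF assms] unfolding faithful_cliff_rep_def by blast
  ultimately have "map_matrix cnj (transpose ?C) = - ?C"
    using rep_uminus[OF gen_cliff[OF assms]] by simp
  then have star: "cnj (?C $ s $ t) = - ?C $ t $ s" for s t
    by (auto simp: vec_eq_iff transpose_def)
  have "of_real ((norm ?w)\<^sup>2) = (\<Sum>s\<in>UNIV. \<Sum>t\<in>UNIV. ?C $ s $ t * v $ t * cnj (?w $ s))"
    unfolding nrm by (simp add: matrix_vector_mult_def[of ?C v] sum_distrib_right)
  also have "\<dots> = (\<Sum>t\<in>UNIV. \<Sum>s\<in>UNIV. ?C $ s $ t * v $ t * cnj (?w $ s))"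
    by (rule sum.swap)
  also have "\<dots> = (\<Sum>t\<in>UNIV. v $ t * cnj ((- (?C *v ?w)) $ t))"
  proof (rule sum.cong[OF refl])
    fix t
    have "cnj ((- (?C *v ?w)) $ t) = (\<Sum>s\<in>UNIV. ?C $ s $ t * cnj (?w $ s))"
      by (simp add: matrix_vector_mult_def[of ?C ?w] star sum_negf)
    then show "(\<Sum>s\<in>UNIV. ?C $ s $ t * v $ t * cnj (?w $ s)) = v $ t * cnj ((- (?C *v ?w)) $ t)"
      by (simp add: sum_distrib_left mult_ac)
  qed
  also have "\<dots> = of_real ((norm v)\<^sup>2)"
    unfolding nrm using gen_square[OF assms, of v] by simp
  finally have "(norm ?w)\<^sup>2 = (norm v)\<^sup>2" by (simp only: of_real_eq_iff)
  then show ?thesis by simp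
qed

text \<open>The anticommutator with \<open>1 \<otimes> \<gamma>\<^sub>i\<close> isolates the \<open>i\<close>-th term, up to the factor \<open>-2\<close>.\<close>

lemma ell2_norm_component:
  assumes T: "\<And>j. j \<in> {1..N} \<Longrightarrow> T j \<in> ell2 Y"
    and bound: "\<And>v :: complex^'s.
      ell2_norm Y (\<lambda>m. \<Sum>j\<in>{1..N}. T j m *s (c (cliff_gen j) *v v)) \<le> B * norm v"
    and i: "i \<in> {1..N}"
  shows "ell2_norm Y (T i) \<le> B"
proof -
  define \<Phi> where "\<Phi> v = (\<lambda>m. \<Sum>j\<in>{1..N}. T j m *s (c (cliff_gen j) *v v))" for v
  define e where "e i v = c (cliff_gen i) *v v" for i and v :: "complex^'s"
  obtain v :: "complex^'s" where v: "v \<noteq> 0" using zero_neq_one by metis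
  have \<Phi>: "\<Phi> u \<in> ell2 Y" for u
    unfolding \<Phi>_def
    by (rule ell2_sum) (auto intro!: ell2_scaled(1)[OF _ norm_ge_zero T] simp: norm_vector_scalar_mult)
  have anti: "(- 2 * T i m) *s v = e i (\<Phi> v m) + \<Phi> (e i v) m" for m
  proof -
    have "e i (\<Phi> v m) = (\<Sum>j\<in>{1..N}. T j m *s e i (e j v))"
      by (simp add: \<Phi>_def e_def matrix_vector_mult_sum vector_scalar_commute)
    moreover have "\<Phi> (e i v) m = (\<Sum>j\<in>{1..N}. T j m *s e j (e i v))"
      by (simp add: \<Phi>_def e_def)
    \<comment> \<open>Terms with j different from i cancel by anticommutation; the remaining one is
      doubled and picks up the square -1.\<close>
    moreover have "T j m *s e i (e j v) + T j m *s e j (e i v) =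
        (if j = i then (- 2 * T i m) *s v else 0)" if "j \<in> {1..N}" for j
      using that i gen_square[of i v] gen_anticommute[of i j v]
      by (auto simp: e_def vec_eq_iff)
    ultimately show ?thesis using i by (simp add: sum.distrib[symmetric])
  qed
  have "2 * norm v * ell2_norm Y (T i) = ell2_norm Y (\<lambda>m. (- 2 * T i m) *s v)"
    by (rule ell2_scaled(2)[OF _ _ T[OF i], symmetric]) (auto simp: norm_vector_scalar_mult norm_mult)
  also have "\<dots> = ell2_norm Y (\<lambda>m. e i (\<Phi> v m) + \<Phi> (e i v) m)" by (simp only: anti)
  also have "\<dots> \<le> ell2_norm Y (\<lambda>m. e i (\<Phi> v m)) + ell2_norm Y (\<Phi> (e i v))"
    using ell2_scaled(1)[of "\<lambda>m. e i (\<Phi> v m)" 1 "\<Phi> v"] \<Phi> i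
    by (intro ell2_add) (auto simp: e_def gen_isometry)
  also have "ell2_norm Y (\<lambda>m. e i (\<Phi> v m)) = ell2_norm Y (\<Phi> v)"
    using ell2_scaled(2)[of "\<lambda>m. e i (\<Phi> v m)" 1 "\<Phi> v"] \<Phi> i by (simp add: e_def gen_isometry)
  \<comment> \<open>The hypothesis is applied to \<open>v\<close> and to its image under the i-th
    generator, of the same norm. The resulting 2 cancels against the one on the left, so the
    constant stays \<open>B\<close>.\<close>
  also have "\<dots> + ell2_norm Y (\<Phi> (e i v)) \<le> B * norm v + B * norm (e i v)"
    unfolding \<Phi>_def by (intro add_mono bound)
  also have "\<dots> = 2 * norm v * B" using i by (simp add: e_def gen_isometry)
  finally show ?thesis using v by simp
qed

end

section \<open>Almost invariance under diagonal unitaries\<close>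

text \<open>Distance at most \<open>C\<close> between \<open>a\<close> and its conjugate by the
  diagonal unitary, stated on vectors so that the supremum defining \<open>opnorm\<close> appears
  only at the very end.\<close>

definition almost_invariant :: "'g set \<Rightarrow> 'g oper \<Rightarrow> ('g \<Rightarrow> complex) \<Rightarrow> real \<Rightarrow> bool" where
  "almost_invariant X a u C \<longleftrightarrow> (\<forall>\<eta>\<in>ell2 X.
     ell2_norm X (\<lambda>m. a \<eta> m - diag X u (a (diag X (\<lambda>m. cnj (u m)) \<eta>)) m) \<le> C * ell2_norm X \<eta>)"

lemma diag_cong: "(\<And>m. m \<in> X \<Longrightarrow> u m = w m) \<Longrightarrow> diag X u = diag X w"
  by (intro ext) (auto simp: diag_def on_ell2_def, metis ell2_outside mult_zero_right)

lemma diag_mult: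
  assumes "\<And>m. m \<in> X \<Longrightarrow> norm (w m) = 1" "\<xi> \<in> ell2 X"
  shows "diag X u (diag X w \<xi>) = diag X (\<lambda>m. u m * w m) \<xi>"
  using bop_ell2[OF unitary_pairD(2)[OF diag_unitary[of X w]], OF assms(1) assms(2)] assms(2)
  by (simp add: diag_def on_ell2_def mult.assoc)

lemma diag_one: "\<xi> \<in> ell2 X \<Longrightarrow> diag X (\<lambda>_. 1) \<xi> = \<xi>"
  by (simp add: diag_def on_ell2_def)

lemma almost_invariant_cong:
  "(\<And>m. m \<in> X \<Longrightarrow> u m = w m) \<Longrightarrow> almost_invariant X a u C \<longleftrightarrow> almost_invariant X a w C"
  using diag_cong[of X u w] diag_cong[of X "\<lambda>m. cnj (u m)" "\<lambda>m. cnj (w m)"]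
  by (simp add: almost_invariant_def)

lemma almost_invariant_one: "almost_invariant X a (\<lambda>_. 1) 0" if "a \<in> bop X"
  using that by (auto simp: almost_invariant_def diag_one bop_ell2)

text \<open>With u' and w' the inverse unitaries, a - uw a w'u' = (a - u a u') + u (a - w a w') u',
  and conjugation by u preserves norms.\<close>

lemma almost_invariant_mult:
  assumes a: "a \<in> bop X"
    and u: "\<And>m. m \<in> X \<Longrightarrow> norm (u m) = 1" and w: "\<And>m. m \<in> X \<Longrightarrow> norm (w m) = 1"
    and "almost_invariant X a u C" "almost_invariant X a w C'"
  shows "almost_invariant X a (\<lambda>m. u m * w m) (C + C')"
  unfolding almost_invariant_def
proof
  fix \<eta> :: "'a \<Rightarrow> complex" assume \<eta>: "\<eta> \<in> ell2 X"
  let ?u = "diag X u" and ?u' = "diag X (\<lambda>m. cnj (u m))"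
  let ?w = "diag X w" and ?w' = "diag X (\<lambda>m. cnj (w m))"
  have Du: "unitary_pair X ?u ?u'" by (rule diag_unitary) (rule u)
  have Dw: "unitary_pair X ?w ?w'" by (rule diag_unitary) (rule w)
  note D = unitary_pairD(2,3)[OF Du] unitary_pairD(2,3)[OF Dw]
  define \<zeta> where "\<zeta> = ?u' \<eta>"
  have \<zeta>: "\<zeta> \<in> ell2 X" unfolding \<zeta>_def by (rule bop_ell2[OF D(2) \<eta>])
  have n\<zeta>: "ell2_norm X \<zeta> = ell2_norm X \<eta>"
    unfolding \<zeta>_def by (rule unitary_norm[OF unitary_pair_sym[OF Du] \<eta>])
  have w\<zeta>: "?w' \<zeta> \<in> ell2 X" by (rule bop_ell2[OF D(4) \<zeta>])
  have mem: "a \<zeta> \<in> ell2 X" "?w (a (?w' \<zeta>)) \<in> ell2 X" "a (?w' \<zeta>) \<in> ell2 X"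
    using a D \<zeta> w\<zeta> by (simp_all add: bop_ell2)
  have "diag X (\<lambda>m. cnj (u m * w m)) \<eta> = ?w' \<zeta>"
    unfolding \<zeta>_def using u \<eta> by (subst diag_mult) (auto simp: mult.commute)
  moreover have "diag X (\<lambda>m. u m * w m) (a (?w' \<zeta>)) = ?u (?w (a (?w' \<zeta>)))"
    using w mem(3) by (simp add: diag_mult)
  moreover have "?u (\<lambda>m. a \<zeta> m - ?w (a (?w' \<zeta>)) m) = (\<lambda>m. ?u (a \<zeta>) m - ?u (?w (a (?w' \<zeta>))) m)"
    by (rule bop_diff[OF D(1) mem(1,2)])
  ultimately have eq: "(\<lambda>m. a \<eta> m - diag X (\<lambda>m. u m * w m) (a (diag X (\<lambda>m. cnj (u m * w m)) \<eta>)) m) =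
      (\<lambda>m. (a \<eta> m - ?u (a (?u' \<eta>)) m) + ?u (\<lambda>m. a \<zeta> m - ?w (a (?w' \<zeta>)) m) m)"
    by (simp add: \<zeta>_def[symmetric])
  have mem': "(\<lambda>m. a \<eta> m - ?u (a (?u' \<eta>)) m) \<in> ell2 X" "(\<lambda>m. a \<zeta> m - ?w (a (?w' \<zeta>)) m) \<in> ell2 X"
    using a \<eta> mem \<zeta> D by (auto intro!: ell2_diff simp: bop_ell2 \<zeta>_def[symmetric])
  have "ell2_norm X (\<lambda>m. a \<eta> m - diag X (\<lambda>m. u m * w m) (a (diag X (\<lambda>m. cnj (u m * w m)) \<eta>)) m)
      \<le> ell2_norm X (\<lambda>m. a \<eta> m - ?u (a (?u' \<eta>)) m) + ell2_norm X (\<lambda>m. a \<zeta> m - ?w (a (?w' \<zeta>)) m)"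
    unfolding eq using ell2_add(2)[OF mem'(1) bop_ell2[OF D(1) mem'(2)]] unitary_norm[OF Du mem'(2)]
    by simp
  also have "\<dots> \<le> C * ell2_norm X \<eta> + C' * ell2_norm X \<zeta>"
    using assms(4,5) \<eta> \<zeta> unfolding almost_invariant_def by (intro add_mono) auto
  finally show "ell2_norm X (\<lambda>m. a \<eta> m - diag X (\<lambda>m. u m * w m) (a (diag X (\<lambda>m. cnj (u m * w m)) \<eta>)) m)
      \<le> (C + C') * ell2_norm X \<eta>"
    by (simp add: n\<zeta> algebra_simps)
qed

text \<open>With u' the inverse unitary, a - u' a u = u' (u a u' - a) u, so the inverse moves
  \<open>a\<close> by the same amount.\<close>

lemma almost_invariant_cnj:
  assumes a: "a \<in> bop X" and u: "\<And>m. m \<in> X \<Longrightarrow> norm (u m) = 1" and "almost_invariant X a u C"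
  shows "almost_invariant X a (\<lambda>m. cnj (u m)) C"
  unfolding almost_invariant_def
proof
  fix \<eta> :: "'a \<Rightarrow> complex" assume \<eta>: "\<eta> \<in> ell2 X"
  let ?u = "diag X u" and ?u' = "diag X (\<lambda>m. cnj (u m))"
  have Du: "unitary_pair X ?u ?u'" by (rule diag_unitary) (rule u)
  note D = unitary_pairD[OF Du]
  define \<zeta> where "\<zeta> = ?u \<eta>"
  have \<zeta>: "\<zeta> \<in> ell2 X" unfolding \<zeta>_def by (rule bop_ell2[OF D(2) \<eta>])
  have n\<zeta>: "ell2_norm X \<zeta> = ell2_norm X \<eta>"
    unfolding \<zeta>_def by (rule unitary_norm[OF Du \<eta>])
  have mem: "a \<zeta> \<in> ell2 X" "?u (a \<eta>) \<in> ell2 X" "a \<eta> \<in> ell2 X"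
    using a D(2) \<zeta> \<eta> by (simp_all add: bop_ell2)
  have "?u' (\<lambda>m. ?u (a \<eta>) m - a \<zeta> m) = (\<lambda>m. a \<eta> m - ?u' (a \<zeta>) m)"
    using bop_diff[OF D(3) mem(2,1)] D(5)[OF mem(3)] by simp
  then have "ell2_norm X (\<lambda>m. a \<eta> m - ?u' (a \<zeta>) m) = ell2_norm X (\<lambda>m. ?u (a \<eta>) m - a \<zeta> m)"
    using unitary_norm[OF unitary_pair_sym[OF Du] ell2_diff(1)[OF mem(2,1)]] by simp
  also have "\<dots> = ell2_norm X (\<lambda>m. a \<zeta> m - ?u (a (?u' \<zeta>)) m)"
    unfolding \<zeta>_def D(5)[OF \<eta>] by (rule ell2_norm_minus_commute)
  also have "\<dots> \<le> C * ell2_norm X \<eta>"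
    using assms(3) \<zeta> n\<zeta> unfolding almost_invariant_def by metis
  finally show "ell2_norm X (\<lambda>m. a \<eta> m - ?u' (a (diag X (\<lambda>m. cnj (cnj (u m))) \<eta>)) m) \<le> C * ell2_norm X \<eta>"
    by (simp add: \<zeta>_def)
qed

lemma almost_invariant_power:
  assumes a: "a \<in> bop X" and u: "\<And>m. m \<in> X \<Longrightarrow> norm (u m) = 1" and "almost_invariant X a u C"
  shows "almost_invariant X a (\<lambda>m. u m ^ n) (of_nat n * C)"
proof (induction n)
  case (Suc n)
  have "almost_invariant X a (\<lambda>m. u m * u m ^ n) (C + of_nat n * C)"
    by (rule almost_invariant_mult[OF a u _ assms(3) Suc]) (simp_all add: norm_power u)
  then show ?case by (simp add: algebra_simps)
qed (simp add: almost_invariant_one[OF a])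

lemma almost_invariant_power_int:
  assumes a: "a \<in> bop X" and u: "\<And>m. m \<in> X \<Longrightarrow> norm (u m) = 1" and inv: "almost_invariant X a u C"
  shows "almost_invariant X a (\<lambda>m. u m powi l) (of_int \<bar>l\<bar> * C)"
proof (cases "0 \<le> l")
  case True
  then show ?thesis
    using almost_invariant_power[OF a u inv, of "nat l"] by (simp add: power_int_def)
next
  case False
  have "almost_invariant X a (\<lambda>m. cnj (u m) ^ nat (- l)) (of_nat (nat (- l)) * C)"
    by (rule almost_invariant_power[OF a _ almost_invariant_cnj[OF a u inv]]) (simp add: u)
  then have "almost_invariant X a (\<lambda>m. u m powi l) (of_nat (nat (- l)) * C)"
  proof (rule almost_invariant_cong[THEN iffD1, rotated])
    fix m assume "m \<in> X"
    then have "cnj (u m) = inverse (u m)" using u[of m] complex_div_cnj[of 1 "u m"] by (simp add: inverse_eq_divide)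
    then show "cnj (u m) ^ nat (- l) = u m powi l" using False by (simp add: power_int_def)
  qed
  then show ?thesis using False by simp
qed

text \<open>The mean value theorem for \<open>t \<mapsto> \<langle>e\<^bsup>ith\<^esup> a e\<^bsup>-ith\<^esup> \<xi>, \<eta>\<rangle>\<close>, a finite exponential sum when \<open>\<xi>\<close> and \<open>\<eta>\<close>
  have finite support.\<close>

lemma almost_invariant_phase:
  fixes h :: "'g \<Rightarrow> real"
  assumes a: "a \<in> bop X" and "0 \<le> C"
    and comm: "\<And>\<xi>. \<xi> \<in> fin_supp X \<Longrightarrow>
      (\<lambda>m. \<i> * of_real (h m) * a \<xi> m - a (\<lambda>p. \<i> * of_real (h p) * \<xi> p) m) \<in> ell2 X \<and>
      ell2_norm X (\<lambda>m. \<i> * of_real (h m) * a \<xi> m - a (\<lambda>p. \<i> * of_real (h p) * \<xi> p) m) \<le> C * ell2_norm X \<xi>"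
  shows "almost_invariant X a (\<lambda>m. exp (\<i> * of_real (t * h m))) (C * \<bar>t\<bar>)"
proof -
  define e where "e t m = exp (\<i> * of_real (t * h m))" for t m
  define D where "D t = diag X (e t)" for t
  define D' where "D' t = diag X (\<lambda>m. cnj (e t m))" for t
  have e: "norm (e t m) = 1" for t m by (simp add: e_def)
  have e': "cnj (e t m) = exp (- (\<i> * of_real (t * h m)))" for t m by (simp add: e_def exp_cnj)
  have DD: "unitary_pair X (D t) (D' t)" for t
    unfolding D_def D'_def by (rule diag_unitary) (rule e)
  \<comment> \<open>This operator is bounded before any estimate is known, which permits the
    extension by density at the end.\<close>
  define T where "T = lincomb 1 a (- 1) (D t \<circ> (a \<circ> D' t))"
  have T: "T \<in> bop X"
    unfolding T_def using unitary_pairD(2,3)[OF DD] a by (intro bop_lincomb bop_comp)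
  have small: "ell2_norm X (T \<xi>) \<le> C * \<bar>t\<bar> * ell2_norm X \<xi>" if \<xi>: "\<xi> \<in> fin_supp X" for \<xi>
  proof (rule ell2_norm_le_dual)
    have \<xi>2: "\<xi> \<in> ell2 X" using \<xi> by (rule fin_supp_ell2)
    show "T \<xi> p = 0" if "p \<notin> X" for p
      using ell2_outside[OF bop_ell2[OF T \<xi>2] that] .
    show "0 \<le> C * \<bar>t\<bar> * ell2_norm X \<xi>" using \<open>0 \<le> C\<close> by simp
    fix \<eta> :: "'g \<Rightarrow> complex" assume \<eta>: "\<eta> \<in> fin_supp X"
    have \<eta>2: "\<eta> \<in> ell2 X" using \<eta> by (rule fin_supp_ell2)
    define F where "F = {p. \<eta> p \<noteq> 0}"
    define H where "H = {q. \<xi> q \<noteq> 0}"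
    have FH: "finite F" "finite H" "F \<subseteq> X" "H \<subseteq> X" using \<xi> \<eta> by (auto simp: F_def H_def fin_supp_def)
    define K where "K p q = \<xi> q * a (delta q) p * cnj (\<eta> p)" for p q
    \<comment> \<open>The variable is complex because the mean value inequality used below is stated
      for functions on a field; it is applied along the real line, where the phases are
      unimodular.\<close>
    define \<phi> where "\<phi> s = (\<Sum>p\<in>F. \<Sum>q\<in>H. exp (\<i> * s * of_real (h p - h q)) * K p q)" for s :: complex
    define \<phi>' where "\<phi>' s = (\<Sum>p\<in>F. \<Sum>q\<in>H. (\<i> * of_real (h p - h q)) * exp (\<i> * s * of_real (h p - h q)) * K p q)"
      for s :: complex
    have D'\<xi>: "D' s \<xi> = (\<lambda>q. exp (- (\<i> * of_real (s * h q))) * \<xi> q)" for s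
      using \<xi>2 by (simp add: D'_def diag_def on_ell2_def e')
    have D'fs: "D' s \<xi> \<in> fin_supp X" for s
      unfolding D'\<xi> by (rule fin_supp_subset[OF \<xi>]) simp
    have D'supp: "{q. D' s \<xi> q \<noteq> 0} = H" for s by (auto simp: D'\<xi> H_def)
    have aD': "a (D' s \<xi>) p = (\<Sum>q\<in>H. exp (- (\<i> * of_real (s * h q))) * \<xi> q * a (delta q) p)" for s p
      unfolding bop_fin_supp[OF a D'fs] D'supp by (simp add: D'\<xi>)
    have inner: "ell2_inner X (D s \<zeta>) \<eta> = (\<Sum>p\<in>F. e s p * \<zeta> p * cnj (\<eta> p))" if "\<zeta> \<in> ell2 X" for s \<zeta>
      using that by (simp add: ell2_inner_fin_supp[OF \<eta>] F_def D_def diag_def on_ell2_def)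
    have expo: "exp (\<i> * (of_real s * (of_real (h p) - of_real (h q)))) =
        exp (\<i> * (of_real s * of_real (h p))) * exp (- (\<i> * (of_real s * of_real (h q))))" for s p q
      by (simp add: exp_add[symmetric] algebra_simps)
    have val: "\<phi> (of_real s) = ell2_inner X (D s (a (D' s \<xi>))) \<eta>" for s
      unfolding inner[OF bop_ell2[OF a fin_supp_ell2[OF D'fs]]] \<phi>_def
      by (intro sum.cong refl)
        (simp add: aD' sum_distrib_left sum_distrib_right K_def e_def expo mult_ac)
    \<comment> \<open>The commutator of \<open>a\<close> with multiplication by \<open>i h\<close>;
      differentiating \<phi> puts it in the place of \<open>a\<close>.\<close>
    define b where "b \<zeta> m = \<i> * of_real (h m) * a \<zeta> m - a (\<lambda>p. \<i> * of_real (h p) * \<zeta> p) m" for \<zeta> m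
    have aD'h: "a (\<lambda>p. \<i> * of_real (h p) * D' s \<xi> p) m =
        (\<Sum>q\<in>H. \<i> * of_real (h q) * exp (- (\<i> * of_real (s * h q))) * \<xi> q * a (delta q) m)" for s m
    proof -
      have fs: "(\<lambda>p. \<i> * of_real (h p) * D' s \<xi> p) \<in> fin_supp X"
        by (rule fin_supp_subset[OF D'fs[of s]]) simp
      show ?thesis
        unfolding bop_fin_supp[OF a fs] using FH
        by (intro sum.mono_neutral_cong_left) (auto simp: D'\<xi> H_def)
    qed
    have bD': "b (D' s \<xi>) p = (\<Sum>q\<in>H. \<i> * of_real (h p - h q) *
        exp (- (\<i> * of_real (s * h q))) * \<xi> q * a (delta q) p)" for s p
      unfolding b_def aD'h aD' by (simp add: sum_distrib_left sum_subtractf[symmetric] algebra_simps)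
    \<comment> \<open>The premise applies at every time s with the same bound, as the phases change
      neither the support nor the norm of \<xi>.\<close>
    have bmem: "b (D' s \<xi>) \<in> ell2 X \<and> ell2_norm X (b (D' s \<xi>)) \<le> C * ell2_norm X \<xi>" for s
      using comm[OF D'fs[of s]] unitary_norm[OF unitary_pair_sym[OF DD] \<xi>2] by (simp add: b_def[abs_def])
    have val': "\<phi>' (of_real s) = ell2_inner X (D s (b (D' s \<xi>))) \<eta>" for s
      unfolding inner[OF conjunct1[OF bmem]] \<phi>'_def
      by (intro sum.cong refl)
        (simp add: bD' sum_distrib_left sum_distrib_right K_def e_def expo mult_ac)
    have bound: "norm (\<phi>' s) \<le> C * ell2_norm X \<xi> * ell2_norm X \<eta>" if s: "s \<in> \<real>" for s
    proof -
      obtain r where r: "s = of_real r" using s by (rule Reals_cases)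
      have "norm (\<phi>' s) \<le> ell2_norm X (D r (b (D' r \<xi>))) * ell2_norm X \<eta>"
        unfolding r val' using bmem \<eta>2 unitary_pairD(2)[OF DD]
        by (intro ell2_Cauchy_Schwarz) (auto simp: bop_ell2)
      also have "\<dots> \<le> C * ell2_norm X \<xi> * ell2_norm X \<eta>"
        using bmem[of r] unitary_norm[OF DD conjunct1[OF bmem]] by (intro mult_right_mono) auto
      finally show ?thesis .
    qed
    have deriv: "(\<phi> has_field_derivative \<phi>' s) (at s within \<real>)" for s
      unfolding \<phi>_def \<phi>'_def
      by (intro DERIV_sum) (auto intro!: derivative_eq_intros)
    have "norm (\<phi> 0 - \<phi> (of_real t)) \<le> C * ell2_norm X \<xi> * ell2_norm X \<eta> * norm (0 - complex_of_real t)"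
      by (rule field_differentiable_bound[OF convex_Reals deriv bound]) auto
    moreover have "\<phi> 0 - \<phi> (of_real t) = ell2_inner X (T \<xi>) \<eta>"
    proof -
      have "D 0 \<zeta> = \<zeta>" "D' 0 \<zeta> = \<zeta>" if "\<zeta> \<in> ell2 X" for \<zeta>
        using that by (simp_all add: D_def D'_def e_def[abs_def] diag_one)
      then have "\<phi> 0 = ell2_inner X (a \<xi>) \<eta>"
        using val[of 0] \<xi>2 a by (simp add: bop_ell2)
      then show ?thesis
        unfolding val T_def lincomb_def
        by (simp add: ell2_inner_fin_supp[OF \<eta>] sum_subtractf[symmetric] algebra_simps)
    qed
    ultimately show "norm (ell2_inner X (T \<xi>) \<eta>) \<le> C * \<bar>t\<bar> * ell2_norm X \<xi> * ell2_norm X \<eta>"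
      by (simp add: mult_ac)
  qed
  have "ell2_norm X (T \<eta>) \<le> C * \<bar>t\<bar> * ell2_norm X \<eta>" if "\<eta> \<in> ell2 X" for \<eta>
    using \<open>0 \<le> C\<close> by (intro bop_le_by_fin_supp[OF T _ small that]) auto
  then show ?thesis
    unfolding almost_invariant_def T_def lincomb_def D_def D'_def e_def[abs_def] by simp
qed

section \<open>Characters and lengths\<close>

definition single :: "nat \<Rightarrow> nat \<Rightarrow> complex \<Rightarrow> (nat \<Rightarrow> complex)" where
  "single q j w = (\<lambda>i\<in>{1..q}. if i = j then w else 1)"

lemma monomial_single: "j \<in> {1..q} \<Longrightarrow> monomial q (single q j w) m = w powi m j"
proof -
  assume j: "j \<in> {1..q}"
  have "monomial q (single q j w) m = (\<Prod>i\<in>{1..q}. if i = j then w powi m i else 1)"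
    unfolding monomial_def single_def by (intro prod.cong) auto
  with j show ?thesis by (simp add: prod.delta)
qed

lemma norm_monomial: "(\<And>j. j \<in> {1..q} \<Longrightarrow> norm (z j) = 1) \<Longrightarrow> norm (monomial q z m) = 1"
  by (simp add: monomial_def prod_norm[symmetric] norm_power_int)

lemma monomial_mult: "monomial q (\<lambda>j. z j * w j) m = monomial q z m * monomial q w m"
  by (simp add: monomial_def power_int_mult_distrib prod.distrib)

lemma monomial_cong: "(\<And>j. j \<in> {1..q} \<Longrightarrow> z j = w j) \<Longrightarrow> monomial q z = monomial q w"
  by (auto simp: monomial_def intro!: ext prod.cong)

lemma cnj_monomial: "monomial q (\<lambda>j. cnj (z j)) m = cnj (monomial q z m)"
  by (simp add: monomial_def)

text \<open>The character of a padded tuple is a product of characters of single coordinates; the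
  last one is split off and the constants add up.\<close>

lemma almost_invariant_pad:
  assumes a: "a \<in> bop X" and "d \<le> d'"
    and z: "\<And>j. j \<in> {1..d} \<Longrightarrow> norm (z j) = 1"
    and inv: "\<And>j. j \<in> {1..d} \<Longrightarrow> almost_invariant X a (\<lambda>m. z j powi m j) (C j)"
  shows "almost_invariant X a (monomial d' (pad 1 d d' z)) (\<Sum>j\<in>{1..d}. C j)"
  using assms(2-)
proof (induction d)
  case 0
  have "monomial d' (pad 1 0 d' z) m = 1" for m
    by (simp add: monomial_def pad_def)
  then show ?case using almost_invariant_one[OF a] by (simp add: fun_eq_iff[symmetric] ext)
next
  case (Suc d)
  have "monomial d' (pad 1 (Suc d) d' z) = monomial d' (\<lambda>j. pad 1 d d' z j * single d' (Suc d) (z (Suc d)) j)"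
    by (rule monomial_cong) (auto simp: pad_def single_def)
  then have eq: "monomial d' (pad 1 (Suc d) d' z) = (\<lambda>m. monomial d' (pad 1 d d' z) m * z (Suc d) powi m (Suc d))"
    using Suc.prems(1) by (simp add: monomial_mult monomial_single fun_eq_iff)
  have "almost_invariant X a (\<lambda>m. monomial d' (pad 1 d d' z) m * z (Suc d) powi m (Suc d))
      ((\<Sum>j\<in>{1..d}. C j) + C (Suc d))"
  proof (rule almost_invariant_mult[OF a])
    show "norm (monomial d' (pad 1 d d' z) m) = 1" for m
      using Suc.prems(2) by (intro norm_monomial) (auto simp: pad_def)
    show "norm (z (Suc d) powi m (Suc d)) = 1" for m
      using Suc.prems(2)[of "Suc d"] by (simp add: norm_power_int)
  qed (use Suc in auto)
  then show ?case unfolding eq by simp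
qed

text \<open>The minimum is attained at the principal argument: any other angle lies outside (-pi,
  pi] and has absolute value at least pi.\<close>

lemma Least_angle:
  assumes "norm z = 1"
  shows "(LEAST s. \<exists>t::real. exp (\<i> * of_real t) = z \<and> s = \<bar>t\<bar>) = \<bar>Arg z\<bar>"
proof (rule Least_equality)
  show "\<exists>t::real. exp (\<i> * of_real t) = z \<and> \<bar>Arg z\<bar> = \<bar>t\<bar>"
    using assms complex_norm_eq_1_exp_eq by blast
next
  fix s assume "\<exists>t::real. exp (\<i> * of_real t) = z \<and> s = \<bar>t\<bar>"
  then obtain t where t: "exp (\<i> * of_real t) = z" "s = \<bar>t\<bar>" by blast
  show "\<bar>Arg z\<bar> \<le> s"
  proof (cases "- pi < t \<and> t \<le> pi")
    case True
    then have "Arg z = t" using t(1) by (intro Arg_unique[of 1]) auto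
    then show ?thesis using t by simp
  next
    case False
    then have "pi \<le> \<bar>t\<bar>" by auto
    moreover have "\<bar>Arg z\<bar> \<le> pi" using mpi_less_Arg[of z] Arg_le_pi[of z] by auto
    ultimately show ?thesis using t by simp
  qed
qed

lemma slen_eq_Arg:
  "(\<And>j. j \<in> {1..d} \<Longrightarrow> norm (z j) = 1) \<Longrightarrow> slen d z = (\<Sum>j\<in>{1..d}. \<bar>Arg (z j)\<bar>)"
  unfolding slen_def by (intro sum.cong Least_angle) auto

text \<open>The exponent is read off the principal argument rather than taken in 0..r-1, so that the
  number of steps matches the shortest arc.\<close>

lemma root_of_unity_Arg:
  assumes z: "z ^ r = 1" "norm z = 1" and r: "0 < r"
  obtains l :: int where "z = exp (2 * \<i> * of_real pi / of_nat r) powi l"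
    "\<bar>Arg z\<bar> = of_int \<bar>l\<bar> * (2 * pi / of_nat r)"
proof -
  have ez: "z = exp (\<i> * of_real (Arg z))" using z(2) complex_norm_eq_1_exp_eq by metis
  have "exp (of_nat r * (\<i> * of_real (Arg z))) = z ^ r"
    by (subst (2) ez) (rule exp_of_nat_mult)
  then obtain l :: int where l: "of_nat r * Arg z = of_int (2 * l) * pi"
    using z(1) by (auto simp: exp_eq_1)
  then have A: "Arg z = of_int l * (2 * pi / of_nat r)" using r by (simp add: field_simps)
  have "exp (2 * \<i> * of_real pi / of_nat r) powi l = exp (of_int l * (2 * \<i> * of_real pi / of_nat r))"
    by (rule exp_power_int)
  also have "of_int l * (2 * \<i> * of_real pi / of_nat r) = \<i> * of_real (Arg z)"
    unfolding A by simp
  finally have "z = exp (2 * \<i> * of_real pi / of_nat r) powi l" using ez by simp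
  moreover have "\<bar>Arg z\<bar> = of_int \<bar>l\<bar> * (2 * pi / of_nat r)" unfolding A by (simp add: abs_mult)
  ultimately show ?thesis using that by blast
qed

lemma twisted_group_Zgrp:
  assumes "(k, \<sigma>) \<in> Xi q"
  shows "twisted_group (Zgrp q k) \<sigma>"
proof -
  have "group (Zgrp q k)" by (simp add: Zgrp_def)
  then have "comm_group (Zgrp q k)"
    by (rule group.group_comm_groupI) (auto simp: Zgrp_def add.commute intro!: ext)
  then show ?thesis using assms by (simp add: twisted_group_def twisted_group_axioms_def Xi_def)
qed

section \<open>The Dirac operators\<close>

text \<open>Group coordinates are stored as residues, so a power whose exponent is a coordinate is
  well behaved only if its base is a root of unity of the matching order.\<close>

lemma power_int_mod:
  fixes w :: "'a::field"
  assumes "w ^ r = 1" "w \<noteq> 0"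
  shows "w powi (x mod int r) = w powi x"
proof -
  have "w powi x = w powi (int r * (x div int r) + x mod int r)" by simp
  also have "\<dots> = (w powi int r) powi (x div int r) * w powi (x mod int r)"
    using assms(2) by (subst power_int_add) (simp_all add: power_int_mult)
  also have "w powi int r = 1" using assms(1) by (simp add: power_int_def)
  finally show ?thesis by simp
qed

text \<open>The data for one fixed index n. The relation is written with the large torus vector
  \<open>k\<close>, which agrees with the small one on the first \<open>d\<close>
  coordinates.\<close>

locale dirac_setting =
  fixes d d' :: nat and f :: "nat \<Rightarrow> nat" and k :: "nat \<Rightarrow> enat"
    and \<sigma> :: "(nat \<Rightarrow> int) \<times> (nat \<Rightarrow> int) \<Rightarrow> complex"
    and c :: "(nat set \<Rightarrow> complex) \<Rightarrow> complex^'s^'s"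
  assumes d_le: "d \<le> d'"
    and f_in: "\<And>j. j \<in> {1..d} \<Longrightarrow> f j \<in> {1..d'}"
    and Xi: "(k, \<sigma>) \<in> Xi d'"
    and relation: "\<And>j s. j \<in> {1..d} \<Longrightarrow> s \<in> {1..d'} \<Longrightarrow>
      U d' k \<sigma> (f j) \<circ> U d' k \<sigma> s =
           (\<lambda>\<xi> m. (case k j of
                     enat r \<Rightarrow> if s = j
                       then exp ((if j < f j then 1 else - 1) * 2 * \<i> * of_real pi / of_nat r)
                       else 1
                   | \<infinity> \<Rightarrow> 1) *
             (U d' k \<sigma> s \<circ> U d' k \<sigma> (f j)) \<xi> m)"
    and rep: "faithful_cliff_rep (d + d') c"
begin

abbreviation "G \<equiv> Zgrp d' k"
abbreviation "X \<equiv> carrier (Zgrp d' k)"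
abbreviation "Ug j \<equiv> U d' k \<sigma> j"
abbreviation "Ug' j \<equiv> W (Zgrp d' k) \<sigma> (inv\<^bsub>Zgrp d' k\<^esub> (unit_vec d' j))"
abbreviation "\<Gamma> \<equiv> Gam d d' f k \<sigma>"

sublocale tw: twisted_group G \<sigma>
  by (rule twisted_group_Zgrp[OF Xi])

sublocale cl: clifford_rep "d + d'" c
  by standard (rule rep)

lemma k_ge: "j \<in> {1..d'} \<Longrightarrow> 2 \<le> k j"
proof -
  assume j: "j \<in> {1..d'}"
  have "k \<in> {1..d'} \<rightarrow>\<^sub>E {2..}" using Xi by (simp add: Xi_def)
  from PiE_mem[OF this j] show ?thesis by simp
qed

text \<open>A finite modulus is at least 2, so 1 is an admissible residue.\<close>

lemma unit_vec_carrier: "j \<in> {1..d'} \<Longrightarrow> unit_vec d' j \<in> X"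
  using k_ge[of j] by (auto simp: Zgrp_def unit_vec_def carrier_integer_mod_group modulus_def numeral_eq_enat split: enat.splits)

lemma U_unitary: "j \<in> {1..d'} \<Longrightarrow> unitary_pair X (Ug j) (Ug' j)"
  unfolding U_def by (rule tw.W_unitary[OF unit_vec_carrier])

definition orient :: "nat \<Rightarrow> int" where
  "orient j = (if j < f j then 1 else - 1)"

text \<open>The scalar by which conjugation with \<open>Ug (f j)\<close> multiplies
  \<open>Ug j\<close>. The value 1 at infinite order lets both kinds of coordinates share the
  commutation argument.\<close>

definition phase :: "nat \<Rightarrow> complex" where
  "phase j = (case k j of enat r \<Rightarrow> exp (of_int (orient j) * (2 * \<i> * of_real pi / of_nat r)) | \<infinity> \<Rightarrow> 1)"

lemma norm_phase: "norm (phase j) = 1"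
  by (cases "k j") (simp_all add: phase_def orient_def norm_exp_eq_Re)

lemma Xop_eq:
  assumes "j \<in> {1..d}"
  shows "Xop d' f k \<sigma> j = lincomb (1/2) (Ug (f j)) (1/2) (Ug' (f j))"
  unfolding Xop_def Re_op_eq adj_eqI[OF unitary_pairD(1)[OF U_unitary[OF f_in[OF assms]]]] ..

lemma Yop_eq:
  assumes "j \<in> {1..d}"
  shows "Yop d' f k \<sigma> j = lincomb (of_int (orient j) / (2 * \<i>)) (Ug (f j)) (- of_int (orient j) / (2 * \<i>)) (Ug' (f j))"
  unfolding Yop_def Im_op_eq adj_eqI[OF unitary_pairD(1)[OF U_unitary[OF f_in[OF assms]]]]
  by (simp add: lincomb_def orient_def)

text \<open>The sign inside \<open>Yop\<close> and the sign here multiply to 1, leaving U = Re U + i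
  Im U.\<close>

lemma U_from_XY:
  assumes "j \<in> {1..d}"
  shows "Ug (f j) \<xi> m = Xop d' f k \<sigma> j \<xi> m + of_int (orient j) * \<i> * Yop d' f k \<sigma> j \<xi> m"
  unfolding Xop_eq[OF assms] Yop_eq[OF assms] lincomb_def by (simp add: orient_def field_simps)

lemma lincomb_U_bop:
  "j \<in> {1..d} \<Longrightarrow> lincomb w (Ug (f j)) w' (Ug' (f j)) \<in> bop X"
  using unitary_pairD(2,3)[OF U_unitary[OF f_in]] by (intro bop_lincomb) auto

lemma Xop_bop: "j \<in> {1..d} \<Longrightarrow> Xop d' f k \<sigma> j \<in> bop X"
  by (simp add: Xop_eq lincomb_U_bop)

lemma Yop_bop: "j \<in> {1..d} \<Longrightarrow> Yop d' f k \<sigma> j \<in> bop X"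
  by (simp add: Yop_eq lincomb_U_bop)

text \<open>The adjoint conjugates the scalars and \<open>J\<close> conjugates them back, so the
  coefficients survive while the unitary and its inverse trade places.\<close>

lemma right_act_lincomb:
  assumes j: "j \<in> {1..d}" and \<zeta>: "\<zeta> \<in> ell2 X"
  shows "right_act G \<zeta> (lincomb w (Ug (f j)) w' (Ug' (f j))) =
    lincomb w (conjJ G (Ug' (f j))) w' (conjJ G (Ug (f j))) \<zeta>"
proof -
  note u = unitary_pairD(1)[OF U_unitary[OF f_in[OF j]]]
  have "adj X (lincomb w (Ug (f j)) w' (Ug' (f j))) = lincomb (cnj w) (Ug' (f j)) (cnj w') (Ug (f j))"
    by (rule adj_eqI[OF adj_pair_lincomb[OF u adj_pair_sym[OF u]]])
  then show ?thesis
    using \<zeta> unfolding right_act_def lincomb_def by (simp add: Jop_add Jop_smult conjJ_def on_ell2_def)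
qed

text \<open>The map from m to \<open>phase j powi m j\<close> is a character of the group. For
  finite order this rests on the phase being an r-th root of unity, which absorbs the reduction
  modulo r.\<close>

lemma phase_translate:
  assumes j: "j \<in> {1..d}" and s: "s \<in> {1..d'}" and p: "p \<in> X"
  shows "phase j powi p j =
    (if s = j then phase j else 1) * phase j powi (p \<otimes>\<^bsub>G\<^esub> inv\<^bsub>G\<^esub> (unit_vec d' s)) j"
proof (cases "k j")
  case (enat r)
  have j': "j \<in> {1..d'}" using j d_le by auto
  have r: "2 \<le> r" using k_ge[OF j'] enat by (simp add: numeral_eq_enat)
  have ph: "phase j ^ r = 1" "phase j \<noteq> 0"
  proof -
    have "phase j ^ r = exp (of_nat r * (of_int (orient j) * (2 * \<i> * of_real pi / of_nat r)))"
      unfolding phase_def enat by (simp only: enat.simps exp_of_nat_mult)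
    also have "\<dots> = exp (of_int (orient j) * (2 * \<i> * of_real pi))" using r by simp
    also have "\<dots> = 1" using exp_two_pi_i' by (auto simp: orient_def exp_minus mult_ac)
    finally show "phase j ^ r = 1" .
    show "phase j \<noteq> 0" using norm_phase[of j] by auto
  qed
  have pj: "p j mod int r = p j"
    using p j' enat by (auto simp: Zgrp_def carrier_integer_mod_group modulus_def dest!: PiE_mem[of _ _ _ j] split: if_splits)
  have mem: "unit_vec d' s \<in> (\<Pi>\<^sub>E j\<in>{1..d'}. carrier (integer_mod_group (modulus (k j))))"
    using unit_vec_carrier[OF s] by (simp add: Zgrp_def)
  from PiE_mem[OF mem j'] have "unit_vec d' s j \<in> carrier (integer_mod_group r)"
    using enat by (simp add: modulus_def)
  with mem have "(p \<otimes>\<^bsub>G\<^esub> inv\<^bsub>G\<^esub> (unit_vec d' s)) j = (p j + (- unit_vec d' s j) mod int r) mod int r"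
    using j' enat by (simp add: Zgrp_def modulus_def)
  then have "(p \<otimes>\<^bsub>G\<^esub> inv\<^bsub>G\<^esub> (unit_vec d' s)) j = (p j - (if s = j then 1 else 0)) mod int r"
    using j' by (auto simp: unit_vec_def mod_add_right_eq pj)
  then show ?thesis
    using power_int_mod[OF ph] ph(2) pj by (auto simp: power_int_diff)
qed (simp add: phase_def)

text \<open>Conjugation by \<open>U\<^bsub>f(j)\<^esub>\<close> agrees with the dual action of \<open>phase j\<close> on the generators. Commutation with
  the single unitary \<open>Vop j\<close> expresses this in a form that passes to the generated algebra.\<close>

definition Vop :: "nat \<Rightarrow> (nat \<Rightarrow> int) oper" where
  "Vop j = diag X (\<lambda>m. cnj (phase j powi m j)) \<circ> Ug (f j)"

definition Vop' :: "nat \<Rightarrow> (nat \<Rightarrow> int) oper" where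
  "Vop' j = Ug' (f j) \<circ> diag X (\<lambda>m. phase j powi m j)"

lemma diag_phase:
  "unitary_pair X (diag X (\<lambda>m. phase j powi m j)) (diag X (\<lambda>m. cnj (phase j powi m j)))"
  by (rule diag_unitary) (simp add: norm_power_int norm_phase)

lemma V_unitary: "j \<in> {1..d} \<Longrightarrow> unitary_pair X (Vop j) (Vop' j)"
  unfolding Vop_def Vop'_def
  by (intro unitary_pair_comp U_unitary f_in unitary_pair_sym[OF diag_phase])

text \<open>Moving \<open>Ug s\<close> past \<open>Ug (f j)\<close> costs the scalar
  \<open>l\<close>, and past the diagonal factor its conjugate; \<open>l\<close> is unimodular, so
  the two cancel.\<close>

lemma U_commutes_V:
  assumes j: "j \<in> {1..d}" and s: "s \<in> {1..d'}"
  shows "commutes_on X (Ug s) (Vop j)"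
  unfolding commutes_on_def
proof (intro ballI ext)
  fix \<xi> :: "(nat \<Rightarrow> int) \<Rightarrow> complex" and p assume \<xi>: "\<xi> \<in> ell2 X"
  define \<zeta> where "\<zeta> = Ug (f j) \<xi>"
  define q where "q = p \<otimes>\<^bsub>G\<^esub> inv\<^bsub>G\<^esub> (unit_vec d' s)"
  define l where "l = (if s = j then phase j else 1)"
  have \<zeta>: "\<zeta> \<in> ell2 X" unfolding \<zeta>_def
    using bop_ell2[OF unitary_pairD(2)[OF U_unitary[OF f_in[OF j]]] \<xi>] .
  note us = unitary_pairD(2)[OF U_unitary[OF s]]
  have rel: "Ug (f j) (Ug s \<xi>) = (\<lambda>m. l * Ug s \<zeta> m)"
    using fun_cong[OF relation[OF j s], of \<xi>]
    by (cases "k j") (simp_all add: \<zeta>_def l_def phase_def orient_def)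
  have app: "Ug s \<eta> p = (if p \<in> X then \<sigma> (unit_vec d' s, q) * \<eta> q else 0)" if "\<eta> \<in> ell2 X" for \<eta>
    using that by (simp add: U_def tw.W_apply q_def)
  have V: "Vop j \<eta> = (\<lambda>m. cnj (phase j powi m j) * Ug (f j) \<eta> m)" if "\<eta> \<in> ell2 X" for \<eta>
    using bop_ell2[OF unitary_pairD(2)[OF U_unitary[OF f_in[OF j]]] that]
    by (simp add: Vop_def diag_def on_ell2_def)
  note mem = bop_ell2[OF unitary_pairD(2)[OF V_unitary[OF j]] \<xi>] bop_ell2[OF us \<xi>]
  show "Ug s (Vop j \<xi>) p = Vop j (Ug s \<xi>) p"
  proof (cases "p \<in> X")
    case p: True
    have "norm l = 1" by (simp add: l_def norm_phase)
    then have ll: "l * cnj l = 1" using complex_norm_square[of l] by simp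
    have "phase j powi p j = l * phase j powi q j"
      using phase_translate[OF j s p] by (simp add: q_def l_def)
    then have "cnj (phase j powi p j) * l = cnj (phase j powi q j)"
      using ll by (simp add: mult.commute[of "cnj l"] mult.assoc del: complex_cnj_power_int)
    moreover have "Ug s (Vop j \<xi>) p = \<sigma> (unit_vec d' s, q) * (cnj (phase j powi q j) * \<zeta> q)"
      by (subst app[OF mem(1)]) (simp add: p V[OF \<xi>] \<zeta>_def)
    moreover have "Vop j (Ug s \<xi>) p = cnj (phase j powi p j) * l * (\<sigma> (unit_vec d' s, q) * \<zeta> q)"
      using p by (simp add: V[OF mem(2)] rel app[OF \<zeta>])
    ultimately show ?thesis by (simp only: mult_ac)
  next
    case False
    then show ?thesis by (simp add: app[OF mem(1)] V[OF mem(2)] rel app[OF \<zeta>])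
  qed
qed

text \<open>Two families of unitaries commute with the generators and hence with the algebra:
  \<open>Vop j\<close>, encoding the dual action, and the right translations, which remove the right
  actions from the finite-order operators.\<close>

lemma frakA_commutes:
  assumes a: "a \<in> frakA d d' k \<sigma>"
  shows "a \<in> bop X"
    and "j \<in> {1..d} \<Longrightarrow> commutes_on X a (Vop j)"
    and "j \<in> {1..d} \<Longrightarrow> commutes_on X a (Vop' j)"
    and "m \<in> X \<Longrightarrow> commutes_on X a (conjJ G (W G \<sigma> m))"
proof -
  have a': "a \<in> cstar_gen X (U d' k \<sigma> ` {1..d})" using a by (simp add: frakA_def)
  have s: "U d' k \<sigma> ` {1..d} \<subseteq> bop X"
    using unitary_pairD(2)[OF U_unitary] d_le by force
  have R: "unitary_pair X (conjJ G (W G \<sigma> m)) (conjJ G (W G \<sigma> (inv\<^bsub>G\<^esub> m)))" if "m \<in> X" for m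
    by (rule tw.conjJ_unitary[OF tw.W_unitary[OF that]])
  have R': "commutes_on X s (conjJ G (W G \<sigma> m))" if "s \<in> U d' k \<sigma> ` {1..d}" "m \<in> X" for s m
    using that d_le by (auto simp: U_def intro!: tw.W_commutes_conjJ unit_vec_carrier)
  show "m \<in> X \<Longrightarrow> commutes_on X a (conjJ G (W G \<sigma> m))"
    by (rule cstar_gen_commutes(2)[OF R s R' a'])
  have V: "commutes_on X s (Vop j)" if "s \<in> U d' k \<sigma> ` {1..d}" "j \<in> {1..d}" for s j
    using that d_le by (auto intro!: U_commutes_V)
  show "j \<in> {1..d} \<Longrightarrow> commutes_on X a (Vop j)" "j \<in> {1..d} \<Longrightarrow> commutes_on X a (Vop' j)"
    using cstar_gen_commutes(2,3)[OF V_unitary s V a'] by blast+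
  show "a \<in> bop X"
    using cstar_gen_commutes(1)[OF R[OF tw.one_closed] s R' a'] by blast
qed

section \<open>Domains of the operators entering the Dirac operator\<close>

lemma right_act_bop: "b \<in> bop X \<Longrightarrow> \<xi> \<in> ell2 X \<Longrightarrow> right_act G \<xi> b \<in> ell2 X"
  unfolding right_act_def
  by (intro tw.Jop_ell2(1) bop_ell2[of "adj X b" X] adj_pairD(2)[OF adj_pair_adj]) auto

lemma right_act_smult: "b \<in> bop X \<Longrightarrow> right_act G (\<lambda>p. w * \<xi> p) b = (\<lambda>p. w * right_act G \<xi> b p)"
  unfolding right_act_def
  by (simp add: Jop_smult bop_smult[OF adj_pairD(2)[OF adj_pair_adj]])

lemma vec_comm_smult: "b \<in> bop X \<Longrightarrow> vec_comm G b (\<lambda>p. w * \<xi> p) = (\<lambda>p. w * vec_comm G b \<xi> p)"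
  by (simp add: vec_comm_def right_act_smult bop_smult[of b X] algebra_simps)

lemma vec_comm_ell2: "b \<in> bop X \<Longrightarrow> \<xi> \<in> ell2 X \<Longrightarrow> vec_comm G b \<xi> \<in> ell2 X"
  unfolding vec_comm_def by (intro ell2_diff right_act_bop bop_ell2[of b X]) auto

text \<open>A scalar counterpart of \<open>dom_D\<close>, given by partial derivatives one
  coordinate at a time; all \<open>Gam\<close> operators send it into square summable
  vectors.\<close>

definition smooth :: "((nat \<Rightarrow> int) \<Rightarrow> complex) set" where
  "smooth = {\<xi> \<in> ell2 X. \<forall>j\<in>{1..d'}. k j = \<infinity> \<longrightarrow> partial j \<xi> \<in> ell2 X}"

lemma fin_supp_smooth: "\<xi> \<in> fin_supp X \<Longrightarrow> \<xi> \<in> smooth"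
  by (auto simp: smooth_def partial_def intro!: fin_supp_ell2 fin_supp_subset[of \<xi> X "\<lambda>m. \<i> * of_int (m _) * \<xi> m"])

definition Im_vop :: "nat \<Rightarrow> (nat \<Rightarrow> int) oper" where
  "Im_vop j = Im_op X (on_ell2 X (\<lambda>\<eta> p. \<eta> p - vop d' k (zgen d' k j) \<eta> p))"

lemma Im_vop_bop:
  assumes "j \<in> {1..d'}"
  shows "Im_vop j \<in> bop X"
proof -
  have n: "norm (monomial d' (zgen d' k j) m) = 1" for m
    by (rule norm_monomial) (auto simp: zgen_def norm_exp_eq_Re split: enat.splits)
  then have v: "vop d' k (zgen d' k j) \<in> bop X"
    unfolding vop_def diag_def[symmetric] by (rule unitary_pairD(2)[OF diag_unitary])
  have one: "diag X (\<lambda>_. 1) \<in> bop X" by (rule unitary_pairD(2)[OF diag_unitary]) simp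
  have "on_ell2 X (\<lambda>\<eta> p. \<eta> p - vop d' k (zgen d' k j) \<eta> p) =
      lincomb 1 (diag X (\<lambda>_. 1)) (- 1) (vop d' k (zgen d' k j))"
    by (auto simp: lincomb_def on_ell2_def diag_def vop_def fun_eq_iff)
  with bop_lincomb[OF one v] show ?thesis unfolding Im_vop_def by (intro bop_Im_op) simp
qed

lemma Gam_cases:
  "i \<in> {1..d} \<Longrightarrow> k i = \<infinity> \<Longrightarrow> \<Gamma> i \<xi> = Xop d' f k \<sigma> i (partial i \<xi>)"
  "i \<in> {1..d} \<Longrightarrow> k i = enat r \<Longrightarrow>
    \<Gamma> i \<xi> = (\<lambda>m. - of_nat r / (2 * \<i> * of_real pi) * vec_comm G (Yop d' f k \<sigma> i) \<xi> m)"
  "i \<in> {1..d} \<Longrightarrow> k i = \<infinity> \<Longrightarrow> \<Gamma> (d + i) \<xi> = Yop d' f k \<sigma> i (partial i \<xi>)"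
  "i \<in> {1..d} \<Longrightarrow> k i = enat r \<Longrightarrow>
    \<Gamma> (d + i) \<xi> = (\<lambda>m. of_nat r / (2 * \<i> * of_real pi) * vec_comm G (Xop d' f k \<sigma> i) \<xi> m)"
  "i \<in> {d+1..d'} \<Longrightarrow> k i = \<infinity> \<Longrightarrow> \<Gamma> (d + i) \<xi> = partial i \<xi>"
  "i \<in> {d+1..d'} \<Longrightarrow> k i = enat r \<Longrightarrow>
    \<Gamma> (d + i) \<xi> = (\<lambda>m. of_nat r / (2 * \<i> * of_real pi) * Im_vop i \<xi> m)"
  by (auto simp: Gam_def Im_vop_def)

lemma index_cases:
  assumes "i \<in> {1..d + d'}"
  obtains "i \<in> {1..d}" | j where "i = d + j" "j \<in> {1..d}" | j where "i = d + j" "j \<in> {d+1..d'}"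
proof -
  have "i \<le> d \<or> i = d + (i - d) \<and> i - d \<in> {1..d} \<or> i = d + (i - d) \<and> i - d \<in> {d+1..d'}"
    using assms by auto
  then show ?thesis using that assms by (metis atLeastAtMost_iff)
qed

lemma partial_smult: "partial j (\<lambda>p. w * \<xi> p) = (\<lambda>p. w * partial j \<xi> p)"
  by (simp add: partial_def mult_ac)

lemma Gam_smult:
  assumes "i \<in> {1..d + d'}"
  shows "\<Gamma> i (\<lambda>p. w * \<xi> p) = (\<lambda>p. w * \<Gamma> i \<xi> p)"
  using assms
proof (cases rule: index_cases)
  case 1
  then show ?thesis
    by (cases "k i") (simp_all add: Gam_cases partial_smult bop_smult[OF Xop_bop] vec_comm_smult[OF Yop_bop] mult.left_commute)
next
  case (2 j)
  then show ?thesis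
    by (cases "k j") (simp_all add: Gam_cases partial_smult bop_smult[OF Yop_bop] vec_comm_smult[OF Xop_bop] mult.left_commute)
next
  case (3 j)
  then have "j \<in> {1..d'}" by auto
  then show ?thesis using 3
    by (cases "k j") (simp_all add: Gam_cases partial_smult bop_smult[OF Im_vop_bop] mult.left_commute)
qed

lemma Gam_ell2:
  assumes "i \<in> {1..d + d'}" "\<xi> \<in> smooth"
  shows "\<Gamma> i \<xi> \<in> ell2 X"
proof -
  have \<xi>: "\<xi> \<in> ell2 X" "\<And>j. j \<in> {1..d'} \<Longrightarrow> k j = \<infinity> \<Longrightarrow> partial j \<xi> \<in> ell2 X"
    using assms(2) by (auto simp: smooth_def)
  show ?thesis using assms(1)
  proof (cases rule: index_cases)
    case 1
    then have "i \<in> {1..d'}" using d_le by auto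
    then show ?thesis using 1 \<xi>
      by (cases "k i") (simp_all only: Gam_cases bop_ell2[OF Xop_bop] ell2_smult vec_comm_ell2[OF Yop_bop])
  next
    case (2 j)
    then have "j \<in> {1..d'}" using d_le by auto
    then show ?thesis using 2 \<xi>
      by (cases "k j") (simp_all only: Gam_cases bop_ell2[OF Yop_bop] ell2_smult vec_comm_ell2[OF Xop_bop])
  next
    case (3 j)
    then have "j \<in> {1..d'}" by auto
    then show ?thesis using 3 \<xi>
      by (cases "k j") (simp_all only: Gam_cases bop_ell2[OF Im_vop_bop] ell2_smult)
  qed
qed

abbreviation tensor :: "((nat \<Rightarrow> int) \<Rightarrow> complex) \<Rightarrow> complex^'s \<Rightarrow> ((nat \<Rightarrow> int) \<Rightarrow> complex^'s)" where
  "tensor \<xi> v \<equiv> (\<lambda>p. \<xi> p *s v)"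

lemma tensor_ell2:
  assumes "\<xi> \<in> ell2 Y"
  shows "tensor \<xi> v \<in> ell2 Y" "ell2_norm Y (tensor \<xi> v) = ell2_norm Y \<xi> * norm v"
  using ell2_scaled[of "tensor \<xi> v" "norm v" \<xi>] assms by (auto simp: norm_vector_scalar_mult mult.commute)

text \<open>Each component of \<open>C\<close> applied to the tensor is a multiple of \<xi>, so only
  homogeneity of \<open>T\<close> at \<xi> enters. This makes it usable for the unbounded
  \<open>Gam\<close> operators.\<close>

lemma tens_tensor:
  assumes "\<And>w. T (\<lambda>p. w * \<xi> p) = (\<lambda>p. w * T \<xi> p)"
  shows "tens T C (tensor \<xi> v) = tensor (T \<xi>) (C *v v)"
proof -
  have "(\<lambda>p. (C *v tensor \<xi> v p) $ s) = (\<lambda>p. (C *v v) $ s * \<xi> p)" for s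
    by (simp add: vector_scalar_commute mult.commute)
  then show ?thesis by (simp only: tens_def assms) (simp add: vec_eq_iff fun_eq_iff mult.commute)
qed

abbreviation weight :: "(nat \<Rightarrow> int) \<Rightarrow> real" where
  "weight m \<equiv> (1 + (\<Sum>j | j \<in> {1..d'} \<and> k j = \<infinity>. (real_of_int (m j))\<^sup>2))"

lemma fin_supp_dom_D:
  assumes "\<xi> \<in> fin_supp X"
  shows "tensor \<xi> v \<in> (dom_D d' k :: ((nat \<Rightarrow> int) \<Rightarrow> complex^'s) set)"
proof -
  have "(\<lambda>m. weight m * (norm (tensor \<xi> v m))\<^sup>2) summable_on X"
    using assms unfolding fin_supp_def
    by (intro finite_nonzero_values_imp_summable_on) (auto intro: finite_subset[of _ "{p. \<xi> p \<noteq> 0}"])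
  then show ?thesis using tensor_ell2(1)[OF fin_supp_ell2[OF assms]] by (simp add: dom_D_def)
qed

text \<open>Each squared coordinate is one summand of the weight, and the factor coming from a
  nonzero \<open>v\<close> can be divided out.\<close>

lemma dom_D_smooth:
  assumes "tensor \<xi> v \<in> (dom_D d' k :: ((nat \<Rightarrow> int) \<Rightarrow> complex^'s) set)" "v \<noteq> 0" "\<xi> \<in> ell2 X"
  shows "\<xi> \<in> smooth"
  unfolding smooth_def
proof (intro CollectI conjI ballI impI assms(3))
  fix j assume j: "j \<in> {1..d'}" "k j = \<infinity>"
  have "(\<lambda>m. weight m * (norm (tensor \<xi> v m))\<^sup>2) summable_on X"
    using assms(1) by (simp add: dom_D_def)
  then have s: "(\<lambda>m. inverse ((norm v)\<^sup>2) * (weight m * (norm (tensor \<xi> v m))\<^sup>2)) summable_on X"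
    by (rule summable_on_cmult_right)
  have "(\<lambda>m. (norm (partial j \<xi> m))\<^sup>2) summable_on X"
  proof (rule summable_on_comparison_test[OF s])
    fix m
    have "(real_of_int (m j))\<^sup>2 \<le> (\<Sum>j | j \<in> {1..d'} \<and> k j = \<infinity>. (real_of_int (m j))\<^sup>2)"
      using j by (intro member_le_sum) auto
    then have "(real_of_int (m j))\<^sup>2 * (norm (\<xi> m))\<^sup>2 \<le> weight m * (norm (\<xi> m))\<^sup>2"
      by (intro mult_right_mono) auto
    also have "\<dots> = inverse ((norm v)\<^sup>2) * (weight m * (norm (tensor \<xi> v m))\<^sup>2)"
      using assms(2) by (simp add: norm_vector_scalar_mult power_mult_distrib)
    finally show "(norm (partial j \<xi> m))\<^sup>2 \<le> inverse ((norm v)\<^sup>2) * (weight m * (norm (tensor \<xi> v m))\<^sup>2)"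
      by (simp add: partial_def norm_mult power_mult_distrib)
  qed simp
  then show "partial j \<xi> \<in> ell2 X"
    using ell2_outside[OF assms(3)] by (auto simp: ell2_def partial_def)
qed

end

section \<open>Commutators of the Gamma operators with a Lipschitz element\<close>

locale lipschitz_element = dirac_setting d d' f k \<sigma> c
  for d d' f k \<sigma> and c :: "(nat set \<Rightarrow> complex) \<Rightarrow> complex^'s^'s" +
  fixes a assumes a_L: "a \<in> dom_L d d' f c k \<sigma>"
begin

lemma a_frakA: "a \<in> frakA d d' k \<sigma>"
  using a_L by (simp add: dom_L_def)

lemmas a_bop = frakA_commutes(1)[OF a_frakA]

definition Gam_comm :: "nat \<Rightarrow> ((nat \<Rightarrow> int) \<Rightarrow> complex) \<Rightarrow> ((nat \<Rightarrow> int) \<Rightarrow> complex)" where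
  "Gam_comm j \<xi> = (\<lambda>m. \<Gamma> j (a \<xi>) m - a (\<Gamma> j \<xi>) m)"

abbreviation "Lip \<equiv> L d d' f c k \<sigma> a"

lemma ampl_tensor: "ampl a (tensor \<xi> v) = tensor (a \<xi>) v"
  unfolding ampl_def using tens_tensor[of a \<xi> "mat 1" v] by (simp add: bop_smult[OF a_bop])

text \<open>Here the domain condition in \<open>dom_L\<close> enters: tested on a tensor with a
  nonzero vector, it makes the partial derivatives of \<open>a \<xi>\<close> square
  summable.\<close>

lemma a_smooth:
  assumes "\<xi> \<in> fin_supp X"
  shows "a \<xi> \<in> smooth"
proof -
  obtain v :: "complex^'s" where v: "v \<noteq> 0" using zero_neq_one by metis
  have "ampl a (tensor \<xi> v) \<in> (dom_D d' k :: ((nat \<Rightarrow> int) \<Rightarrow> complex^'s) set)"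
    using a_L fin_supp_dom_D[OF assms, of v] unfolding dom_L_def by blast
  then show ?thesis
    unfolding ampl_tensor by (rule dom_D_smooth[OF _ v bop_ell2[OF a_bop fin_supp_ell2[OF assms]]])
qed

lemma Gam_comm_ell2:
  assumes "\<xi> \<in> fin_supp X" "j \<in> {1..d + d'}"
  shows "Gam_comm j \<xi> \<in> ell2 X"
  unfolding Gam_comm_def
  using assms by (intro ell2_diff bop_ell2[OF a_bop] Gam_ell2 a_smooth fin_supp_smooth)

lemma dirac_comm_tensor:
  assumes \<xi>: "\<xi> \<in> fin_supp X"
  shows "dirac_comm d d' f c k \<sigma> a (tensor \<xi> v) =
    (\<lambda>m. \<Sum>j\<in>{1..d + d'}. Gam_comm j \<xi> m *s (c (cliff_gen j) *v v))"
proof -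
  have dirac: "dirac d d' f c k \<sigma> (tensor \<eta> v) = (\<lambda>m. \<Sum>j\<in>{1..d + d'}. \<Gamma> j \<eta> m *s (c (cliff_gen j) *v v))" for \<eta>
    unfolding dirac_def by (intro ext sum.cong refl) (simp add: tens_tensor Gam_smult)
  have "ampl a (dirac d d' f c k \<sigma> (tensor \<xi> v)) m =
      (\<Sum>j\<in>{1..d + d'}. a (\<Gamma> j \<xi>) m *s (c (cliff_gen j) *v v))" for m
  proof -
    \<comment> \<open>\<open>a\<close> is additive on square summable vectors only, so each summand
      has to be known to be one; this holds because \<xi> is smooth.\<close>
    have "a (\<lambda>p. \<Sum>j\<in>{1..d + d'}. (c (cliff_gen j) *v v) $ s * \<Gamma> j \<xi> p) m =
        (\<Sum>j\<in>{1..d + d'}. (c (cliff_gen j) *v v) $ s * a (\<Gamma> j \<xi>) m)" for s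
      using bop_sum[OF a_bop, of "{1..d+d'}" "\<lambda>j. \<Gamma> j \<xi>"] \<xi> by (simp add: Gam_ell2 fin_supp_smooth)
    then show ?thesis
      unfolding dirac ampl_def tens_def by (simp add: vec_eq_iff mult.commute)
  qed
  then show ?thesis
    unfolding dirac_comm_def ampl_tensor dirac Gam_comm_def
    by (simp add: sum_subtractf[symmetric] vector_ssub_ldistrib vector_sub_rdistrib)
qed

text \<open>On the tensor of \<xi> with v, \<open>[D, a]\<close> is the Clifford combination of the
  vectors \<open>Gam_comm j \<xi>\<close>. Its norm is bounded for every v, as
  \<open>ell2_norm_component\<close> requires.\<close>

lemma Gam_comm_bound:
  assumes \<xi>: "\<xi> \<in> fin_supp X" and j: "j \<in> {1..d + d'}"
  shows "ell2_norm X (Gam_comm j \<xi>) \<le> Lip * ell2_norm X \<xi>"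
proof (rule cl.ell2_norm_component[OF Gam_comm_ell2[OF \<xi>] _ j])
  fix v :: "complex^'s"
  let ?D = "dirac_comm d d' f c k \<sigma> a"
  have Gam_comm_scale: "Gam_comm j (\<lambda>p. w * \<xi> p) = (\<lambda>m. w * Gam_comm j \<xi> m)" if "j \<in> {1..d+d'}" for w j
    using that by (simp add: Gam_comm_def bop_smult[OF a_bop] Gam_smult algebra_simps)
  have "ell2_norm X (?D (tensor \<xi> v)) \<le> opnorm X (dom_D d' k) ?D * ell2_norm X (tensor \<xi> v)"
  proof (rule le_opnorm)
    show "bounded_on X (dom_D d' k) ?D" using a_L by (simp add: dom_L_def)
    show "tensor \<xi> v \<in> dom_D d' k" by (rule fin_supp_dom_D[OF \<xi>])
    show "dom_D d' k \<subseteq> ell2 X" by (auto simp: dom_D_def)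
    show "?D (tensor \<xi> v) \<in> ell2 X"
      unfolding dirac_comm_tensor[OF \<xi>] using \<xi> by (intro ell2_sum tensor_ell2 Gam_comm_ell2) auto
    fix r :: real
    have fs: "(\<lambda>p. of_real r * \<xi> p) \<in> fin_supp X" by (rule fin_supp_subset[OF \<xi>]) simp
    have eq: "(\<lambda>p. r *\<^sub>R tensor \<xi> v p) = tensor (\<lambda>p. of_real r * \<xi> p) v"
      by (simp add: vec_eq_iff scaleR_conv_of_real[where 'a = complex] fun_eq_iff)
    show "(\<lambda>p. r *\<^sub>R tensor \<xi> v p) \<in> dom_D d' k \<and>
        ?D (\<lambda>p. r *\<^sub>R tensor \<xi> v p) = (\<lambda>p. r *\<^sub>R ?D (tensor \<xi> v) p)"
      unfolding eq dirac_comm_tensor[OF fs] dirac_comm_tensor[OF \<xi>]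
      using fin_supp_dom_D[OF fs, of v]
      by (simp add: Gam_comm_scale scaleR_sum_right vec_eq_iff scaleR_conv_of_real[where 'a = complex] fun_eq_iff sum_distrib_left mult.assoc)
  qed
  then show "ell2_norm X (\<lambda>m. \<Sum>j\<in>{1..d + d'}. Gam_comm j \<xi> m *s (c (cliff_gen j) *v v)) \<le> Lip * ell2_norm X \<xi> * norm v"
    unfolding dirac_comm_tensor[OF \<xi>] L_def by (simp add: tensor_ell2 fin_supp_ell2[OF \<xi>] mult.assoc)
qed

text \<open>Being a supremum over a set, \<open>Lip\<close> is not visibly nonnegative; a vector of
  norm 1 in the domain settles it.\<close>

lemma Lip_nonneg: "d \<noteq> 0 \<Longrightarrow> 0 \<le> Lip"
proof -
  assume "d \<noteq> 0"
  then have 1: "1 \<in> {1..d + d'}" by auto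
  let ?\<delta> = "\<lambda>p. if p \<in> {\<one>\<^bsub>G\<^esub>} then (\<lambda>_. 1 :: complex) p else 0"
  have fs: "?\<delta> \<in> fin_supp X" by (rule fin_supp_restrict) auto
  have "ell2_norm X ?\<delta> = 1" by (subst ell2_norm_restrict) auto
  then show ?thesis using Gam_comm_bound[OF fs 1] order_trans[OF ell2_norm_nonneg] by fastforce
qed

section \<open>Moving along a single coordinate\<close>

lemma norm_add_unimodular_le:
  fixes P Q :: "(nat \<Rightarrow> int) \<Rightarrow> complex"
  assumes "P \<in> ell2 X" "Q \<in> ell2 X" "ell2_norm X P \<le> B" "ell2_norm X Q \<le> B" "norm w = 1"
  shows "ell2_norm X (\<lambda>m. P m + w * Q m) \<le> 2 * B"
  using ell2_add(2)[OF assms(1) ell2_smult(1)[OF assms(2), of w]] ell2_smult(2)[OF assms(2), of w] assms(3-)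
  by simp

lemma Gam_comm_indices: "j \<in> {1..d} \<Longrightarrow> j \<in> {1..d + d'}" "j \<in> {1..d} \<Longrightarrow> d + j \<in> {1..d + d'}"
  using d_le by auto

lemma almost_invariant_infinite_coordinate:
  assumes j: "j \<in> {1..d}" and inf: "k j = \<infinity>" and z: "norm z = 1"
  shows "almost_invariant X a (\<lambda>m. z powi m j) (2 * Lip * \<bar>Arg z\<bar>)"
proof -
  note U = U_unitary[OF f_in[OF j]]
  have ph: "phase j = 1" by (simp add: phase_def inf)
  have V: "Vop j \<xi> = Ug (f j) \<xi>" "Vop' j \<xi> = Ug' (f j) \<xi>" if "\<xi> \<in> ell2 X" for \<xi>
    using that bop_ell2[OF unitary_pairD(2)[OF U] that] by (simp_all add: Vop_def Vop'_def ph diag_one)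
  \<comment> \<open>With phase 1 the diagonal factor of \<open>Vop j\<close> is trivial, so
    commuting with \<open>Vop j\<close> means commuting with \<open>Ug (f j)\<close>.\<close>
  have aU: "commutes_on X a (Ug (f j))" "commutes_on X a (Ug' (f j))"
    using frakA_commutes(2,3)[OF a_frakA j] V bop_ell2[OF a_bop] by (simp_all add: commutes_on_def)
  have aZ: "commutes_on X a (Xop d' f k \<sigma> j)" "commutes_on X a (Yop d' f k \<sigma> j)"
    unfolding Xop_eq[OF j] Yop_eq[OF j]
    by (intro commutes_on_lincomb a_bop unitary_pairD(2,3)[OF U] aU)+
  have "almost_invariant X a (\<lambda>m. exp (\<i> * of_real (Arg z * of_int (m j)))) (2 * Lip * \<bar>Arg z\<bar>)"
  proof (rule almost_invariant_phase[OF a_bop])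
    show "0 \<le> 2 * Lip" using Lip_nonneg j by auto
    fix \<xi> :: "(nat \<Rightarrow> int) \<Rightarrow> complex" assume \<xi>: "\<xi> \<in> fin_supp X"
    define b where "b = (\<lambda>m. partial j (a \<xi>) m - a (partial j \<xi>) m)"
    have j': "j \<in> {1..d'}" using j d_le by auto
    have mem: "partial j (a \<xi>) \<in> ell2 X" "partial j \<xi> \<in> ell2 X"
      using a_smooth[OF \<xi>] fin_supp_smooth[OF \<xi>] j' inf by (auto simp: smooth_def)
    have mem': "a (partial j \<xi>) \<in> ell2 X" by (rule bop_ell2[OF a_bop mem(2)])
    have b: "b \<in> ell2 X" unfolding b_def by (rule ell2_diff(1)[OF mem(1) mem'])
    have X: "Gam_comm j \<xi> = Xop d' f k \<sigma> j b"
      unfolding Gam_comm_def b_def bop_diff[OF Xop_bop[OF j] mem(1) mem'] Gam_cases(1)[OF j inf]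
      using aZ(1) mem(2) by (simp add: commutes_on_def)
    have Y: "Gam_comm (d + j) \<xi> = Yop d' f k \<sigma> j b"
      unfolding Gam_comm_def b_def bop_diff[OF Yop_bop[OF j] mem(1) mem'] Gam_cases(3)[OF j inf]
      using aZ(2) mem(2) by (simp add: commutes_on_def)
    \<comment> \<open>Neither \<open>Xop\<close> nor \<open>Yop\<close> need be invertible, but
      their combination \<open>Ug (f j)\<close> is unitary, so \<open>b\<close> is controlled by
      both of its images together.\<close>
    have "ell2_norm X b = ell2_norm X (Ug (f j) b)" by (rule unitary_norm[OF U b, symmetric])
    also have "Ug (f j) b = (\<lambda>m. Gam_comm j \<xi> m + (of_int (orient j) * \<i>) * Gam_comm (d + j) \<xi> m)"
      unfolding X Y by (rule ext) (rule U_from_XY[OF j])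
    also have "ell2_norm X \<dots> \<le> 2 * (Lip * ell2_norm X \<xi>)"
      using \<xi> Gam_comm_indices[OF j] by (intro norm_add_unimodular_le Gam_comm_ell2 Gam_comm_bound) (auto simp: orient_def)
    finally show "(\<lambda>m. \<i> * of_real (of_int (m j)) * a \<xi> m - a (\<lambda>p. \<i> * of_real (of_int (p j)) * \<xi> p) m) \<in> ell2 X \<and>
      ell2_norm X (\<lambda>m. \<i> * of_real (of_int (m j)) * a \<xi> m - a (\<lambda>p. \<i> * of_real (of_int (p j)) * \<xi> p) m)
        \<le> 2 * Lip * ell2_norm X \<xi>"
      using b by (simp add: b_def partial_def)
  qed
  moreover have "exp (\<i> * of_real (Arg z * of_int l)) = z powi l" for l
  proof -
    have "z powi l = exp (\<i> * of_real (Arg z)) powi l" using z complex_norm_eq_1_exp_eq by metis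
    also have "\<dots> = exp (of_int l * (\<i> * of_real (Arg z)))" by (rule exp_power_int)
    finally show ?thesis by (simp add: mult_ac)
  qed
  ultimately show ?thesis by simp
qed

lemma almost_invariant_finite_coordinate:
  assumes j: "j \<in> {1..d}" and r: "k j = enat r" and z: "norm z = 1" "z ^ r = 1"
  shows "almost_invariant X a (\<lambda>m. z powi m j) (2 * Lip * \<bar>Arg z\<bar>)"
proof -
  note U = U_unitary[OF f_in[OF j]]
  have r0: "0 < r" using k_ge[of j] j d_le r by (auto simp: numeral_eq_enat)
  define \<kappa> where "\<kappa> = of_nat r / (2 * \<i> * of_real pi)"
  have \<kappa>: "\<kappa> \<noteq> 0" using r0 by (simp add: \<kappa>_def)
  \<comment> \<open>A right action is a combination of operators \<open>J U J\<close>, with which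
    \<open>a\<close> commutes; in a commutator with \<open>a\<close> it therefore cancels.\<close>
  have right: "commutes_on X a (\<lambda>\<zeta>. right_act G \<zeta> (lincomb w (Ug (f j)) w' (Ug' (f j))))" for w w'
  proof -
    have m: "unit_vec d' (f j) \<in> X" by (rule unit_vec_carrier[OF f_in[OF j]])
    have "commutes_on X a (lincomb w (conjJ G (Ug' (f j))) w' (conjJ G (Ug (f j))))"
      unfolding U_def
      by (intro commutes_on_lincomb a_bop tw.conjJ_bop tw.W_bop frakA_commutes(4)[OF a_frakA] tw.inv_closed m)
    then show ?thesis
      unfolding commutes_on_def by (simp add: right_act_lincomb[OF j] bop_ell2[OF a_bop])
  qed
  have Gam_comm_Z: "(\<lambda>m. w0 * vec_comm G Z (a \<xi>) m - a (\<lambda>m. w0 * vec_comm G Z \<xi> m) m) =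
      (\<lambda>m. w0 * (Z (a \<xi>) m - a (Z \<xi>) m))"
    if Z: "Z = lincomb w (Ug (f j)) w' (Ug' (f j))" and \<xi>: "\<xi> \<in> ell2 X" for w0 w w' Z \<xi>
  proof -
    have Zb: "Z \<in> bop X" unfolding Z by (rule lincomb_U_bop[OF j])
    have E: "a (vec_comm G Z \<xi>) = (\<lambda>m. a (Z \<xi>) m - right_act G (a \<xi>) Z m)"
      unfolding vec_comm_def bop_diff[OF a_bop bop_ell2[OF Zb \<xi>] right_act_bop[OF Zb \<xi>]]
      using right[of w w'] \<xi> by (simp add: commutes_on_def Z)
    show ?thesis unfolding bop_smult[OF a_bop] E by (simp add: vec_comm_def algebra_simps)
  qed
  define T where "T = lincomb 1 (Ug (f j) \<circ> a) (- 1) (a \<circ> Ug (f j))"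
  have T: "T \<in> bop X" unfolding T_def by (intro bop_lincomb bop_comp a_bop unitary_pairD(2)[OF U])
  have T_fin: "ell2_norm X (T \<xi>) \<le> 2 * Lip * (2 * pi / r) * ell2_norm X \<xi>" if \<xi>: "\<xi> \<in> fin_supp X" for \<xi>
  proof -
    have \<xi>2: "\<xi> \<in> ell2 X" by (rule fin_supp_ell2[OF \<xi>])
    have X: "Gam_comm (d + j) \<xi> = (\<lambda>m. \<kappa> * (Xop d' f k \<sigma> j (a \<xi>) m - a (Xop d' f k \<sigma> j \<xi>) m))"
      unfolding Gam_comm_def Gam_cases(4)[OF j r] \<kappa>_def by (rule Gam_comm_Z[OF Xop_eq[OF j] \<xi>2])
    have Y: "Gam_comm j \<xi> = (\<lambda>m. (- \<kappa>) * (Yop d' f k \<sigma> j (a \<xi>) m - a (Yop d' f k \<sigma> j \<xi>) m))"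
      using Gam_comm_Z[OF Yop_eq[OF j] \<xi>2, of "- \<kappa>"] unfolding Gam_comm_def Gam_cases(2)[OF j r]
      by (simp add: \<kappa>_def)
    have aU: "a (Ug (f j) \<xi>) = (\<lambda>m. a (Xop d' f k \<sigma> j \<xi>) m + of_int (orient j) * \<i> * a (Yop d' f k \<sigma> j \<xi>) m)"
    proof -
      have "Ug (f j) \<xi> = (\<lambda>m. Xop d' f k \<sigma> j \<xi> m + of_int (orient j) * \<i> * Yop d' f k \<sigma> j \<xi> m)"
        by (rule ext) (rule U_from_XY[OF j])
      then show ?thesis
        using \<xi>2 by (simp add: bop_add[OF a_bop] bop_smult[OF a_bop] ell2_smult bop_ell2[OF Xop_bop[OF j]]
            bop_ell2[OF Yop_bop[OF j]])
    qed
    have mem: "(\<lambda>m. Gam_comm (d + j) \<xi> m + (- of_int (orient j) * \<i>) * Gam_comm j \<xi> m) \<in> ell2 X"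
      by (intro ell2_add(1) ell2_smult(1) Gam_comm_ell2[OF \<xi>] Gam_comm_indices[OF j])
    \<comment> \<open>\<open>Gam j\<close> carries -\<kappa> with \<open>Yop\<close> and
      \<open>Gam (d + j)\<close> carries \<kappa> with \<open>Xop\<close>, so the minus sign on the
      second term rebuilds \<kappa> times the commutator of X + i (orient) Y, which is
      \<open>Ug (f j)\<close>.\<close>
    have "T \<xi> m = inverse \<kappa> * (Gam_comm (d + j) \<xi> m + (- of_int (orient j) * \<i>) * Gam_comm j \<xi> m)" for m
      unfolding X Y T_def lincomb_def o_apply aU U_from_XY[OF j, of "a \<xi>"]
      using \<kappa> by (simp add: field_simps)
    then have "T \<xi> = (\<lambda>m. inverse \<kappa> * (Gam_comm (d + j) \<xi> m + (- of_int (orient j) * \<i>) * Gam_comm j \<xi> m))"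
      by (rule ext)
    then have "ell2_norm X (T \<xi>) =
        norm (inverse \<kappa>) * ell2_norm X (\<lambda>m. Gam_comm (d + j) \<xi> m + (- of_int (orient j) * \<i>) * Gam_comm j \<xi> m)"
      using ell2_smult(2)[OF mem] by simp
    also have "\<dots> \<le> norm (inverse \<kappa>) * (2 * (Lip * ell2_norm X \<xi>))"
      using \<xi> Gam_comm_indices[OF j]
      by (intro mult_left_mono norm_add_unimodular_le Gam_comm_ell2 Gam_comm_bound) (auto simp: orient_def)
    also have "norm (inverse \<kappa>) = 2 * pi / r" by (simp add: \<kappa>_def norm_inverse norm_divide norm_mult)
    finally show ?thesis by (simp add: mult_ac)
  qed
  have base: "almost_invariant X a (\<lambda>m. phase j powi m j) (2 * Lip * (2 * pi / r))"
    unfolding almost_invariant_def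
  proof
    fix \<eta> :: "(nat \<Rightarrow> int) \<Rightarrow> complex" assume \<eta>: "\<eta> \<in> ell2 X"
    \<comment> \<open>Writing \<eta> as U \<xi> and using that \<open>a\<close> commutes with the
      diagonal inverse times U, the rotated copy of \<open>a\<close> sends \<eta> to U a \<xi>. Its
      difference from \<open>a \<eta>\<close> is \<open>T \<xi>\<close> up to sign.\<close>
    define \<xi> where "\<xi> = Ug' (f j) \<eta>"
    let ?D = "diag X (\<lambda>m. phase j powi m j)" and ?D' = "diag X (\<lambda>m. cnj (phase j powi m j))"
    have \<xi>: "\<xi> \<in> ell2 X" unfolding \<xi>_def by (rule bop_ell2[OF unitary_pairD(3)[OF U] \<eta>])
    have U\<xi>: "Ug (f j) \<xi> = \<eta>" unfolding \<xi>_def by (rule unitary_pairD(4)[OF U \<eta>])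
    have a\<xi>: "Ug (f j) (a \<xi>) \<in> ell2 X" by (intro bop_ell2[OF unitary_pairD(2)[OF U]] bop_ell2[OF a_bop] \<xi>)
    have "a (Vop j \<xi>) = Vop j (a \<xi>)"
      using frakA_commutes(2)[OF a_frakA j] \<xi> by (simp add: commutes_on_def)
    then have "a (?D' \<eta>) = ?D' (Ug (f j) (a \<xi>))" by (simp add: Vop_def U\<xi>)
    then have "?D (a (?D' \<eta>)) = Ug (f j) (a \<xi>)" using unitary_pairD(4)[OF diag_phase a\<xi>] by simp
    then have "ell2_norm X (\<lambda>m. a \<eta> m - ?D (a (?D' \<eta>)) m) = ell2_norm X (T \<xi>)"
      using ell2_norm_minus_commute[of X "a \<eta>" "Ug (f j) (a \<xi>)"] by (simp add: T_def lincomb_def U\<xi>)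
    also have "\<dots> \<le> 2 * Lip * (2 * pi / r) * ell2_norm X \<xi>"
      using Lip_nonneg j by (intro bop_le_by_fin_supp[OF T _ T_fin \<xi>]) auto
    also have "ell2_norm X \<xi> = ell2_norm X \<eta>"
      unfolding \<xi>_def by (rule unitary_norm[OF unitary_pair_sym[OF U] \<eta>])
    finally show "ell2_norm X (\<lambda>m. a \<eta> m - ?D (a (?D' \<eta>)) m) \<le> 2 * Lip * (2 * pi / r) * ell2_norm X \<eta>" .
  qed
  obtain l where l: "z = exp (2 * \<i> * of_real pi / of_nat r) powi l"
    "\<bar>Arg z\<bar> = of_int \<bar>l\<bar> * (2 * pi / of_nat r)"
    using root_of_unity_Arg[OF z(2,1) r0] .
  \<comment> \<open>The sign occurs in the phase and again in the exponent, so it squares to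
    1.\<close>
  have zl: "z = phase j powi (orient j * l)"
    using r unfolding l(1) phase_def by (auto simp: exp_power_int orient_def)
  have "almost_invariant X a (\<lambda>m. (phase j powi m j) powi (orient j * l))
      (of_int \<bar>orient j * l\<bar> * (2 * Lip * (2 * pi / r)))"
    by (rule almost_invariant_power_int[OF a_bop _ base]) (simp add: norm_power_int norm_phase)
  moreover have "(phase j powi m j) powi (orient j * l) = z powi m j" for m
    unfolding zl by (simp add: power_int_mult[symmetric] mult.commute)
  moreover have "of_int \<bar>orient j * l\<bar> * (2 * Lip * (2 * pi / r)) = 2 * Lip * \<bar>Arg z\<bar>"
    unfolding l(2) by (simp add: orient_def abs_mult)
  ultimately show ?thesis by simp
qed

section \<open>All coordinates together\<close>

lemma dual_action_bound:
  assumes z: "z \<in> Ugrp d k"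
  shows "opnorm X (ell2 X) (\<lambda>\<xi> m. a \<xi> m - dual_action d' k (pad 1 d d' z) a \<xi> m) \<le> 2 * slen d z * Lip"
proof -
  have nz: "norm (z j) = 1" if "j \<in> {1..d}" for j
    using z that by (auto simp: Ugrp_def dest!: PiE_mem[of z _ _ j])
  have len: "slen d z = (\<Sum>j\<in>{1..d}. \<bar>Arg (z j)\<bar>)" by (rule slen_eq_Arg) (rule nz)
  have coordinate: "almost_invariant X a (\<lambda>m. z j powi m j) (2 * Lip * \<bar>Arg (z j)\<bar>)" if j: "j \<in> {1..d}" for j
  proof (cases "k j")
    case (enat r)
    then have "z j ^ r = 1" using z j by (auto simp: Ugrp_def)
    then show ?thesis by (rule almost_invariant_finite_coordinate[OF j enat nz[OF j]])
  qed (use almost_invariant_infinite_coordinate[OF j _ nz[OF j]] in auto)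
  have "almost_invariant X a (monomial d' (pad 1 d d' z)) (\<Sum>j\<in>{1..d}. 2 * Lip * \<bar>Arg (z j)\<bar>)"
    by (rule almost_invariant_pad[OF a_bop d_le]) (auto intro: nz coordinate)
  also have "(\<Sum>j\<in>{1..d}. 2 * Lip * \<bar>Arg (z j)\<bar>) = 2 * slen d z * Lip"
    unfolding len by (simp add: sum_distrib_left sum_distrib_right mult_ac)
  finally have inv: "almost_invariant X a (monomial d' (pad 1 d d' z)) (2 * slen d z * Lip)" .
  have dual: "dual_action d' k (pad 1 d d' z) a =
      (\<lambda>\<xi>. diag X (monomial d' (pad 1 d d' z)) (a (diag X (\<lambda>m. cnj (monomial d' (pad 1 d d' z) m)) \<xi>)))"
    by (simp add: dual_action_def vop_def diag_def cnj_monomial fun_eq_iff)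
  have slen: "0 \<le> 2 * slen d z * Lip"
  proof (cases "d = 0")
    case True
    then have "slen d z = 0" unfolding len by simp
    then show ?thesis by simp
  qed (use Lip_nonneg in \<open>auto simp: len sum_nonneg\<close>)
  show ?thesis
    unfolding opnorm_def
  proof (rule cSup_least)
    fix x assume "x \<in> {ell2_norm X (\<lambda>m. a \<xi> m - dual_action d' k (pad 1 d d' z) a \<xi> m) |\<xi>.
      \<xi> \<in> ell2 X \<and> ell2_norm X \<xi> \<le> 1}"
    then obtain \<xi> where x: "x = ell2_norm X (\<lambda>m. a \<xi> m - dual_action d' k (pad 1 d d' z) a \<xi> m)"
      and \<xi>: "\<xi> \<in> ell2 X" "ell2_norm X \<xi> \<le> 1" by blast
    have "x \<le> 2 * slen d z * Lip * ell2_norm X \<xi>"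
      using inv \<xi>(1) unfolding x dual almost_invariant_def by blast
    also have "\<dots> \<le> 2 * slen d z * Lip" using mult_left_mono[OF \<xi>(2) slen] by simp
    finally show "x \<le> 2 * slen d z * Lip" .
  \<comment> \<open>The zero vector shows that the set under the supremum is nonempty.\<close>
  qed (auto intro!: exI[of _ "\<lambda>_. 0"])
qed

end

theorem corollary3p19:
  fixes d d' :: nat and f :: "nat \<Rightarrow> nat"
    and k k' :: "enat \<Rightarrow> nat \<Rightarrow> enat"
    and \<sigma> \<sigma>' :: "enat \<Rightarrow> (nat \<Rightarrow> int) \<times> (nat \<Rightarrow> int) \<Rightarrow> complex"
    and c :: "(nat set \<Rightarrow> complex) \<Rightarrow> complex^'s^'s"
  assumes "2 \<le> d" and "d \<le> d'"
    and "f permutes {1..d'}" and "f \<circ> f = id" and "\<forall>j\<in>{1..d'}. f j \<noteq> j"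
    and "{d + 1..d'} \<subseteq> f ` {1..d}"
    and "\<forall>n. (k n, \<sigma> n) \<in> Xi d"
    and "\<forall>n. (k' n, \<sigma>' n) \<in> Xi d'"
    and "limitin (Xi_topology d) (\<lambda>i::nat. (k (enat i), \<sigma> (enat i))) (k \<infinity>, \<sigma> \<infinity>) sequentially"
    and "k \<infinity> = infty_vec d"
    and "limitin (Xi_topology d') (\<lambda>i::nat. (k' (enat i), \<sigma>' (enat i))) (k' \<infinity>, \<sigma>' \<infinity>) sequentially"
    and "k' \<infinity> = infty_vec d'"
    and "\<forall>j\<in>{1..d}. (\<forall>i::nat. k (enat i) j < \<infinity>) \<or> (\<forall>i::nat. k (enat i) j = \<infinity>)"
    and "\<forall>n. \<forall>j\<in>{1..d}. k' n (f j) = k' n j \<and> k' n j = k n j"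
    and "\<forall>n. \<forall>x\<in>carrier (Zgrp d (k n)). \<forall>y\<in>carrier (Zgrp d (k n)).
           \<sigma> n (x, y) = \<sigma>' n (pad 0 d d' x, pad 0 d d' y)"
    and "\<forall>n. \<forall>j\<in>{1..d}. \<forall>s\<in>{1..d'}.
           U d' (k' n) (\<sigma>' n) (f j) \<circ> U d' (k' n) (\<sigma>' n) s =
           (\<lambda>\<xi> m. (case k n j of
                     enat r \<Rightarrow> if s = j
                       then exp ((if j < f j then 1 else - 1) * 2 * \<i> * of_real pi / of_nat r)
                       else 1
                   | \<infinity> \<Rightarrow> 1) *
             (U d' (k' n) (\<sigma>' n) s \<circ> U d' (k' n) (\<sigma>' n) (f j)) \<xi> m)"
    and "faithful_cliff_rep (d + d') c"
  shows "\<forall>n. \<forall>a\<in>dom_L d d' f c (k' n) (\<sigma>' n). \<forall>z\<in>Ugrp d (k n).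
           opnorm (carrier (Zgrp d' (k' n))) (ell2 (carrier (Zgrp d' (k' n))))
             (\<lambda>\<xi> m. a \<xi> m - dual_action d' (k' n) (pad 1 d d' z) a \<xi> m)
           \<le> 2 * slen d z * L d d' f c (k' n) (\<sigma>' n) a"
proof (intro allI ballI)
  fix n a z
  assume a: "a \<in> dom_L d d' f c (k' n) (\<sigma>' n)" and z: "z \<in> Ugrp d (k n)"
  have kk: "k' n j = k n j" if "j \<in> {1..d}" for j using assms(14) that by blast
  interpret dirac_setting d d' f "k' n" "\<sigma>' n" c
  proof
    show "f j \<in> {1..d'}" if "j \<in> {1..d}" for j
      using that assms(2) permutes_in_image[OF assms(3), of j] by auto
  qed (use assms(2,8,16,17) kk in simp_all)
  interpret lipschitz_element d d' f "k' n" "\<sigma>' n" c a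
    by standard (rule a)
  \<comment> \<open>The two tori have the same orders in the first \<open>d\<close> coordinates,
    which are the only ones \<open>Ugrp d\<close> looks at.\<close>
  have "z \<in> Ugrp d (k' n)" using z kk by (auto simp: Ugrp_def)
  then show "opnorm (carrier (Zgrp d' (k' n))) (ell2 (carrier (Zgrp d' (k' n))))
      (\<lambda>\<xi> m. a \<xi> m - dual_action d' (k' n) (pad 1 d d' z) a \<xi> m)
      \<le> 2 * slen d z * L d d' f c (k' n) (\<sigma>' n) a"
    by (rule dual_action_bound)
qed

end
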